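(* Let $\alpha\in(0,1]$, let $\gamma=\sup\{i\alpha:i\in\mathbb N,\ i\alpha\le1\}$ and let $q'>\lfloor\gamma/\alpha\rfloor\ge1$. Let $(\mathbf p,\mathbf q)$ be the dual integrability functional on $\mathscr F^{\gamma,\alpha,\alpha}$ with $q[T]_h=q'/|h|$ for $h\in H^T$. Let $\mu$ be a probability measure on $C^1([0,1];\mathbb R^d)$ with finite moment of order $q'$ (for the norm $\|x\|_1=|x_0|+\sup_s|x'_s|$), let $N\in\mathbb N$, and let $(\Omega,\mathcal F,\mathbb P)$ be a probability space carrying random variables $W^{1,N},\dots,W^{N,N}:\Omega\to C^1([0,1];\mathbb R^d)$, each with law $\mu$. Let $\nu$ be the uniform measure on $\{1,\dots,N\}$. For $\omega\in\Omega$ and $s,t\in[0,1]$ let $\mathcal I_{s,t}^{\gamma,\alpha}[\mu](\omega)$ be the family $\big((i,\iota_{H^T})\mapsto\mathcal I_{s,t}^{i,T}(\omega)(\iota_{H^T})\big)_{T\in\mathscr F_0^{\gamma,\alpha,\alpha}}$, where the functions $\mathcal I_{s,t}^{i,T}(\omega):\{1,\dots,N\}^{\times|H^T|}\to(\mathbb R^d)^{\otimes|\mathscr N^T|}$ are determined inductively by $\mathcal I^{i,\mathbf 1}_{s,t}=1$ and $$\mathcal I_{s,t}^{i,\lfloor\mathbf 1\rfloor}(\omega)=W^{i,N}_{s,t}(\omega)=W^{i,N}_t(\omega)-W^{i,N}_s(\omega),$$ $$\mathcal I_{s,t}^{i,T_1\circledast T_2}(\omega)(\iota_{H^{T_1}},\iota_{H^{T_2}})=\mathcal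 I_{s,t}^{i,T_1}(\omega)(\iota_{H^{T_1}})\otimes\mathcal I_{s,t}^{i,T_2}(\omega)(\iota_{H^{T_2}}),$$ $$\mathcal I_{s,t}^{i,\mathcal E[T]}(\omega)(\iota_{h_0^T},\iota_{H^T})=\mathcal I_{s,t}^{\iota_{h_0^T},T}(\omega)(\iota_{H^T})\quad(h_0^T\neq\emptyset),$$ $$\mathcal I_{s,t}^{i,\lfloor T\rfloor}(\omega)(\iota_{H^T})=\int_s^t\mathcal I_{s,r}^{i,T}(\omega)(\iota_{H^T})\otimes dW_r^{i,N}(\omega).$$ Then, for $\mathbb P$-almost every $\omega$, the path $t\mapsto\mathcal I^{\gamma,\alpha}_{0,t}[\mu](\omega)$ takes values in the group $G_{\mathbf q}^{\gamma,\alpha,\alpha}$ of McKean–Vlasov characters over the probability space $(\{1,\dots,N\},\nu)$, and for all $s,t,u\in[0,1]$ $$\mathcal I_{s,t}^{\gamma,\alpha}[\mu](\omega)\ast\mathcal I_{t,u}^{\gamma,\alpha}[\mu](\omega)=\mathcal I_{s,u}^{\gamma,\alpha}[\mu](\omega).$$ As such, the path $t\mapsto\mathcal I^{\gamma,\alpha}_{0,t}[\mu](\omega)$ is, for $\mathbb P$-a.e. $\omega$, a McKean–Vlasov probabilistic rough path (with parameters $\alpha=\beta$) over $(\{1,\dots,N\},\nu)$.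
   Context: **Lions forests.** A directed forest $(\mathscr N,\mathscr E)$ is a finite node set $\mathscr N$ with $\mathscr E\subseteq\mathscr N\times\mathscr N$ such that every connected component is a tree with all edges pointing towards a single root. The depth of a node is the number of nodes on its unique path to a root; write $x\le y$ if $\mathrm{depth}(x)\le\mathrm{depth}(y)$ and $x<y$ if the inequality is strict. A Lions forest is $T=(\mathscr N,\mathscr E,h_0,H)$ where $\mathscr N\neq\emptyset$, $(\mathscr N,\mathscr E)$ is a directed forest, $h_0\subseteq\mathscr N$ (possibly empty), $H$ is a partition of $\mathscr N\setminus h_0$ and, with $H'=(H\cup\{h_0\})\setminus\{\emptyset\}$: (i) if $h_0\ne\emptyset$ there is $x\in h_0$ with $x\le y$ for all $y\in\mathscr N$; (ii) if $h\in H'$, $x,y\in h$ and $x<y$, there is $z\in h$ with $(y,z)\in\mathscr E$; (iii) if $h\in H'$, $x_1,y_1\in h$ have equal depth, $(x_1,x_2),(y_1,y_2)\in\mathscr E$ and $x_2\ne y_2$, then $x_2,y_2\in h$. $\mathscr F$ is the set of Lions forests, $\mathbf 1$ the empty forest, $\mathscr F_0=\mathscr F\cup\{\mathbf 1\}$. Components of $T$ are written $\mathscr N^T,\mathscr E^T,h_0^T,H^T$. Lions forests are considered up to isomorphism; all families indexed by Lions forests are understood to be compatible with isomorphisms (relabelling of nodes and hyperedges). **Operations and truncation.** $T_1\circledast T_2=(\mathscr N^{T_1}\sqcup\mathscr N^{T_2},\mathscr E^{T_1}\sqcup\mathscr E^{T_2},h_0^{T_1}\sqcup h_0^{T_2},H^{T_1}\sqcup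 H^{T_2})$. Decoupling: $\mathcal E[T]=(\mathscr N^T,\mathscr E^T,\emptyset,(H^T\cup\{h_0^T\})\setminus\{\emptyset\})$. Rooting: $\lfloor T\rfloor$ is obtained by adding one new node $x_0$, edges from every root of $T$ to $x_0$, and replacing $h_0^T$ by $h_0^T\cup\{x_0\}$; $\lfloor\mathbf 1\rfloor$ is the single tagged node. Every Lions forest is obtained from $\mathbf 1$ by these three operations. Put $\mathscr G_{\alpha,\beta}[T]=\alpha|h_0^T|+\beta|\mathscr N^T\setminus h_0^T|$, $\mathscr F^{\gamma,\alpha,\beta}=\{T\in\mathscr F:\mathscr G_{\alpha,\beta}[T]\le\gamma\}$, $\mathscr F_0^{\gamma,\alpha,\beta}=\mathscr F^{\gamma,\alpha,\beta}\cup\{\mathbf 1\}$. **Cuts.** $R\subseteq\mathscr N^T$ is ancestor-closed if $y\in R$ and $(y,z)\in\mathscr E^T$ imply $z\in R$. For $A\subseteq\mathscr N^T$ let $T|_A=(A,\mathscr E^T\cap(A\times A),h_0^T\cap A,\{h\cap A:h\in H^T\}\setminus\{\emptyset\})$; for $R$ ancestor-closed, $T|_R$ and $T|_{\mathscr N^T\setminus R}$ are in $\mathscr F_0$. **Dual integrability functional.** A pair of families $\mathbf p=(p[T])$, $\mathbf q=(q[T])$ indexed by $T\in\mathscr F^{\gamma,\alpha,\beta}$, with $p[T],q[T]\in(1,\infty)^{H^T}$, such that: $1/p[T]_h+1/q[T]_h=1$; $p[T_1\circledast T_2]=(p[T_1],p[T_2])$ and likewise for $q$ whenever $T_1\circledast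 T_2\in\mathscr F^{\gamma,\alpha,\beta}$; and for every $T$, ancestor-closed $R$, $h\in H^T$, with $\Upsilon=T|_{\mathscr N^T\setminus R}$, $Y=T|_R$, one has $1/q[T]_h\ge 1/q[\Upsilon]_{h\cap\mathscr N^\Upsilon}+1/q[Y]_{h\cap\mathscr N^Y}$, where a term is omitted if the corresponding intersection is empty. **McKean–Vlasov characters over a probability space $(\Omega_*,\mathbb P_* )$** (here $\Omega_*=\{1,\dots,N\}$, $\mathbb P_*=\nu$). Families $f=(\langle f,T\rangle)_{T\in\mathscr F_0^{\gamma,\alpha,\beta}}$ of (a.e. classes of) measurable functions $\langle f,T\rangle:\Omega_*\times\Omega_*^{\times|H^T|}\to(\mathbb R^d)^{\otimes|\mathscr N^T|}$ (tensor factors indexed by nodes; in the product and rooting formulas factors are placed at the corresponding nodes), written $\langle f,T\rangle(\omega_0,\omega_{H^T})$, $\omega_{H^T}=(\omega_h)_{h\in H^T}$, such that: $\langle f,T\rangle(\omega_0,\cdot)$ lies for a.e. $\omega_0$ in the mixed-norm space $L^{q[T]}(\Omega_*^{\times|H^T|})$ with exponent $q[T]_h$ in the variable $\omega_h$; $\langle f,\mathbf 1\rangle=1$; $\langle f,T_1\circledast T_2\rangle(\omega_0,\omega_{H^{T_1}},\omega_{H^{T_2}})=\langle f,T_1\rangle(\omega_0,\omega_{H^{T_1}})\otimes\langle f,T_2\rangle(\omega_0,\omega_{H^{T_2}})$ a.s. whenever $T_1\circledast T_2\in\mathscr F^{\gamma,\alpha,\beta}$; for $T$ with $h_0^T\ne\emptyset$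 and $T,\mathcal E[T]\in\mathscr F^{\gamma,\alpha,\beta}$, $\langle f,T\rangle(\omega_{h_0^T},\omega_{H^T})=\langle f,\mathcal E[T]\rangle(\omega_0,\omega_{h_0^T},\omega_{H^T})$ a.s.; and for $h_0^T=\emptyset$, $\langle f,T\rangle$ does not depend on $\omega_0$ a.s. With the convolution $$\langle f\ast g,T\rangle(\omega_0,\omega_{H^T})=\sum_{R\subseteq\mathscr N^T\text{ ancestor-closed}}\langle f,T|_{\mathscr N^T\setminus R}\rangle\otimes^{H^T}\langle g,T|_R\rangle(\omega_0,\omega_{H^T}),$$ where $\otimes^{H^T}$ means that in each factor the variable attached to the hyperedge $h\cap(\mathscr N^T\setminus R)$ (resp. $h\cap R$), $h\in H^T$, is set equal to $\omega_h$ and both factors share $\omega_0$, this set is a group $G_{\mathbf q}^{\gamma,\alpha,\beta}$ with unit $\epsilon$ ($\langle\epsilon,\mathbf 1\rangle=1$, $\langle\epsilon,T\rangle=0$ otherwise). **McKean–Vlasov probabilistic rough path.** With $\gamma=\inf\{\mathscr G_{\alpha,\beta}[T]:T\in\mathscr F,\ \mathscr G_{\alpha,\beta}[T]>1-\alpha\}$ (which for $\alpha=\beta\le1$ equals $\sup\{i\alpha:i\alpha\le1\}$), a path $\mathbf W:[0,1]\to G_{\mathbf q}^{\gamma,\alpha,\beta}$ such that, setting $\mathbf W_{s,t}=(\mathbf W_s)^{-1}\ast\mathbf W_t$, one has $\mathbf W_{s,t}\ast\mathbf W_{t,u}=\mathbf W_{s,u}$ a.s. for all $s,t,u\in[0,1]$,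 and for all $T\in\mathscr F^{\gamma,\alpha,\beta}$, for a.e. $\omega_0$, $$\sup_{s,t\in[0,1]}\frac{\int|\langle\mathbf W_{s,t},T\rangle(\omega_0,\omega_{H^T})|\,d\mathbb P_*^{\times|H^T|}(\omega_{H^T})}{|t-s|^{\mathscr G_{\alpha,\beta}[T]}}<\infty .$$ *)

theory Defs
  imports "HOL-Probability.Probability" "HOL-Algebra.Group"
begin

section \<open>Lions forests\<close>

text \<open>
  Forests are considered up to isomorphism and have finitely many nodes, so it is enough to use
  finite sets of natural numbers as node sets. The components are the nodes, the edges, the tagged
  hyperedge \<open>h\<^sub>0\<close> and the partition \<open>H\<close>. Operations that need disjoint copies or a
  fresh node are used only for node sets that are disjoint, resp. for a node that is fresh.
\<close>

datatype lforest =
  LForest (nodes: "nat set") (edges: "(nat \<times> nat) set") (tagged: "nat set") (hyps: "nat set set")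

definition dwalk :: "(nat \<times> nat) set \<Rightarrow> nat \<Rightarrow> nat list \<Rightarrow> nat \<Rightarrow> bool" where
  "dwalk E x xs y \<longleftrightarrow> xs \<noteq> [] \<and> hd xs = x \<and> last xs = y \<and> successively (\<lambda>a b. (a, b) \<in> E) xs"

definition components :: "nat set \<Rightarrow> (nat \<times> nat) set \<Rightarrow> nat set set" where
  "components N E = {(E \<union> E\<inverse>)\<^sup>* `` {x} | x. x \<in> N}"

text \<open>
  A component is a tree with all edges pointing towards \<open>r\<close> if there is exactly one directed walk
  (nodes may a priori repeat, so this excludes directed cycles as well) from each node to \<open>r\<close>.
\<close>

definition directed_forest :: "nat set \<Rightarrow> (nat \<times> nat) set \<Rightarrow> bool" where
  "directed_forest N E \<longleftrightarrow> finite N \<and> E \<subseteq> N \<times> N \<and>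
     (\<forall>C\<in>components N E. \<exists>r\<in>C. \<forall>x\<in>C. \<exists>!xs. dwalk E x xs r)"

definition roots :: "lforest \<Rightarrow> nat set" where
  "roots T = {x \<in> nodes T. \<forall>y. (x, y) \<notin> edges T}"

definition depth :: "lforest \<Rightarrow> nat \<Rightarrow> nat" where
  "depth T x = length (THE xs. \<exists>r\<in>roots T. dwalk (edges T) x xs r)"

definition all_hyps :: "lforest \<Rightarrow> nat set set" where
  "all_hyps T = (hyps T \<union> {tagged T}) - {{}}"

definition lions_forest :: "lforest \<Rightarrow> bool" where
  "lions_forest T \<longleftrightarrow>
     nodes T \<noteq> {} \<and> directed_forest (nodes T) (edges T) \<and>
     tagged T \<subseteq> nodes T \<and> partition_on (nodes T - tagged T) (hyps T) \<and>
     (tagged T \<noteq> {} \<longrightarrow> (\<exists>x\<in>tagged T. \<forall>y\<in>nodes T. depth T x \<le> depth T y)) \<and>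
     (\<forall>h\<in>all_hyps T. \<forall>x\<in>h. \<forall>y\<in>h. depth T x < depth T y \<longrightarrow> (\<exists>z\<in>h. (y, z) \<in> edges T)) \<and>
     (\<forall>h\<in>all_hyps T. \<forall>x\<^sub>1\<in>h. \<forall>y\<^sub>1\<in>h. \<forall>x\<^sub>2 y\<^sub>2.
        depth T x\<^sub>1 = depth T y\<^sub>1 \<and> (x\<^sub>1, x\<^sub>2) \<in> edges T \<and> (y\<^sub>1, y\<^sub>2) \<in> edges T \<and> x\<^sub>2 \<noteq> y\<^sub>2
        \<longrightarrow> x\<^sub>2 \<in> h \<and> y\<^sub>2 \<in> h)"

definition empty_forest :: lforest where
  "empty_forest = LForest {} {} {} {}"

definition relabel :: "(nat \<Rightarrow> nat) \<Rightarrow> lforest \<Rightarrow> lforest" where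
  "relabel \<phi> T = LForest (\<phi> ` nodes T) (map_prod \<phi> \<phi> ` edges T) (\<phi> ` tagged T) ((`) \<phi> ` hyps T)"

definition fprod :: "lforest \<Rightarrow> lforest \<Rightarrow> lforest" where
  "fprod T\<^sub>1 T\<^sub>2 = LForest (nodes T\<^sub>1 \<union> nodes T\<^sub>2) (edges T\<^sub>1 \<union> edges T\<^sub>2)
     (tagged T\<^sub>1 \<union> tagged T\<^sub>2) (hyps T\<^sub>1 \<union> hyps T\<^sub>2)"

definition decouple :: "lforest \<Rightarrow> lforest" where
  "decouple T = LForest (nodes T) (edges T) {} (all_hyps T)"

definition rooting :: "nat \<Rightarrow> lforest \<Rightarrow> lforest" where
  "rooting x\<^sub>0 T = LForest (insert x\<^sub>0 (nodes T)) (edges T \<union> roots T \<times> {x\<^sub>0})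
     (insert x\<^sub>0 (tagged T)) (hyps T)"

definition grading :: "real \<Rightarrow> real \<Rightarrow> lforest \<Rightarrow> real" where
  "grading \<alpha> \<beta> T = \<alpha> * real (card (tagged T)) + \<beta> * real (card (nodes T - tagged T))"

definition forests :: "real \<Rightarrow> real \<Rightarrow> real \<Rightarrow> lforest set" where
  "forests \<gamma> \<alpha> \<beta> = {T. lions_forest T \<and> grading \<alpha> \<beta> T \<le> \<gamma>}"

definition forests\<^sub>0 :: "real \<Rightarrow> real \<Rightarrow> real \<Rightarrow> lforest set" where
  "forests\<^sub>0 \<gamma> \<alpha> \<beta> = insert empty_forest (forests \<gamma> \<alpha> \<beta>)"

definition ancestor_closed :: "lforest \<Rightarrow> nat set \<Rightarrow> bool" where
  "ancestor_closed T R \<longleftrightarrow> R \<subseteq> nodes T \<and> (\<forall>y z. y \<in> R \<and> (y, z) \<in> edges T \<longrightarrow> z \<in> R)"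

definition subforest :: "lforest \<Rightarrow> nat set \<Rightarrow> lforest" where
  "subforest T A = LForest A (edges T \<inter> A \<times> A) (tagged T \<inter> A) ((\<lambda>h. h \<inter> A) ` hyps T - {{}})"

section \<open>Dual integrability functionals\<close>

definition dual_integrability ::
  "real \<Rightarrow> real \<Rightarrow> real \<Rightarrow> (lforest \<Rightarrow> nat set \<Rightarrow> real) \<Rightarrow> (lforest \<Rightarrow> nat set \<Rightarrow> real) \<Rightarrow> bool" where
  "dual_integrability \<gamma> \<alpha> \<beta> p q \<longleftrightarrow>
     (\<forall>T\<in>forests \<gamma> \<alpha> \<beta>. \<forall>h\<in>hyps T. 1 < p T h \<and> 1 < q T h \<and> 1 / p T h + 1 / q T h = 1) \<and>
     (\<forall>T\<in>forests \<gamma> \<alpha> \<beta>. \<forall>\<phi>. inj_on \<phi> (nodes T) \<longrightarrow>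
        (\<forall>h\<in>hyps T. p (relabel \<phi> T) (\<phi> ` h) = p T h \<and> q (relabel \<phi> T) (\<phi> ` h) = q T h)) \<and>
     (\<forall>T\<^sub>1 T\<^sub>2. lions_forest T\<^sub>1 \<and> lions_forest T\<^sub>2 \<and> nodes T\<^sub>1 \<inter> nodes T\<^sub>2 = {} \<and>
        fprod T\<^sub>1 T\<^sub>2 \<in> forests \<gamma> \<alpha> \<beta> \<longrightarrow>
        (\<forall>h\<in>hyps T\<^sub>1. p (fprod T\<^sub>1 T\<^sub>2) h = p T\<^sub>1 h \<and> q (fprod T\<^sub>1 T\<^sub>2) h = q T\<^sub>1 h) \<and>
        (\<forall>h\<in>hyps T\<^sub>2. p (fprod T\<^sub>1 T\<^sub>2) h = p T\<^sub>2 h \<and> q (fprod T\<^sub>1 T\<^sub>2) h = q T\<^sub>2 h)) \<and>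
     (\<forall>T\<in>forests \<gamma> \<alpha> \<beta>. \<forall>R. ancestor_closed T R \<longrightarrow> (\<forall>h\<in>hyps T.
        1 / q T h \<ge>
          (if h \<inter> (nodes T - R) = {} then 0
           else 1 / q (subforest T (nodes T - R)) (h \<inter> (nodes T - R))) +
          (if h \<inter> R = {} then 0 else 1 / q (subforest T R) (h \<inter> R))))"

section \<open>McKean--Vlasov characters\<close>

text \<open>
  An element of the tensor product of copies of \<open>\<real>\<^sup>d\<close> indexed by a finite set \<open>A\<close> of nodes is given
  by its coordinates: a function of multi-indices \<open>c\<close> that depends only on the restriction
  of \<open>c\<close> to \<open>A\<close>. For disjoint sets of nodes, the tensor product with factors placed at the
  corresponding nodes is then the pointwise product.
\<close>

type_synonym 'd tensor = "(nat \<Rightarrow> 'd) \<Rightarrow> real"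

definition tensors :: "nat set \<Rightarrow> ('d::finite) tensor set" where
  "tensors A = {v. \<forall>c c'. (\<forall>x\<in>A. c x = c' x) \<longrightarrow> v c = v c'}"

definition tprod :: "('d::finite) tensor \<Rightarrow> 'd tensor \<Rightarrow> 'd tensor" where
  "tprod v w = (\<lambda>c. v c * w c)"

definition tnorm :: "nat set \<Rightarrow> ('d::finite) tensor \<Rightarrow> real" where
  "tnorm A v = sqrt (\<Sum>c\<in>A \<rightarrow>\<^sub>E UNIV. (v c)\<^sup>2)"

text \<open>
  The arguments of a family are \<open>T\<close>, \<open>\<omega>\<^sub>0\<close> and \<open>\<omega>\<^sub>H\<close>, the last one an extensional function on
  \<open>hyps T\<close>.
\<close>

type_synonym ('a, 'd) mv_family = "lforest \<Rightarrow> 'a \<Rightarrow> (nat set \<Rightarrow> 'a) \<Rightarrow> 'd tensor"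

abbreviation hyp_space :: "'a measure \<Rightarrow> lforest \<Rightarrow> (nat set \<Rightarrow> 'a) measure" where
  "hyp_space M T \<equiv> Pi\<^sub>M (hyps T) (\<lambda>_. M)"

abbreviation arg_space :: "'a measure \<Rightarrow> lforest \<Rightarrow> ('a \<times> (nat set \<Rightarrow> 'a)) measure" where
  "arg_space M T \<equiv> M \<Otimes>\<^sub>M hyp_space M T"

definition epowr :: "ennreal \<Rightarrow> real \<Rightarrow> ennreal" where
  "epowr x a = (if x = \<infinity> then \<infinity> else ennreal (enn2real x powr a))"

text \<open>
  Iterated norm with the first hyperedge of the list outermost. As the
  order of integration matters for a mixed norm and hyperedges carry no canonical order, members of
  the mixed-norm space are required to have finite norm for every order.
\<close>

fun mixed_norm ::
  "'a measure \<Rightarrow> (nat set \<Rightarrow> real) \<Rightarrow> nat set list \<Rightarrow> ((nat set \<Rightarrow> 'a) \<Rightarrow> ennreal) \<Rightarrow>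
     (nat set \<Rightarrow> 'a) \<Rightarrow> ennreal" where
  "mixed_norm M r [] F \<omega> = F \<omega>"
| "mixed_norm M r (h # hs) F \<omega> =
     epowr (\<integral>\<^sup>+ a. epowr (mixed_norm M r hs F (fun_upd \<omega> h a)) (r h) \<partial>M) (1 / r h)"

definition in_mixed_Lp ::
  "'a measure \<Rightarrow> lforest \<Rightarrow> (nat set \<Rightarrow> real) \<Rightarrow> ((nat set \<Rightarrow> 'a) \<Rightarrow> ('d::finite) tensor) \<Rightarrow> bool" where
  "in_mixed_Lp M T r F \<longleftrightarrow>
     (\<forall>c. (\<lambda>\<omega>. F \<omega> c) \<in> borel_measurable (hyp_space M T)) \<and>
     (\<forall>hs. distinct hs \<and> set hs = hyps T \<longrightarrow>
        mixed_norm M r hs (\<lambda>\<omega>. ennreal (tnorm (nodes T) (F \<omega>))) (\<lambda>_. undefined) < \<infinity>)"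

definition mv_characters ::
  "'a measure \<Rightarrow> real \<Rightarrow> real \<Rightarrow> real \<Rightarrow> (lforest \<Rightarrow> nat set \<Rightarrow> real) \<Rightarrow>
     ('a, 'd::finite) mv_family set" where
  "mv_characters M \<gamma> \<alpha> \<beta> q = {f.
     (\<forall>T\<in>forests\<^sub>0 \<gamma> \<alpha> \<beta>.
        (\<forall>\<omega>\<^sub>0\<in>space M. \<forall>\<omega>\<in>space (hyp_space M T). f T \<omega>\<^sub>0 \<omega> \<in> tensors (nodes T)) \<and>
        (\<forall>c. (\<lambda>(\<omega>\<^sub>0, \<omega>). f T \<omega>\<^sub>0 \<omega> c) \<in> borel_measurable (arg_space M T)) \<and>
        (AE \<omega>\<^sub>0 in M. in_mixed_Lp M T (q T) (f T \<omega>\<^sub>0))) \<and>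
     (\<forall>T\<in>forests\<^sub>0 \<gamma> \<alpha> \<beta>. \<forall>\<phi>. inj_on \<phi> (nodes T) \<longrightarrow>
        (AE (\<omega>\<^sub>0, \<omega>) in arg_space M (relabel \<phi> T). \<forall>c.
           f (relabel \<phi> T) \<omega>\<^sub>0 \<omega> c = f T \<omega>\<^sub>0 (\<lambda>h\<in>hyps T. \<omega> (\<phi> ` h)) (c \<circ> \<phi>))) \<and>
     (AE (\<omega>\<^sub>0, \<omega>) in arg_space M empty_forest. f empty_forest \<omega>\<^sub>0 \<omega> = (\<lambda>_. 1)) \<and>
     (\<forall>T\<^sub>1 T\<^sub>2. lions_forest T\<^sub>1 \<and> lions_forest T\<^sub>2 \<and> nodes T\<^sub>1 \<inter> nodes T\<^sub>2 = {} \<and>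
        fprod T\<^sub>1 T\<^sub>2 \<in> forests \<gamma> \<alpha> \<beta> \<longrightarrow>
        (AE (\<omega>\<^sub>0, \<omega>) in arg_space M (fprod T\<^sub>1 T\<^sub>2).
           f (fprod T\<^sub>1 T\<^sub>2) \<omega>\<^sub>0 \<omega> =
             tprod (f T\<^sub>1 \<omega>\<^sub>0 (restrict \<omega> (hyps T\<^sub>1))) (f T\<^sub>2 \<omega>\<^sub>0 (restrict \<omega> (hyps T\<^sub>2))))) \<and>
     (\<forall>T\<in>forests \<gamma> \<alpha> \<beta>. tagged T \<noteq> {} \<and> decouple T \<in> forests \<gamma> \<alpha> \<beta> \<longrightarrow>
        (AE (\<omega>\<^sub>0, \<omega>) in arg_space M (decouple T).
           f T (\<omega> (tagged T)) (restrict \<omega> (hyps T)) = f (decouple T) \<omega>\<^sub>0 \<omega>)) \<and>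
     (\<forall>T\<in>forests \<gamma> \<alpha> \<beta>. tagged T = {} \<longrightarrow>
        (AE (\<omega>\<^sub>0, \<omega>\<^sub>0', \<omega>) in M \<Otimes>\<^sub>M arg_space M T. f T \<omega>\<^sub>0 \<omega> = f T \<omega>\<^sub>0' \<omega>))}"

text \<open>
  For \<open>A \<subseteq> nodes T\<close>, the variable attached to the hyperedge \<open>h \<inter> A\<close> of \<open>subforest T A\<close> is \<open>\<omega> h\<close>;
  here \<open>h\<close> is determined by \<open>h \<inter> A \<noteq> {}\<close> since the hyperedges are disjoint.
\<close>

definition hyp_args :: "lforest \<Rightarrow> nat set \<Rightarrow> (nat set \<Rightarrow> 'a) \<Rightarrow> nat set \<Rightarrow> 'a" where
  "hyp_args T A \<omega> = (\<lambda>g\<in>hyps (subforest T A). \<omega> (THE h. h \<in> hyps T \<and> h \<inter> A = g))"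

definition mv_conv ::
  "('a, 'd::finite) mv_family \<Rightarrow> ('a, 'd) mv_family \<Rightarrow> ('a, 'd) mv_family" where
  "mv_conv f g T \<omega>\<^sub>0 \<omega> = (\<lambda>c. \<Sum>R | ancestor_closed T R.
     tprod (f (subforest T (nodes T - R)) \<omega>\<^sub>0 (hyp_args T (nodes T - R) \<omega>))
           (g (subforest T R) \<omega>\<^sub>0 (hyp_args T R \<omega>)) c)"

definition mv_unit :: "('a, 'd::finite) mv_family" where
  "mv_unit T \<omega>\<^sub>0 \<omega> = (\<lambda>c. if T = empty_forest then 1 else 0)"

definition mv_ae_eq ::
  "'a measure \<Rightarrow> real \<Rightarrow> real \<Rightarrow> real \<Rightarrow> ('a, 'd::finite) mv_family \<Rightarrow> ('a, 'd) mv_family \<Rightarrow> bool" where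
  "mv_ae_eq M \<gamma> \<alpha> \<beta> f g \<longleftrightarrow>
     (\<forall>T\<in>forests\<^sub>0 \<gamma> \<alpha> \<beta>. AE (\<omega>\<^sub>0, \<omega>) in arg_space M T. f T \<omega>\<^sub>0 \<omega> = g T \<omega>\<^sub>0 \<omega>)"

definition mv_class ::
  "'a measure \<Rightarrow> real \<Rightarrow> real \<Rightarrow> real \<Rightarrow> (lforest \<Rightarrow> nat set \<Rightarrow> real) \<Rightarrow>
     ('a, 'd::finite) mv_family \<Rightarrow> ('a, 'd) mv_family set" where
  "mv_class M \<gamma> \<alpha> \<beta> q f = {g \<in> mv_characters M \<gamma> \<alpha> \<beta> q. mv_ae_eq M \<gamma> \<alpha> \<beta> f g}"

definition mv_group ::
  "'a measure \<Rightarrow> real \<Rightarrow> real \<Rightarrow> real \<Rightarrow> (lforest \<Rightarrow> nat set \<Rightarrow> real) \<Rightarrow>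
     ('a, 'd::finite) mv_family set monoid" where
  "mv_group M \<gamma> \<alpha> \<beta> q =
     \<lparr>carrier = mv_class M \<gamma> \<alpha> \<beta> q ` mv_characters M \<gamma> \<alpha> \<beta> q,
      monoid.mult = (\<lambda>F G. {k \<in> mv_characters M \<gamma> \<alpha> \<beta> q.
        \<exists>f\<in>F. \<exists>g\<in>G. mv_ae_eq M \<gamma> \<alpha> \<beta> (mv_conv f g) k}),
      one = mv_class M \<gamma> \<alpha> \<beta> q mv_unit\<rparr>"

section \<open>Probabilistic rough paths\<close>

definition mv_gamma :: "real \<Rightarrow> real \<Rightarrow> real" where
  "mv_gamma \<alpha> \<beta> = Inf {grading \<alpha> \<beta> T | T. lions_forest T \<and> grading \<alpha> \<beta> T > 1 - \<alpha>}"

definition mv_increment ::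
  "'a measure \<Rightarrow> real \<Rightarrow> real \<Rightarrow> real \<Rightarrow> (lforest \<Rightarrow> nat set \<Rightarrow> real) \<Rightarrow>
     (real \<Rightarrow> ('a, 'd::finite) mv_family set) \<Rightarrow> real \<Rightarrow> real \<Rightarrow> ('a, 'd) mv_family set" where
  "mv_increment M \<gamma> \<alpha> \<beta> q X s t =
     inv\<^bsub>mv_group M \<gamma> \<alpha> \<beta> q\<^esub> (X s) \<otimes>\<^bsub>mv_group M \<gamma> \<alpha> \<beta> q\<^esub> X t"

text \<open>
  The supremum over \<open>s, t\<close> inside an almost-everywhere statement is read for suitable representatives
  of the increments. In \<^typ>\<open>ennreal\<close>, \<open>0 / 0 = 0\<close> and \<open>a / 0 = \<infinity>\<close> for \<open>a > 0\<close>, so the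
  supremum over all \<open>s, t\<close> makes sense on the diagonal.
\<close>

definition mv_rough_path ::
  "'a measure \<Rightarrow> real \<Rightarrow> real \<Rightarrow> (lforest \<Rightarrow> nat set \<Rightarrow> real) \<Rightarrow>
     (real \<Rightarrow> ('a, 'd::finite) mv_family set) \<Rightarrow> bool" where
  "mv_rough_path M \<alpha> \<beta> q X \<longleftrightarrow>
     (let \<gamma> = mv_gamma \<alpha> \<beta>; G = mv_group M \<gamma> \<alpha> \<beta> q; X' = mv_increment M \<gamma> \<alpha> \<beta> q X in
       (\<forall>t\<in>{0..1}. X t \<in> carrier G) \<and>
       (\<forall>s\<in>{0..1}. \<forall>t\<in>{0..1}. \<forall>u\<in>{0..1}. X' s t \<otimes>\<^bsub>G\<^esub> X' t u = X' s u) \<and>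
       (\<exists>V. (\<forall>s\<in>{0..1}. \<forall>t\<in>{0..1}. V s t \<in> X' s t) \<and>
         (\<forall>T\<in>forests \<gamma> \<alpha> \<beta>. AE \<omega>\<^sub>0 in M.
            (SUP (s, t)\<in>{0..1} \<times> {0..1}.
               (\<integral>\<^sup>+ \<omega>. ennreal (tnorm (nodes T) (V s t T \<omega>\<^sub>0 \<omega>)) \<partial>hyp_space M T) /
                 ennreal (\<bar>t - s\<bar> powr grading \<alpha> \<beta> T)) < \<infinity>)))"

section \<open>The space of continuously differentiable paths\<close>

text \<open>
  Paths on \<open>[0,1]\<close> are extensional functions, so that equality of paths is equality in HOL. The
  distance is \<open>0\<close> off the space because \<^locale>\<open>Metric_space\<close> requires it to be symmetric
  and non-negative everywhere.
\<close>

definition c1_space :: "(real \<Rightarrow> 'v::real_normed_vector) set" where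
  "c1_space = {x \<in> extensional {0..1}. \<exists>x'. continuous_on {0..1} x' \<and>
     (\<forall>t\<in>{0..1}. (x has_vector_derivative x' t) (at t within {0..1}))}"

definition path_deriv :: "(real \<Rightarrow> 'v::real_normed_vector) \<Rightarrow> real \<Rightarrow> 'v" where
  "path_deriv x t = vector_derivative x (at t within {0..1})"

definition c1_norm :: "(real \<Rightarrow> 'v::real_normed_vector) \<Rightarrow> real" where
  "c1_norm x = norm (x 0) + (SUP s\<in>{0..1}. norm (path_deriv x s))"

definition c1_dist :: "(real \<Rightarrow> 'v::real_normed_vector) \<Rightarrow> (real \<Rightarrow> 'v) \<Rightarrow> real" where
  "c1_dist x y =
     (if x \<in> c1_space \<and> y \<in> c1_space then c1_norm (\<lambda>t. x t - y t) else 0)"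

lemma Metric_space_c1: "Metric_space c1_space (c1_dist :: (real \<Rightarrow> 'v::real_normed_vector) \<Rightarrow> _)"
proof -
  have nontriv: "at s within {0..1} \<noteq> bot" if "s \<in> {0..1}" for s :: real
    using that by (auto simp: trivial_limit_within islimpt_Icc)
  have deriv: "(x has_vector_derivative path_deriv x s) (at s within {0..1})"
    and cont: "continuous_on {0..1} (path_deriv x)"
    if "x \<in> c1_space" "s \<in> {0..1}" for x :: "real \<Rightarrow> 'v" and s
  proof -
    obtain x' where c: "continuous_on {0..1} x'"
      and d: "\<And>t. t \<in> {0..1} \<Longrightarrow> (x has_vector_derivative x' t) (at t within {0..1})"
      using \<open>x \<in> c1_space\<close> unfolding c1_space_def by blast
    have eq: "path_deriv x t = x' t" if "t \<in> {0..1}" for t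
      unfolding path_deriv_def by (rule vector_derivative_within[OF nontriv[OF that] d[OF that]])
    show "(x has_vector_derivative path_deriv x s) (at s within {0..1})"
      using d eq \<open>s \<in> {0..1}\<close> by simp
    show "continuous_on {0..1} (path_deriv x)"
      using c eq continuous_on_cong[of "{0..1}" "{0..1}" "path_deriv x" x'] by blast
  qed
  have diff: "path_deriv (\<lambda>t. x t - y t) s = path_deriv x s - path_deriv y s"
    if "x \<in> c1_space" "y \<in> c1_space" "s \<in> {0..1}" for x y :: "real \<Rightarrow> 'v" and s
    unfolding path_deriv_def[of "\<lambda>t. x t - y t"]
    by (intro vector_derivative_within[OF nontriv] has_vector_derivative_diff deriv that)
  have bdd: "bdd_above ((\<lambda>s. norm (path_deriv x s - path_deriv y s)) ` {0..1})"
    if "x \<in> c1_space" "y \<in> c1_space" for x y :: "real \<Rightarrow> 'v"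
    by (intro bounded_imp_bdd_above compact_imp_bounded compact_continuous_image
        continuous_on_norm continuous_on_diff cont[of _ 0] that) auto
  have dist: "c1_dist x y = norm (x 0 - y 0) + (SUP s\<in>{0..1}. norm (path_deriv x s - path_deriv y s))"
    if "x \<in> c1_space" "y \<in> c1_space" for x y :: "real \<Rightarrow> 'v"
    unfolding c1_dist_def c1_norm_def using diff[OF that] that by simp
  have ge: "norm (path_deriv x s - path_deriv y s)
      \<le> (SUP s\<in>{0..1}. norm (path_deriv x s - path_deriv y s))"
    if "x \<in> c1_space" "y \<in> c1_space" "s \<in> {0..1}" for x y :: "real \<Rightarrow> 'v" and s
    using that(3) bdd[OF that(1,2)] by (rule cSUP_upper)
  have ge0: "0 \<le> (SUP s\<in>{0..1}. norm (path_deriv x s - path_deriv y s))"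
    if "x \<in> c1_space" "y \<in> c1_space" for x y :: "real \<Rightarrow> 'v"
    by (rule order_trans[OF norm_ge_zero ge[OF that, of 0]]) simp
  show ?thesis
  proof
    fix x y :: "real \<Rightarrow> 'v"
    show "0 \<le> c1_dist x y"
      by (cases "x \<in> c1_space \<and> y \<in> c1_space") (auto simp: dist ge0, auto simp: c1_dist_def)
    show "c1_dist x y = c1_dist y x"
      by (cases "x \<in> c1_space \<and> y \<in> c1_space")
        (auto simp: dist norm_minus_commute, auto simp: c1_dist_def)
  next
    fix x y :: "real \<Rightarrow> 'v" assume xy: "x \<in> c1_space" "y \<in> c1_space"
    show "c1_dist x y = 0 \<longleftrightarrow> x = y"
    proof
      assume "c1_dist x y = 0"
      then have "norm (x 0 - y 0) + (SUP s\<in>{0..1}. norm (path_deriv x s - path_deriv y s)) = 0"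
        using dist[OF xy] by simp
      then have 0: "x 0 = y 0" and sup0: "(SUP s\<in>{0..1}. norm (path_deriv x s - path_deriv y s)) = 0"
        using ge0[OF xy] by (simp_all add: add_nonneg_eq_0_iff)
      have "((\<lambda>t. x t - y t) has_vector_derivative 0) (at s within {0..1})" if "s \<in> {0..1}" for s
      proof -
        have "path_deriv x s = path_deriv y s" using ge[OF xy that] sup0 by simp
        then show ?thesis
          using has_vector_derivative_diff[OF deriv[OF xy(1) that] deriv[OF xy(2) that]] by simp
      qed
      then obtain c where "\<And>s. s \<in> {0..1} \<Longrightarrow> x s - y s = c"
        using has_vector_derivative_zero_constant[of "{0..1}" "\<lambda>t. x t - y t"] by auto
      then have "x s = y s" if "s \<in> {0..1}" for s
        using 0 that by (metis atLeastAtMost_iff eq_iff_diff_eq_0 order_refl zero_le_one)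
      then show "x = y"
        using xy unfolding c1_space_def by (auto intro: extensionalityI)
    qed (use xy in \<open>simp add: dist\<close>)
  next
    fix x y z :: "real \<Rightarrow> 'v" assume xyz: "x \<in> c1_space" "y \<in> c1_space" "z \<in> c1_space"
    have "(SUP s\<in>{0..1}. norm (path_deriv x s - path_deriv z s))
        \<le> (SUP s\<in>{0..1}. norm (path_deriv x s - path_deriv y s)) +
          (SUP s\<in>{0..1}. norm (path_deriv y s - path_deriv z s))"
    proof (rule cSUP_least)
      fix s :: real assume s: "s \<in> {0..1}"
      have "norm (path_deriv x s - path_deriv z s)
          \<le> norm (path_deriv x s - path_deriv y s) + norm (path_deriv y s - path_deriv z s)"
        by (metis dist_norm dist_triangle)
      then show "norm (path_deriv x s - path_deriv z s) \<le>
          (SUP s\<in>{0..1}. norm (path_deriv x s - path_deriv y s)) +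
          (SUP s\<in>{0..1}. norm (path_deriv y s - path_deriv z s))"
        using ge[OF xyz(1,2) s] ge[OF xyz(2,3) s] by linarith
    qed simp
    moreover have "norm (x 0 - z 0) \<le> norm (x 0 - y 0) + norm (y 0 - z 0)"
      by (metis dist_norm dist_triangle)
    ultimately show "c1_dist x z \<le> c1_dist x y + c1_dist y z"
      using xyz by (simp add: dist)
  qed
qed

definition c1_borel :: "(real \<Rightarrow> 'v::real_normed_vector) measure" where
  "c1_borel = sigma c1_space {U. openin (Metric_space.mtopology c1_space c1_dist) U}"

section \<open>Iterated integrals\<close>

text \<open>
  The inductive characterisation of the iterated integrals of the paths \<open>w 1, \<dots>, w N\<close>.
  Since these are continuously differentiable, integration against \<open>dw\<close> means
  integration against \<open>path_deriv w r dr\<close>; the interval integral is oriented, so \<open>t < s\<close> is allowed.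
\<close>

definition iterated_integrals ::
  "nat \<Rightarrow> real \<Rightarrow> real \<Rightarrow> (nat \<Rightarrow> real \<Rightarrow> real ^ 'd) \<Rightarrow>
     (real \<Rightarrow> real \<Rightarrow> (nat, 'd::finite) mv_family) \<Rightarrow> bool" where
  "iterated_integrals N \<gamma> \<alpha> w I \<longleftrightarrow>
     (\<forall>s\<in>{0..1}. \<forall>t\<in>{0..1}. \<forall>i\<in>{1..N}.
       I s t empty_forest i (\<lambda>_. undefined) = (\<lambda>_. 1) \<and>
       (\<forall>x\<^sub>0. rooting x\<^sub>0 empty_forest \<in> forests \<gamma> \<alpha> \<alpha> \<longrightarrow>
          I s t (rooting x\<^sub>0 empty_forest) i (\<lambda>_. undefined) = (\<lambda>c. (w i t - w i s) $ c x\<^sub>0)) \<and>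
       (\<forall>T\<^sub>1 T\<^sub>2. lions_forest T\<^sub>1 \<and> lions_forest T\<^sub>2 \<and> nodes T\<^sub>1 \<inter> nodes T\<^sub>2 = {} \<and>
          fprod T\<^sub>1 T\<^sub>2 \<in> forests \<gamma> \<alpha> \<alpha> \<longrightarrow>
          (\<forall>\<iota>\<in>hyps (fprod T\<^sub>1 T\<^sub>2) \<rightarrow>\<^sub>E {1..N}.
             I s t (fprod T\<^sub>1 T\<^sub>2) i \<iota> =
               tprod (I s t T\<^sub>1 i (restrict \<iota> (hyps T\<^sub>1))) (I s t T\<^sub>2 i (restrict \<iota> (hyps T\<^sub>2))))) \<and>
       (\<forall>T. lions_forest T \<and> tagged T \<noteq> {} \<and> decouple T \<in> forests \<gamma> \<alpha> \<alpha> \<longrightarrow>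
          (\<forall>\<iota>\<in>hyps (decouple T) \<rightarrow>\<^sub>E {1..N}.
             I s t (decouple T) i \<iota> = I s t T (\<iota> (tagged T)) (restrict \<iota> (hyps T)))) \<and>
       (\<forall>T x\<^sub>0. lions_forest T \<and> x\<^sub>0 \<notin> nodes T \<and> rooting x\<^sub>0 T \<in> forests \<gamma> \<alpha> \<alpha> \<longrightarrow>
          (\<forall>\<iota>\<in>hyps T \<rightarrow>\<^sub>E {1..N}.
             I s t (rooting x\<^sub>0 T) i \<iota> =
               (\<lambda>c. LBINT r=s..t. I s r T i \<iota> c * path_deriv (w i) r $ c x\<^sub>0))))"

end

(*
  Everything holds for every omega. The conditions on a Lions forest can be restated without depths:
  the tagged nodes are closed under passing to the parent, and the nodes of a hyperedge whose parent
  lies outside of it all have the same parent. In this form cuts of Lions forests are Lions forests,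
  and every Lions forest is generated from the empty one by rooting, products and decoupling, so that
  the rules for the iterated integrals allow proofs by induction: this gives continuity in t, the
  bound |I_{s,t}^T| <= (K |t - s|)^|T|, invariance under relabelling and Chen's relation, the rooting
  step of which splits the integral over [s,u] at t.

  On the finite index space almost everywhere means everywhere. By Chen's relation the class of
  I_{s,0} is an inverse of that of I_{0,s}, and inverses are unique because convolution with a
  character can be cancelled. Hence the increments of the path are the classes of I_{s,t}, and
  |t - s|^|T| <= |t - s|^(alpha |T|) on [0,1] gives the regularity.
*)

theory Submission
  imports Defs
begin

section \<open>Structural characterisation of Lions forests\<close>

text \<open>Depth is awkward for cuts: removing an ancestor-closed set shifts depths by amounts that
  differ from node to node, so conditions comparing depths are not visibly inherited by the lower
  part. Parents are local data that survive restriction. Admitting the empty forest keeps all cuts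
  inside the class on which the inductions run.

  Integrals occur with s and t in either order. Replacing each continuous integrand by one
  antiderivative on all of [0,1] turns splitting and linearity into algebra of differences, without
  distinguishing the orders of s, t and u.

  The product in \<open>mv_group\<close> acts on sets of almost everywhere equal characters, and
  neither its associativity nor its closedness is established here. The inverse in the increments is
  a definite description, so its uniqueness is proved directly by cancellation, and Chen's relation
  computes every product that the increments involve.\<close>

definition forest_edges :: "nat set \<Rightarrow> (nat \<times> nat) set \<Rightarrow> bool" where
  "forest_edges N E \<longleftrightarrow> finite N \<and> E \<subseteq> N \<times> N \<and> single_valued E \<and> wf (E\<inverse>)"

lemma dwalk_Cons:
  "dwalk E x xs r \<longleftrightarrow> (xs = [x] \<and> x = r) \<or> (\<exists>y ys. xs = x # ys \<and> (x, y) \<in> E \<and> dwalk E y ys r)"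
proof (cases xs)
  case (Cons a ys)
  then show ?thesis by (cases ys) (auto simp: dwalk_def successively_Cons)
qed (auto simp: dwalk_def)

text \<open>Parents are unique, so the walk is forced, and \<open>wf (E\<inverse>)\<close> makes it
  stop: the induction goes from the parent to the child. Uniqueness concerns the walk alone, its
  endpoint being its last entry; this fits both the tree condition and the description in
  \<open>depth\<close>.\<close>

lemma forest_edges_walk:
  assumes "forest_edges N E" "x \<in> N"
  shows "\<exists>!xs. \<exists>r. r \<in> N \<and> E `` {r} = {} \<and> dwalk E x xs r"
proof -
  have wf: "wf (E\<inverse>)" and sub: "E \<subseteq> N \<times> N" and sv: "single_valued E"
    using assms by (auto simp: forest_edges_def)
  from wf show ?thesis using \<open>x \<in> N\<close>
  proof (induction x rule: wf_induct_rule)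
    case (less x)
    show ?case
    proof (cases "E `` {x} = {}")
      case True
      then show ?thesis using less.prems
        by (subst dwalk_Cons) auto
    next
      case False
      then obtain y where y: "(x, y) \<in> E" by auto
      have uniq: "y' = y" if "(x, y') \<in> E" for y'
        using sv y that by (auto simp: single_valued_def)
      have "\<exists>!ys. \<exists>r. r \<in> N \<and> E `` {r} = {} \<and> dwalk E y ys r"
        by (rule less.IH) (use y sub in auto)
      then obtain ys where ys: "\<exists>r. r \<in> N \<and> E `` {r} = {} \<and> dwalk E y ys r"
        and ysu: "\<And>zs. \<exists>r. r \<in> N \<and> E `` {r} = {} \<and> dwalk E y zs r \<Longrightarrow> zs = ys"
        by blast
      show ?thesis
      proof (rule ex1I[of _ "x # ys"])
        show "\<exists>r. r \<in> N \<and> E `` {r} = {} \<and> dwalk E x (x # ys) r"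
          using ys y by (metis dwalk_Cons)
        fix zs assume "\<exists>r. r \<in> N \<and> E `` {r} = {} \<and> dwalk E x zs r"
        then obtain r where r: "r \<in> N" "E `` {r} = {}" "dwalk E x zs r" by blast
        then have "x \<noteq> r" using y by auto
        then obtain y' zs' where "zs = x # zs'" "(x, y') \<in> E" "dwalk E y' zs' r"
          using r(3) by (subst (asm) dwalk_Cons) auto
        then show "zs = x # ys" using uniq ysu r by blast
      qed
    qed
  qed
qed

text \<open>The unique walk \<open>W x\<close> to the chosen root of the component satisfies
  \<open>W x = x # W y\<close> for every edge (x, y). Its tail determines y, which makes parents
  unique, and its length drops along edges, which excludes infinite ascent. Directed cycles need no
  separate treatment, since walks with repetitions compete for uniqueness.\<close>

lemma forest_edges_if_directed_forest:
  assumes "directed_forest N E"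
  shows "forest_edges N E"
proof -
  have fin: "finite N" and sub: "E \<subseteq> N \<times> N"
    and tree: "\<And>C. C \<in> components N E \<Longrightarrow> \<exists>r\<in>C. \<forall>x\<in>C. \<exists>!xs. dwalk E x xs r"
    using assms by (auto simp: directed_forest_def)
  define comp where "comp x = (E \<union> E\<inverse>)\<^sup>* `` {x}" for x
  have comp: "comp x \<in> components N E" "x \<in> comp x" if "x \<in> N" for x
    using that by (auto simp: comp_def components_def)
  have "\<exists>f. \<forall>C\<in>components N E. \<forall>x\<in>C. \<exists>!xs. dwalk E x xs (f C)"
    using tree by metis
  then obtain f where f': "\<forall>C\<in>components N E. \<forall>x\<in>C. \<exists>!xs. dwalk E x xs (f C)" ..
  have f: "\<exists>!xs. dwalk E x xs (f (comp x))" if "x \<in> N" for x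
    using bspec[OF bspec[OF f' comp(1)[OF that]] comp(2)[OF that]] .
  define W where "W x = (THE xs. dwalk E x xs (f (comp x)))" for x
  have W: "dwalk E x (W x) (f (comp x))" if "x \<in> N" for x
    using theI'[OF f[OF that]] unfolding W_def .
  have W_eq: "xs = W x" if "x \<in> N" "dwalk E x xs (f (comp x))" for x xs
    unfolding W_def using the1_equality[OF f[OF that(1)] that(2)] by (rule sym)
  have comp_eq: "comp x = comp y" if "(x, y) \<in> E" for x y
  proof -
    have "sym (E \<union> E\<inverse>)" by (auto simp: sym_def)
    then have "sym ((E \<union> E\<inverse>)\<^sup>*)" by (rule sym_rtrancl)
    moreover have "(x, y) \<in> (E \<union> E\<inverse>)\<^sup>*" using that by auto
    ultimately show ?thesis unfolding comp_def
      by (auto simp: sym_def intro: rtrancl_trans)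
  qed
  have step: "W x = x # W y" if "(x, y) \<in> E" for x y
  proof -
    have xy: "x \<in> N" "y \<in> N" using that sub by auto
    have "dwalk E x (x # W y) (f (comp x))"
      using W[OF xy(2)] that comp_eq[OF that] by (subst dwalk_Cons) auto
    then show ?thesis using W_eq[OF xy(1)] by simp
  qed
  have sv: "single_valued E"
  proof (rule single_valuedI)
    fix x y z assume xy: "(x, y) \<in> E" and xz: "(x, z) \<in> E"
    then have "W y = W z" using step by (metis list.inject)
    moreover have "hd (W y) = y" "hd (W z) = z" using W xy xz sub by (auto simp: dwalk_def)
    ultimately show "y = z" by metis
  qed
  have "length (W y) < length (W x)" if "(x, y) \<in> E" for x y
    using step[OF that] by simp
  then have "E\<inverse> \<subseteq> Wellfounded.measure (\<lambda>x. length (W x))" by auto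
  then have "wf (E\<inverse>)" by (rule wf_subset[OF wf_measure])
  then show ?thesis using fin sub sv by (simp add: forest_edges_def)
qed

text \<open>The endpoint \<open>rt x\<close> of the walk to a parentless node is the same at both
  ends of an edge, hence constant on a component; it is the root that the component needs.\<close>

lemma directed_forest_if_forest_edges:
  assumes "forest_edges N E"
  shows "directed_forest N E"
proof -
  note walk = forest_edges_walk[OF assms]
  have sub: "E \<subseteq> N \<times> N" and fin: "finite N" using assms by (auto simp: forest_edges_def)
  define W where "W x = (THE xs. \<exists>r. r \<in> N \<and> E `` {r} = {} \<and> dwalk E x xs r)" for x
  have W: "\<exists>r. r \<in> N \<and> E `` {r} = {} \<and> dwalk E x (W x) r" if "x \<in> N" for x
    using theI'[OF walk[OF that]] unfolding W_def .
  have W_eq: "xs = W x" if "x \<in> N" "r \<in> N" "E `` {r} = {}" "dwalk E x xs r" for x xs r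
    unfolding W_def by (rule the1_equality[OF walk[OF that(1)], symmetric]) (use that in blast)
  define rt where "rt x = last (W x)" for x
  have rt: "rt x \<in> N" "E `` {rt x} = {}" "dwalk E x (W x) (rt x)" if "x \<in> N" for x
    using W[OF that] by (auto simp: rt_def dwalk_def)
  have step: "rt x = rt y" if "(x, y) \<in> E" for x y
  proof -
    have xy: "x \<in> N" "y \<in> N" using that sub by auto
    have "dwalk E x (x # W y) (rt y)"
      using rt[OF xy(2)] that by (subst dwalk_Cons) auto
    then have "x # W y = W x" by (rule W_eq[OF xy(1) rt(1,2)[OF xy(2)]])
    then show ?thesis using rt[OF xy(2)] by (metis \<open>dwalk E x (x # W y) (rt y)\<close> dwalk_def rt_def)
  qed
  have conn: "y \<in> N \<and> rt y = rt x" if "(x, y) \<in> (E \<union> E\<inverse>)\<^sup>*" "x \<in> N" for x y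
    using that by (induction rule: rtrancl_induct) (use step sub in auto)
  have reach: "(x, r) \<in> E\<^sup>*" if "dwalk E x xs r" for x xs r
    using that
  proof (induction xs arbitrary: x)
    case Nil then show ?case by (simp add: dwalk_def)
  next
    case (Cons a xs)
    then show ?case
      by (subst (asm) dwalk_Cons) (auto intro: converse_rtrancl_into_rtrancl)
  qed
  have "\<exists>r\<in>C. \<forall>x\<in>C. \<exists>!xs. dwalk E x xs r" if "C \<in> components N E" for C
  proof -
    obtain x where x: "x \<in> N" "C = (E \<union> E\<inverse>)\<^sup>* `` {x}"
      using \<open>C \<in> components N E\<close> unfolding components_def by blast
    show ?thesis
    proof (intro bexI ballI)
      have "(x, rt x) \<in> (E \<union> E\<inverse>)\<^sup>*"
        using reach[OF rt(3)[OF x(1)]] by (rule rtrancl_mono[THEN subsetD, rotated]) auto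
      then show "rt x \<in> C" using x by auto
      fix y assume "y \<in> C"
      then have y: "y \<in> N" "rt y = rt x" using conn x by auto
      show "\<exists>!xs. dwalk E y xs (rt x)"
        unfolding y(2)[symmetric]
        by (rule ex1I[of _ "W y"]) (use rt[OF y(1)] W_eq[OF y(1) rt(1,2)[OF y(1)]] in blast)+
    qed
  qed
  then show ?thesis using sub fin by (simp add: directed_forest_def)
qed

lemma directed_forest_iff: "directed_forest N E \<longleftrightarrow> forest_edges N E"
  using forest_edges_if_directed_forest directed_forest_if_forest_edges by blast

lemma roots_iff: "x \<in> roots T \<longleftrightarrow> x \<in> nodes T \<and> edges T `` {x} = {}"
  by (auto simp: roots_def)

lemma depth_root:
  assumes "x \<in> roots T"
  shows "depth T x = 1"
proof -
  have "(\<exists>r\<in>roots T. dwalk (edges T) x xs r) \<longleftrightarrow> xs = [x]" for xs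
    by (subst dwalk_Cons) (use assms in \<open>auto simp: roots_def\<close>)
  then show ?thesis by (simp add: depth_def)
qed

lemma depth_step:
  assumes "forest_edges (nodes T) (edges T)" "(x, y) \<in> edges T"
  shows "depth T x = Suc (depth T y)"
proof -
  have xy: "x \<in> nodes T" "y \<in> nodes T" using assms by (auto simp: forest_edges_def)
  have walk: "\<exists>!xs. \<exists>r\<in>roots T. dwalk (edges T) z xs r" if "z \<in> nodes T" for z
    using forest_edges_walk[OF assms(1) that] unfolding Bex_def roots_iff by (simp add: conj_assoc)
  let ?W = "\<lambda>z. THE xs. \<exists>r\<in>roots T. dwalk (edges T) z xs r"
  obtain r where r: "r \<in> roots T" "dwalk (edges T) y (?W y) r"
    using theI'[OF walk[OF xy(2)]] by blast
  then have "dwalk (edges T) x (x # ?W y) r" using assms(2) by (subst dwalk_Cons) auto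
  then have "?W x = x # ?W y" using walk[OF xy(1)] r(1) by (intro the1_equality) auto
  then show ?thesis by (simp add: depth_def)
qed

text \<open>
  The forest may be empty. The last two conditions replace the three depth conditions: nonempty
  \<open>tagged T\<close> contains a root, and the nodes of lowest depth of a hyperedge are those whose parent lies
  outside of it.
\<close>

definition lions_forest0 :: "lforest \<Rightarrow> bool" where
  "lions_forest0 T \<longleftrightarrow> forest_edges (nodes T) (edges T) \<and> tagged T \<subseteq> nodes T \<and>
     partition_on (nodes T - tagged T) (hyps T) \<and> edges T `` tagged T \<subseteq> tagged T \<and>
     (\<forall>h\<in>hyps T. \<forall>x\<in>h. \<forall>y\<in>h. edges T `` {x} \<inter> h = {} \<and> edges T `` {y} \<inter> h = {}
        \<longrightarrow> edges T `` {x} = edges T `` {y})"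

text \<open>Cited below as \<open>D\<close> by position: 1 to 9 are the definition unfolded, 10 is
  uniqueness of the parent, 11 to 17 are consequences of finiteness and of the partition.\<close>

lemma lions_forest0D:
  assumes "lions_forest0 T"
  shows "forest_edges (nodes T) (edges T)" "finite (nodes T)" "edges T \<subseteq> nodes T \<times> nodes T"
    "single_valued (edges T)" "wf ((edges T)\<inverse>)" "tagged T \<subseteq> nodes T"
    "partition_on (nodes T - tagged T) (hyps T)" "edges T `` tagged T \<subseteq> tagged T"
    "\<And>h x y. h \<in> hyps T \<Longrightarrow> x \<in> h \<Longrightarrow> y \<in> h \<Longrightarrow> edges T `` {x} \<inter> h = {} \<Longrightarrow>
      edges T `` {y} \<inter> h = {} \<Longrightarrow> edges T `` {x} = edges T `` {y}"
    "\<And>x y z. (x, y) \<in> edges T \<Longrightarrow> (x, z) \<in> edges T \<Longrightarrow> y = z"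
    "finite (tagged T)" "\<And>h. h \<in> hyps T \<Longrightarrow> h \<noteq> {}" "\<And>h. h \<in> hyps T \<Longrightarrow> h \<subseteq> nodes T"
    "\<And>h. h \<in> hyps T \<Longrightarrow> h \<inter> tagged T = {}"
    "\<And>h h'. h \<in> hyps T \<Longrightarrow> h' \<in> hyps T \<Longrightarrow> h \<noteq> h' \<Longrightarrow> h \<inter> h' = {}"
    "\<Union> (hyps T) = nodes T - tagged T" "finite (hyps T)"
proof -
  show *: "forest_edges (nodes T) (edges T)" "finite (nodes T)" "edges T \<subseteq> nodes T \<times> nodes T"
    "single_valued (edges T)" "wf ((edges T)\<inverse>)" "tagged T \<subseteq> nodes T"
    "partition_on (nodes T - tagged T) (hyps T)" "edges T `` tagged T \<subseteq> tagged T"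
    using assms by (simp_all add: lions_forest0_def forest_edges_def)
  show "edges T `` {x} = edges T `` {y}" if "h \<in> hyps T" "x \<in> h" "y \<in> h"
    "edges T `` {x} \<inter> h = {}" "edges T `` {y} \<inter> h = {}" for h x y
    using assms that unfolding lions_forest0_def by blast
  show "\<And>x y z. (x, y) \<in> edges T \<Longrightarrow> (x, z) \<in> edges T \<Longrightarrow> y = z"
    using *(4) by (auto simp: single_valued_def)
  show "finite (tagged T)" using *(2,6) by (rule finite_subset[rotated])
  show U: "\<Union> (hyps T) = nodes T - tagged T" using *(7) by (simp add: partition_on_def)
  then show "\<And>h. h \<in> hyps T \<Longrightarrow> h \<subseteq> nodes T" "\<And>h. h \<in> hyps T \<Longrightarrow> h \<inter> tagged T = {}" by blast+
  show "\<And>h. h \<in> hyps T \<Longrightarrow> h \<noteq> {}" using *(7) by (auto simp: partition_on_def)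
  show "\<And>h h'. h \<in> hyps T \<Longrightarrow> h' \<in> hyps T \<Longrightarrow> h \<noteq> h' \<Longrightarrow> h \<inter> h' = {}"
    using *(7) by (auto simp: partition_on_def disjoint_def)
  show "finite (hyps T)" using *(2,7) finite_elements by blast
qed

text \<open>Climb from x while the parent stays in h; well-foundedness ends the climb at a top of h.
  Tops are the nodes that the last clause of \<open>lions_forest0\<close> compares, and a top of the
  whole node set is a root.\<close>

lemma exists_top:
  assumes "wf (E\<inverse>)" "x \<in> h"
  shows "\<exists>t\<in>h. (x, t) \<in> E\<^sup>* \<and> E `` {t} \<inter> h = {}"
  using assms
proof (induction x rule: wf_induct_rule)
  case (less x)
  show ?case
  proof (cases "E `` {x} \<inter> h = {}")
    case True
    then show ?thesis using less.prems by blast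
  next
    case False
    then obtain y where y: "(x, y) \<in> E" "y \<in> h" by auto
    then obtain t where "t \<in> h" "(y, t) \<in> E\<^sup>*" "E `` {t} \<inter> h = {}" using less.IH[of y] by auto
    then show ?thesis using y(1) by (meson converse_rtrancl_into_rtrancl)
  qed
qed

text \<open>By the second depth condition a node of h deeper than some other node of h has its
  parent in h, so two tops of h have equal depth, and the third condition then gives them the same
  parent. Conversely, tops with the same parent have equal depth, which is the least depth in h
  because climbing only decreases depth; a deeper node is thus no top.\<close>

lemma lions_forest_iff: "lions_forest T \<longleftrightarrow> lions_forest0 T \<and> nodes T \<noteq> {}"
proof
  assume L: "lions_forest T"
  note c = L[unfolded lions_forest_def directed_forest_iff]
  note ne = c[THEN conjunct1]
    and F = c[THEN conjunct2, THEN conjunct1]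
    and tag = c[THEN conjunct2, THEN conjunct2, THEN conjunct1]
    and c' = c[THEN conjunct2, THEN conjunct2, THEN conjunct2]
  note part = c'[THEN conjunct1]
    and i' = c'[THEN conjunct2, THEN conjunct1]
    and ii' = c'[THEN conjunct2, THEN conjunct2, THEN conjunct1]
    and iii' = c'[THEN conjunct2, THEN conjunct2, THEN conjunct2]
  have i: "tagged T \<noteq> {} \<Longrightarrow> \<exists>x\<in>tagged T. \<forall>y\<in>nodes T. depth T x \<le> depth T y"
    using i' by blast
  have ii: "\<exists>z\<in>h. (y, z) \<in> edges T"
    if "h \<in> all_hyps T" "x \<in> h" "y \<in> h" "depth T x < depth T y" for h x y
    using ii' that by blast
  have iii: "x' \<in> h \<and> y' \<in> h"
    if "h \<in> all_hyps T" "x \<in> h" "y \<in> h" "depth T x = depth T y"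
       "(x, x') \<in> edges T" "(y, y') \<in> edges T" "x' \<noteq> y'" for h x y x' y'
    using iii' that by blast
  have wf: "wf ((edges T)\<inverse>)" and sv: "single_valued (edges T)"
    and sub: "edges T \<subseteq> nodes T \<times> nodes T" using F by (auto simp: forest_edges_def)
  note step = depth_step[OF F]
  obtain r where r: "r \<in> roots T"
  proof -
    obtain x where "x \<in> nodes T" using ne by auto
    then obtain t where "t \<in> nodes T" "edges T `` {t} \<inter> nodes T = {}" using exists_top[OF wf] by blast
    then have "t \<in> roots T" using sub by (auto simp: roots_def)
    then show thesis by (rule that)
  qed
  have pos: "depth T x \<ge> 1" if "x \<in> nodes T" for x
    using that step depth_root[of x T] by (cases "x \<in> roots T") (auto simp: roots_def)
  have "y \<in> tagged T" if x: "x \<in> tagged T" and y: "(x, y) \<in> edges T" for x y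
  proof -
    obtain t where t: "t \<in> tagged T" "\<And>y. y \<in> nodes T \<Longrightarrow> depth T t \<le> depth T y" using i x by blast
    \<comment> \<open>Depth counts nodes, so a root has depth 1, which bounds the least depth. As x
      has a parent, its depth is at least 2, and the second depth condition applies to t and
      x.\<close>
    then have "depth T t \<le> 1" using r depth_root[OF r] by (metis roots_iff)
    moreover have "y \<in> nodes T" using y sub by auto
    ultimately have "depth T t < depth T x" using step[OF y] pos[of y] by simp
    moreover have "tagged T \<in> all_hyps T" using x by (auto simp: all_hyps_def)
    ultimately obtain z where "z \<in> tagged T" "(x, z) \<in> edges T" using ii t x by blast
    then show ?thesis using sv y by (auto simp: single_valued_def)
  qed
  moreover have "edges T `` {x} = edges T `` {y}"
    if h: "h \<in> hyps T" "x \<in> h" "y \<in> h" and top: "edges T `` {x} \<inter> h = {}" "edges T `` {y} \<inter> h = {}"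
    for h x y
  proof -
    have hh: "h \<in> all_hyps T" using h by (auto simp: all_hyps_def)
    have xy: "x \<in> nodes T" "y \<in> nodes T" using h part by (auto simp: partition_on_def)
    have eq: "depth T x = depth T y"
    proof (rule linorder_cases[of "depth T x" "depth T y"])
      assume "depth T x < depth T y"
      from ii[OF hh h(2,3) this] show ?thesis using top by blast
    next
      assume "depth T y < depth T x"
      from ii[OF hh h(3,2) this] show ?thesis using top by blast
    qed
    have root: "edges T `` {x} = {} \<longleftrightarrow> depth T x = 1" if "x \<in> nodes T" for x
    proof
      assume "depth T x = 1"
      then show "edges T `` {x} = {}"
        using step pos sub by (metis Image_singleton_iff One_nat_def Suc_le_eq SigmaE2 less_Suc0 less_irrefl
          not_less_eq_eq subsetD empty_iff equals0I)
    qed (use depth_root[of x T] that in \<open>auto simp: roots_def\<close>)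
    show ?thesis
    proof (cases "edges T `` {x} = {}")
      case True
      then show ?thesis using root[OF xy(1)] root[OF xy(2)] eq by metis
    next
      case False
      moreover from this have "edges T `` {y} \<noteq> {}" using root[OF xy(1)] root[OF xy(2)] eq by metis
      ultimately obtain x2 y2 where 2: "(x, x2) \<in> edges T" "(y, y2) \<in> edges T" by blast
      then have "x2 = y2" using iii[OF hh h(2,3) eq 2] top by auto
      then show ?thesis using 2 sv by (auto simp: single_valued_def)
    qed
  qed
  ultimately show "lions_forest0 T \<and> nodes T \<noteq> {}" using F tag part ne unfolding lions_forest0_def by blast
next
  assume "lions_forest0 T \<and> nodes T \<noteq> {}"
  then have S: "lions_forest0 T" and ne: "nodes T \<noteq> {}" by auto
  note D = lions_forest0D[OF S]
  note step = depth_step[OF D(1)]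
  have pos: "depth T x \<ge> 1" if "x \<in> nodes T" for x
    using that step depth_root[of x T] by (cases "x \<in> roots T") (auto simp: roots_def)
  have tops: "edges T `` {x} = edges T `` {y}"
    if "h \<in> all_hyps T" "x \<in> h" "y \<in> h" "edges T `` {x} \<inter> h = {}" "edges T `` {y} \<inter> h = {}" for h x y
  \<comment> \<open>The tagged set is closed under parents, so a top of it has no parent at all and
    both images are empty.\<close>
  proof (cases "h \<in> hyps T")
    case False
    then have "h = tagged T" using that by (auto simp: all_hyps_def)
    then show ?thesis using that D(8) by blast
  qed (use D(9) that in blast)
  have ii: "\<exists>z\<in>h. (y, z) \<in> edges T"
    if h: "h \<in> all_hyps T" "x \<in> h" "y \<in> h" and xy: "depth T x < depth T y" for h x y
  proof (rule ccontr)
    assume "\<not> ?thesis"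
    then have y: "edges T `` {y} \<inter> h = {}" by auto
    obtain t where t: "t \<in> h" "(x, t) \<in> (edges T)\<^sup>*" "edges T `` {t} \<inter> h = {}"
      using exists_top[OF D(5) h(2)] by blast
    have "depth T t \<le> depth T x" using t(2)
      by (induction rule: rtrancl_induct) (use step in force)+
    moreover have "depth T t = depth T y"
    proof -
      have eq: "edges T `` {t} = edges T `` {y}" by (rule tops[OF h(1) t(1) h(3) t(3) y])
      have N: "t \<in> nodes T" "y \<in> nodes T" using h(1,3) t(1) D(6,13) by (auto simp: all_hyps_def)
      show ?thesis
      proof (cases "edges T `` {t} = {}")
        case True
        then have "t \<in> roots T" "y \<in> roots T" using eq N by (auto simp: roots_iff)
        then show ?thesis using depth_root by simp
      next
        case False
        then obtain z where "(t, z) \<in> edges T" "(y, z) \<in> edges T" using eq by blast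
        then show ?thesis using step by simp
      qed
    qed
    ultimately show False using xy by simp
  qed
  have iii: "x2 \<in> h \<and> y2 \<in> h" if h: "h \<in> all_hyps T" "x1 \<in> h" "y1 \<in> h" "depth T x1 = depth T y1"
    and e: "(x1, x2) \<in> edges T" "(y1, y2) \<in> edges T" "x2 \<noteq> y2" for h x1 y1 x2 y2
  proof -
    \<comment> \<open>Distinct parents exclude that x1 and y1 are both tops. If one of the parents
      lies in h, it is less deep than the other child, and \<open>ii\<close> puts the other parent
      into h.\<close>
    have "edges T `` {x1} \<noteq> edges T `` {y1}" using e D(10) by blast
    then consider "edges T `` {x1} \<inter> h \<noteq> {}" | "edges T `` {y1} \<inter> h \<noteq> {}" using tops h by blast
    then show ?thesis
    proof cases
      case 1
      then have "x2 \<in> h" using e D(10) by blast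
      moreover from this have "\<exists>z\<in>h. (y1, z) \<in> edges T" using ii[of h x2 y1] h step[OF e(1)] by simp
      ultimately show ?thesis using e D(10) by blast
    next
      case 2
      then have "y2 \<in> h" using e D(10) by blast
      moreover from this have "\<exists>z\<in>h. (x1, z) \<in> edges T" using ii[of h y2 x1] h step[OF e(2)] by simp
      ultimately show ?thesis using e D(10) by blast
    qed
  qed
  have i: "\<exists>x\<in>tagged T. \<forall>y\<in>nodes T. depth T x \<le> depth T y" if ne: "tagged T \<noteq> {}"
  proof -
    obtain t where t: "t \<in> tagged T" "edges T `` {t} \<inter> tagged T = {}"
      using exists_top[OF D(5)] ne by blast
    then have "t \<in> roots T" using D(6,8) by (auto simp: roots_def)
    then show ?thesis using depth_root pos t(1) by metis
  qed
  show "lions_forest T"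
    unfolding lions_forest_def directed_forest_iff using ne D(1,6,7) i ii iii by blast
qed

section \<open>Cuts and generation of Lions forests\<close>

lemma forest_sel_simps [simp]:
  "nodes empty_forest = {}" "edges empty_forest = {}" "tagged empty_forest = {}" "hyps empty_forest = {}"
  "nodes (fprod T1 T2) = nodes T1 \<union> nodes T2" "edges (fprod T1 T2) = edges T1 \<union> edges T2"
  "tagged (fprod T1 T2) = tagged T1 \<union> tagged T2" "hyps (fprod T1 T2) = hyps T1 \<union> hyps T2"
  "nodes (decouple T) = nodes T" "edges (decouple T) = edges T"
  "tagged (decouple T) = {}" "hyps (decouple T) = all_hyps T"
  "nodes (rooting x T) = insert x (nodes T)" "edges (rooting x T) = edges T \<union> roots T \<times> {x}"
  "tagged (rooting x T) = insert x (tagged T)" "hyps (rooting x T) = hyps T"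
  "nodes (subforest T A) = A" "edges (subforest T A) = edges T \<inter> A \<times> A"
  "tagged (subforest T A) = tagged T \<inter> A" "hyps (subforest T A) = (\<lambda>h. h \<inter> A) ` hyps T - {{}}"
  "nodes (relabel \<phi> T) = \<phi> ` nodes T" "edges (relabel \<phi> T) = map_prod \<phi> \<phi> ` edges T"
  "tagged (relabel \<phi> T) = \<phi> ` tagged T" "hyps (relabel \<phi> T) = (`) \<phi> ` hyps T"
  by (simp_all add: empty_forest_def fprod_def decouple_def rooting_def subforest_def relabel_def)

lemma lforest_eqI:
  "nodes T = nodes T' \<Longrightarrow> edges T = edges T' \<Longrightarrow> tagged T = tagged T' \<Longrightarrow> hyps T = hyps T' \<Longrightarrow> T = T'"
  by (cases T; cases T') simp

lemma lions_forest0_empty: "lions_forest0 empty_forest"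
  by (simp add: lions_forest0_def forest_edges_def partition_on_def)

lemma lions_forest0_nodes_empty_iff: "lions_forest0 T \<Longrightarrow> nodes T = {} \<longleftrightarrow> T = empty_forest"
  using lions_forest0D(3,6,16)[of T] lions_forest0D(12,13)[of T]
  by (intro iffI lforest_eqI) auto

lemma ancestor_closedD: "ancestor_closed T R \<Longrightarrow> y \<in> R \<Longrightarrow> (y, z) \<in> edges T \<Longrightarrow> z \<in> R"
  by (auto simp: ancestor_closed_def)

lemma ancestor_closed_subset: "ancestor_closed T R \<Longrightarrow> R \<subseteq> nodes T"
  by (auto simp: ancestor_closed_def)

lemma ancestor_closed_rtrancl: "ancestor_closed T R \<Longrightarrow> (y, z) \<in> (edges T)\<^sup>* \<Longrightarrow> y \<in> R \<Longrightarrow> z \<in> R"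
  by (rotate_tac, induction rule: rtrancl_induct) (auto dest: ancestor_closedD)

lemma subforest_basics:
  assumes "lions_forest0 T" "A \<subseteq> nodes T"
  shows "forest_edges A (edges T \<inter> A \<times> A)"
    "partition_on (A - tagged T \<inter> A) ((\<lambda>h. h \<inter> A) ` hyps T - {{}})"
proof -
  note D = lions_forest0D[OF assms(1)]
  have "wf ((edges T \<inter> A \<times> A)\<inverse>)" by (rule wf_subset[OF D(5)]) auto
  moreover have "single_valued (edges T \<inter> A \<times> A)" using D(4) by (auto simp: single_valued_def)
  ultimately show "forest_edges A (edges T \<inter> A \<times> A)"
    using finite_subset[OF assms(2) D(2)] by (auto simp: forest_edges_def)
  have "A \<inter> (nodes T - tagged T) = A - tagged T \<inter> A" using assms(2) by auto
  moreover have "(\<inter>) A = (\<lambda>h. h \<inter> A)" by (auto simp: Int_commute)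
  ultimately show "partition_on (A - tagged T \<inter> A) ((\<lambda>h. h \<inter> A) ` hyps T - {{}})"
    using partition_on_restrict[OF D(7), of A] by simp
qed

text \<open>Parents of nodes of R stay in R, so the tops of \<open>h \<inter> R\<close> are tops of
  h.\<close>

lemma lions_forest0_subforest_ancestor_closed:
  assumes "lions_forest0 T" "ancestor_closed T R"
  shows "lions_forest0 (subforest T R)"
proof -
  note D = lions_forest0D[OF assms(1)]
  have R: "R \<subseteq> nodes T" using assms(2) by (rule ancestor_closed_subset)
  have E: "(edges T \<inter> R \<times> R) `` {x} = edges T `` {x}" if "x \<in> R" for x
    using that assms(2) by (auto dest: ancestor_closedD)
  have "(edges T \<inter> R \<times> R) `` {x} = (edges T \<inter> R \<times> R) `` {y}"
    if h: "h \<in> hyps T" and xy: "x \<in> h \<inter> R" "y \<in> h \<inter> R"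
      and t: "(edges T \<inter> R \<times> R) `` {x} \<inter> (h \<inter> R) = {}" "(edges T \<inter> R \<times> R) `` {y} \<inter> (h \<inter> R) = {}"
    for h x y
  proof -
    have "edges T `` {x} \<inter> h = {}" "edges T `` {y} \<inter> h = {}"
      using t xy ancestor_closedD[OF assms(2)] by blast+
    then show ?thesis using D(9)[OF h, of x y] E xy by simp
  qed
  then show ?thesis
    unfolding lions_forest0_def forest_sel_simps
    using subforest_basics[OF assms(1) R] R D(8) by (intro conjI) blast+
qed

text \<open>Unlike the upper part, the lower part can have new tops: nodes whose parent in h was cut
  off. These become roots, so the other tops of the remaining hyperedge must be shown to be roots as
  well.\<close>

lemma lions_forest0_subforest_complement:
  assumes "lions_forest0 T" "ancestor_closed T R"
  shows "lions_forest0 (subforest T (nodes T - R))"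
proof -
  note D = lions_forest0D[OF assms(1)]
  let ?A = "nodes T - R" and ?E = "edges T \<inter> (nodes T - R) \<times> (nodes T - R)"
  have E: "?E `` {x} = edges T `` {x} - R" if "x \<in> ?A" for x
    using that D(3) by auto
  \<comment> \<open>Suppose x has lost its parent z in h to R while y keeps a parent w outside R.
    Climbing from z inside h reaches a top t of h, which lies in R. Since y is also a top of h, t
    has parent w, and ancestor-closedness puts w into R.\<close>
  have *: "edges T `` {y} - R = {}"
    if h: "h \<in> hyps T" and xy: "x \<in> h - R" "y \<in> h - R" and x: "edges T `` {x} \<inter> h \<noteq> {}"
      and y: "(edges T `` {y} - R) \<inter> h = {}" and xR: "(edges T `` {x} - R) \<inter> h = {}" for h x y
  proof (rule ccontr)
    assume "edges T `` {y} - R \<noteq> {}"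
    then obtain w where w: "(y, w) \<in> edges T" "w \<notin> R" by auto
    then have top: "edges T `` {y} = {w}" "edges T `` {y} \<inter> h = {}" using y D(10) by auto
    obtain z where z: "(x, z) \<in> edges T" "z \<in> h" "z \<in> R" using x xR by auto
    obtain t where t: "t \<in> h" "(z, t) \<in> (edges T)\<^sup>*" "edges T `` {t} \<inter> h = {}"
      using exists_top[OF D(5) z(2)] by blast
    have "t \<in> R" using ancestor_closed_rtrancl[OF assms(2) t(2) z(3)] .
    moreover have "edges T `` {t} = {w}" using D(9)[OF h t(1) _ t(3) top(2)] xy top by simp
    ultimately show False using w(2) ancestor_closedD[OF assms(2)] by blast
  qed
  have "?E `` {x} = ?E `` {y}"
    if h: "h \<in> hyps T" and xy: "x \<in> h \<inter> ?A" "y \<in> h \<inter> ?A"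
      and t: "?E `` {x} \<inter> (h \<inter> ?A) = {}" "?E `` {y} \<inter> (h \<inter> ?A) = {}" for h x y
  proof -
    have t': "(edges T `` {x} - R) \<inter> h = {}" "(edges T `` {y} - R) \<inter> h = {}"
      using t xy D(3) by blast+
    have "edges T `` {x} - R = edges T `` {y} - R"
    proof (cases "edges T `` {x} \<inter> h = {} \<and> edges T `` {y} \<inter> h = {}")
      case True
      then show ?thesis using D(9)[OF h, of x y] xy by simp
    next
      case False
      have x: "x \<in> h - R" and y: "y \<in> h - R" using xy by auto
      from False show ?thesis
      proof (cases "edges T `` {x} \<inter> h = {}")
        case True
        then have yh: "edges T `` {y} \<inter> h \<noteq> {}" using False by blast
        have "edges T `` {x} - R = {}" by (rule *[OF h y x yh t'(1) t'(2)])
        moreover have "edges T `` {y} - R = {}" by (rule *[OF h y y yh t'(2) t'(2)])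
        ultimately show ?thesis by blast
      next
        case xh: False
        have "edges T `` {y} - R = {}" by (rule *[OF h x y xh t'(2) t'(1)])
        moreover have "edges T `` {x} - R = {}" by (rule *[OF h x x xh t'(1) t'(1)])
        ultimately show ?thesis by blast
      qed
    qed
    then show ?thesis using E xy by simp
  qed
  then show ?thesis
    unfolding lions_forest0_def forest_sel_simps
    using subforest_basics[OF assms(1), of ?A] D(8) by (intro conjI) blast+
qed

lemma lions_forest0_relabel:
  assumes "lions_forest0 T" "inj_on \<phi> (nodes T)"
  shows "lions_forest0 (relabel \<phi> T)"
proof -
  note D = lions_forest0D[OF assms(1)]
  note inj = inj_onD[OF assms(2)]
  have E: "(map_prod \<phi> \<phi> ` edges T) `` {\<phi> x} = \<phi> ` (edges T `` {x})" if "x \<in> nodes T" for x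
    using that D(3) inj by (auto simp: image_iff)
  have "single_valued (map_prod \<phi> \<phi> ` edges T)"
  proof (rule single_valuedI)
    fix a b c assume "(a, b) \<in> map_prod \<phi> \<phi> ` edges T" "(a, c) \<in> map_prod \<phi> \<phi> ` edges T"
    then obtain x y x' z where xy: "(x, y) \<in> edges T" "(x', z) \<in> edges T" "a = \<phi> x" "a = \<phi> x'" "b = \<phi> y" "c = \<phi> z"
      by auto
    then have "x = x'" using inj D(3) by blast
    then show "b = c" using xy D(10) by blast
  qed
  moreover have "wf ((map_prod \<phi> \<phi> ` edges T)\<inverse>)"
  proof -
    have "(map_prod \<phi> \<phi> ` edges T)\<inverse> = map_prod \<phi> \<phi> ` ((edges T)\<inverse>)" by force
    moreover have "wf (map_prod \<phi> \<phi> ` ((edges T)\<inverse>))"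
      by (rule wf_map_prod_image_Dom_Ran[OF D(5)]) (use inj D(3) in blast)
    ultimately show ?thesis by simp
  qed
  ultimately have f1: "forest_edges (\<phi> ` nodes T) (map_prod \<phi> \<phi> ` edges T)"
    using D(2,3) by (auto simp: forest_edges_def)
  have f2: "partition_on (\<phi> ` nodes T - \<phi> ` tagged T) ((`) \<phi> ` hyps T)"
  proof -
    have "(`) \<phi> ` hyps T - {{}} = (`) \<phi> ` hyps T" using D(12) by auto
    moreover have "\<phi> ` (nodes T - tagged T) = \<phi> ` nodes T - \<phi> ` tagged T"
      using inj_on_image_set_diff[OF assms(2)] D(6) by blast
    ultimately show ?thesis
      using partition_on_inj_image[OF D(7) inj_on_subset[OF assms(2)]] by auto
  qed
  have f3: "(map_prod \<phi> \<phi> ` edges T) `` (\<phi> ` tagged T) \<subseteq> \<phi> ` tagged T"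
  proof -
    have "(map_prod \<phi> \<phi> ` edges T) `` {\<phi> x} \<subseteq> \<phi> ` tagged T" if "x \<in> tagged T" for x
    proof -
      have "x \<in> nodes T" "edges T `` {x} \<subseteq> tagged T" using D(6,8) that by auto
      then show ?thesis unfolding E[OF \<open>x \<in> nodes T\<close>] by blast
    qed
    moreover have "G `` (\<phi> ` tagged T) = (\<Union>x\<in>tagged T. G `` {\<phi> x})" for G :: "(nat \<times> nat) set"
      by blast
    ultimately show ?thesis by (metis (no_types, lifting) UN_least)
  qed
  have f4: "(map_prod \<phi> \<phi> ` edges T) `` {a} = (map_prod \<phi> \<phi> ` edges T) `` {b}"
    if h: "h \<in> hyps T" and ab: "a \<in> \<phi> ` h" "b \<in> \<phi> ` h"
      and t: "(map_prod \<phi> \<phi> ` edges T) `` {a} \<inter> \<phi> ` h = {}" "(map_prod \<phi> \<phi> ` edges T) `` {b} \<inter> \<phi> ` h = {}"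
    for h a b
  proof -
    obtain x y where xy: "x \<in> h" "y \<in> h" "a = \<phi> x" "b = \<phi> y" using ab by auto
    have N: "x \<in> nodes T" "y \<in> nodes T" using xy D(13)[OF h] by auto
    have "edges T `` {x} \<inter> h = {}" "edges T `` {y} \<inter> h = {}"
      using t E[OF N(1)] E[OF N(2)] xy by auto
    then show ?thesis using D(9)[OF h xy(1,2)] E N xy(3,4) by simp
  qed
  show ?thesis
    unfolding lions_forest0_def forest_sel_simps
  proof (intro conjI ballI impI f1 f2 f3 image_mono D(6))
    fix g a b
    assume "g \<in> (`) \<phi> ` hyps T" "a \<in> g" "b \<in> g"
      and "(map_prod \<phi> \<phi> ` edges T) `` {a} \<inter> g = {} \<and> (map_prod \<phi> \<phi> ` edges T) `` {b} \<inter> g = {}"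
    then show "(map_prod \<phi> \<phi> ` edges T) `` {a} = (map_prod \<phi> \<phi> ` edges T) `` {b}"
      using f4 by (elim imageE conjE) simp
  qed
qed

text \<open>As no hyperedge straddles A, the traces of hyperedges on either part are empty or whole
  hyperedges.\<close>

lemma lions_forest0_eq_fprod:
  assumes "lions_forest0 T" "A \<subseteq> nodes T" "\<And>x y. (x, y) \<in> edges T \<Longrightarrow> x \<in> A \<longleftrightarrow> y \<in> A"
    and "\<And>h. h \<in> hyps T \<Longrightarrow> h \<subseteq> A \<or> h \<inter> A = {}"
  shows "T = fprod (subforest T A) (subforest T (nodes T - A))"
proof (rule lforest_eqI)
  note D = lions_forest0D[OF assms(1)]
  show "edges T = edges (fprod (subforest T A) (subforest T (nodes T - A)))"
    using D(3) assms(3) by auto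
  have restr: "(\<lambda>h. h \<inter> B) ` hyps T - {{}} = {h \<in> hyps T. h \<subseteq> B}"
    if "\<And>h. h \<in> hyps T \<Longrightarrow> h \<subseteq> B \<or> h \<inter> B = {}" for B
  proof (intro equalityI subsetI)
    fix g assume "g \<in> (\<lambda>h. h \<inter> B) ` hyps T - {{}}"
    then obtain h where h: "h \<in> hyps T" "g = h \<inter> B" "g \<noteq> {}" by auto
    then have "g = h" using that[OF h(1)] by auto
    then show "g \<in> {h \<in> hyps T. h \<subseteq> B}" using h by auto
  next
    fix g assume "g \<in> {h \<in> hyps T. h \<subseteq> B}"
    then have "g \<in> hyps T" "g = g \<inter> B" "g \<noteq> {}" using D(12) by auto
    then show "g \<in> (\<lambda>h. h \<inter> B) ` hyps T - {{}}" by blast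
  qed
  have disj: "h \<subseteq> nodes T - A \<or> h \<inter> (nodes T - A) = {}" if "h \<in> hyps T" for h
    using assms(4)[OF that] D(13)[OF that] by blast
  have "{h \<in> hyps T. h \<subseteq> A} \<union> {h \<in> hyps T. h \<subseteq> nodes T - A} = hyps T"
    using assms(4) D(13) by blast
  then have "(\<lambda>h. h \<inter> A) ` hyps T - {{}} \<union> ((\<lambda>h. h \<inter> (nodes T - A)) ` hyps T - {{}}) = hyps T"
    using restr[OF assms(4)] restr[OF disj] by simp
  then show "hyps T = hyps (fprod (subforest T A) (subforest T (nodes T - A)))" by simp
qed (use assms(2) lions_forest0D(6)[OF assms(1)] in auto)

text \<open>
  Let \<open>T\<close> have at least one node. If nothing is tagged, the hyperedge of a root can be tagged, so
  \<open>T\<close> is a decoupling. Otherwise some root is tagged: if it is the only root, \<open>T\<close> arises by rooting,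
  and otherwise \<open>T\<close> is a product, since a hyperedge meeting several trees must contain untagged roots.
\<close>

lemma lions_forest0_cases:
  assumes T: "lions_forest0 T"
  obtains "T = empty_forest"
  | x T' where "lions_forest0 T'" "x \<notin> nodes T'" "T = rooting x T'"
  | T1 T2 where "lions_forest0 T1" "lions_forest0 T2" "nodes T1 \<noteq> {}" "nodes T2 \<noteq> {}" "nodes T1 \<inter> nodes T2 = {}"
      "T = fprod T1 T2"
  | T' where "lions_forest0 T'" "tagged T' \<noteq> {}" "tagged T = {}" "T = decouple T'"
proof -
  note D = lions_forest0D[OF T]
  have root_above: "\<exists>r\<in>roots T. (x, r) \<in> (edges T)\<^sup>*" if "x \<in> nodes T" for x
    using exists_top[OF D(5) that] D(3) by (auto simp: roots_def)
  show thesis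
  proof (cases "nodes T = {}")
    case True
    then show thesis using lions_forest0_nodes_empty_iff[OF T] that(1) by simp
  next
    case ne: False
    then obtain r where r: "r \<in> roots T" using root_above by blast
    show thesis
    proof (cases "tagged T = {}")
      case True
      then have "r \<in> \<Union> (hyps T)" using r D(16) by (simp add: roots_def)
      then obtain h where h: "h \<in> hyps T" "r \<in> h" by blast
      define T' where "T' = LForest (nodes T) (edges T) h (hyps T - {h})"
      \<comment> \<open>A node of h with its parent outside h would be a top of h, as is the root r;
        tops share their parents, but r has none.\<close>
      have "edges T `` h \<subseteq> h"
      proof safe
        fix x y assume xy: "(x, y) \<in> edges T" "x \<in> h"
        show "y \<in> h"
        proof (rule ccontr)
          assume "y \<notin> h"
          then have "edges T `` {x} \<inter> h = {}" using xy D(10) by blast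
          then have "edges T `` {x} = edges T `` {r}" using D(9)[OF h(1) xy(2) h(2)] r by (auto simp: roots_iff)
          then show False using xy r by (auto simp: roots_iff)
        qed
      qed
      moreover have "partition_on (nodes T - h) (hyps T - {h})"
      proof -
        have "\<Union> (hyps T - {h}) = nodes T - h" using D(15,16) h True by blast
        then show ?thesis using D(7) by (auto simp: partition_on_def disjoint_def)
      qed
      ultimately have "lions_forest0 T'"
        using D(1,9,13) h unfolding T'_def lions_forest0_def lforest.sel by (intro conjI) blast+
      moreover have "T = decouple T'"
        using True h D(12) by (intro lforest_eqI) (auto simp: T'_def all_hyps_def)
      moreover have "tagged T' \<noteq> {}" using h by (auto simp: T'_def)
      ultimately show thesis using that(4) True by blast
    next
      case tag: False
      then obtain t where t: "t \<in> tagged T" "edges T `` {t} \<inter> tagged T = {}"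
        using exists_top[OF D(5)] by blast
      have tr: "t \<in> roots T" using t D(6,8) by (auto simp: roots_iff)
      show thesis
      proof (cases "roots T = {t}")
        case True
        have anc: "ancestor_closed T {t}" using tr by (auto simp: ancestor_closed_def roots_def)
        let ?T' = "subforest T (nodes T - {t})"
        have "T = rooting t ?T'"
        proof (rule lforest_eqI)
          have "roots ?T' = {x \<in> nodes T. (x, t) \<in> edges T}"
          proof -
            have "x \<in> roots ?T' \<longleftrightarrow> x \<in> nodes T \<and> (x, t) \<in> edges T" for x
            proof
              assume x: "x \<in> roots ?T'"
              then have "x \<in> nodes T" "x \<notin> roots T" using True by (auto simp: roots_def)
              then obtain y where y: "(x, y) \<in> edges T" by (auto simp: roots_def)
              then have "y = t" using x D(3) by (auto simp: roots_def)
              then show "x \<in> nodes T \<and> (x, t) \<in> edges T" using y \<open>x \<in> nodes T\<close> by simp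
            next
              assume x: "x \<in> nodes T \<and> (x, t) \<in> edges T"
              moreover from this have "x \<noteq> t" using tr by (auto simp: roots_def)
              ultimately show "x \<in> roots ?T'" using D(10) by (auto simp: roots_def)
            qed
            then show ?thesis by blast
          qed
          then show "edges T = edges (rooting t ?T')"
            using D(3) tr by (auto simp: roots_def)
          have "h \<inter> (nodes T - {t}) = h" if "h \<in> hyps T" for h
            using D(13,14)[OF that] t by blast
          then have "(\<lambda>h. h \<inter> (nodes T - {t})) ` hyps T = hyps T" by simp
          then show "hyps T = hyps (rooting t ?T')" using D(12) by auto
        qed (use tr t D(6) in \<open>auto simp: roots_def\<close>)
        then show thesis using that(2)[of ?T' t] lions_forest0_subforest_complement[OF T anc] by simp
      next
        case False
        \<comment> \<open>A splitting of the roots that no hyperedge crosses: the single root t if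
          every root is tagged, as hyperedges then contain no roots; otherwise tagged against
          untagged roots.\<close>
        have "\<exists>S\<subseteq>roots T. S \<noteq> {} \<and> S \<noteq> roots T \<and> (\<forall>h\<in>hyps T. \<forall>x\<in>h\<inter>roots T. \<forall>y\<in>h\<inter>roots T. x \<in> S \<longleftrightarrow> y \<in> S)"
        proof (cases "roots T \<subseteq> tagged T")
          case True
          then have "h \<inter> roots T = {}" if "h \<in> hyps T" for h using D(14)[OF that] by blast
          then show ?thesis using tr False by (intro exI[of _ "{t}"]) auto
        next
          case False
          show ?thesis
            by (rule exI[of _ "roots T \<inter> tagged T"]) (use tr t False D(14) in blast)
        qed
        then obtain S where S: "S \<subseteq> roots T" "S \<noteq> {}" "S \<noteq> roots T"
          and Sh: "\<And>h x y. h \<in> hyps T \<Longrightarrow> x \<in> h \<Longrightarrow> x \<in> roots T \<Longrightarrow> y \<in> h \<Longrightarrow> y \<in> roots T \<Longrightarrow> x \<in> S \<longleftrightarrow> y \<in> S"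
          by blast
        define A where "A = {x \<in> nodes T. \<exists>s\<in>S. (x, s) \<in> (edges T)\<^sup>*}"
        have root_S: "x \<in> A \<longleftrightarrow> x \<in> S" if "x \<in> roots T" for x
        proof -
          have "y = x" if "(x, y) \<in> (edges T)\<^sup>*" for y
            using that \<open>x \<in> roots T\<close> by (cases rule: converse_rtranclE) (auto simp: roots_def)
          then show ?thesis using that by (auto simp: A_def roots_def)
        qed
        have step: "x \<in> A \<longleftrightarrow> y \<in> A" if xy: "(x, y) \<in> edges T" for x y
        proof
          assume "x \<in> A"
          then obtain s where s: "s \<in> S" "(x, s) \<in> (edges T)\<^sup>*" by (auto simp: A_def)
          have "x \<noteq> s" using xy s(1) S(1) by (auto simp: roots_def)
          then obtain z where "(x, z) \<in> edges T" "(z, s) \<in> (edges T)\<^sup>*"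
            using s(2) by (auto elim: converse_rtranclE)
          then show "y \<in> A" using D(3) D(10)[OF xy] s(1) xy by (auto simp: A_def)
        next
          assume "y \<in> A"
          then show "x \<in> A" using xy D(3) by (auto simp: A_def intro: converse_rtrancl_into_rtrancl)
        qed
        have steps: "x \<in> A \<longleftrightarrow> y \<in> A" if "(x, y) \<in> (edges T)\<^sup>*" for x y
          using that by (induction rule: rtrancl_induct) (auto simp: step)
        \<comment> \<open>Two nodes of h climb to tops of h. These are either both roots, which S
          does not separate, or they share a parent.\<close>
        have hA: "x \<in> A \<longleftrightarrow> y \<in> A" if h: "h \<in> hyps T" "x \<in> h" "y \<in> h" for h x y
        proof -
          obtain t u where t: "t \<in> h" "(x, t) \<in> (edges T)\<^sup>*" "edges T `` {t} \<inter> h = {}"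
            and u: "u \<in> h" "(y, u) \<in> (edges T)\<^sup>*" "edges T `` {u} \<inter> h = {}"
            using exists_top[OF D(5) h(2)] exists_top[OF D(5) h(3)] by blast
          have eq: "edges T `` {t} = edges T `` {u}" by (rule D(9)[OF h(1) t(1) u(1) t(3) u(3)])
          have "t \<in> A \<longleftrightarrow> u \<in> A"
          proof (cases "edges T `` {t} = {}")
            case True
            then have "t \<in> roots T" "u \<in> roots T" using eq D(13)[OF h(1)] t(1) u(1) by (auto simp: roots_iff)
            then show ?thesis using Sh[OF h(1) t(1) _ u(1)] root_S by simp
          next
            case False
            then obtain w where "(t, w) \<in> edges T" "(u, w) \<in> edges T" using eq by blast
            then show ?thesis using step by simp
          qed
          then show ?thesis using steps t(2) u(2) by simp
        qed
        have A: "A \<subseteq> nodes T" by (auto simp: A_def)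
        have anc: "ancestor_closed T A" using A step by (auto simp: ancestor_closed_def)
        have "T = fprod (subforest T A) (subforest T (nodes T - A))"
        proof (rule lions_forest0_eq_fprod[OF T A step])
          show "h \<subseteq> A \<or> h \<inter> A = {}" if "h \<in> hyps T" for h
            using hA[OF that] by blast
        qed
        moreover have "A \<noteq> {}" using S(1,2) root_S by blast
        moreover have "nodes T - A \<noteq> {}" using S(1,3) root_S by (auto simp: roots_iff)
        ultimately show thesis
          using that(3)[of "subforest T A" "subforest T (nodes T - A)"]
            lions_forest0_subforest_ancestor_closed[OF T anc] lions_forest0_subforest_complement[OF T anc] by auto
      qed
    qed
  qed
qed

text \<open>Decoupling keeps the nodes, so their number alone does not decrease. The measure adds 1
  for a forest without tags, which decoupling produces, and the factor 2 lets the loss of a node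
  outweigh the loss of all tags when a root or a factor is split off.\<close>

lemma lions_forest0_induct [consumes 1, case_names empty rooting fprod decouple]:
  assumes "lions_forest0 T" and "P empty_forest"
    and "\<And>x T. lions_forest0 T \<Longrightarrow> x \<notin> nodes T \<Longrightarrow> lions_forest0 (rooting x T) \<Longrightarrow> P T \<Longrightarrow> P (rooting x T)"
    and "\<And>T1 T2. lions_forest0 T1 \<Longrightarrow> lions_forest0 T2 \<Longrightarrow> nodes T1 \<noteq> {} \<Longrightarrow> nodes T2 \<noteq> {} \<Longrightarrow>
      nodes T1 \<inter> nodes T2 = {} \<Longrightarrow> lions_forest0 (fprod T1 T2) \<Longrightarrow> P T1 \<Longrightarrow> P T2 \<Longrightarrow> P (fprod T1 T2)"
    and "\<And>T. lions_forest0 T \<Longrightarrow> tagged T \<noteq> {} \<Longrightarrow> lions_forest0 (decouple T) \<Longrightarrow> P T \<Longrightarrow> P (decouple T)"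
  shows "P T"
  using assms(1)
proof (induction "2 * card (nodes T) + (if tagged T = {} then 1 else 0::nat)" arbitrary: T rule: less_induct)
  case less
  have fin: "finite (nodes T)" using lions_forest0D(2)[OF less.prems] .
  from less.prems show ?case
  proof (cases rule: lions_forest0_cases)
    case 1
    then show ?thesis using assms(2) by simp
  next
    case (2 x T')
    then have "P T'" using fin by (intro less.hyps) auto
    then show ?thesis using 2 assms(3) less.prems by blast
  next
    case (3 T1 T2)
    have fin': "finite (nodes T1)" "finite (nodes T2)" using 3 fin by auto
    then have "card (nodes T) = card (nodes T1) + card (nodes T2)" using 3 by (simp add: card_Un_disjoint)
    moreover have "card (nodes T1) > 0" "card (nodes T2) > 0" using 3 fin' by (auto simp: card_gt_0_iff)
    ultimately have "P T1" "P T2" using 3 by (intro less.hyps; auto)+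
    then show ?thesis using 3 assms(4) less.prems by blast
  next
    case (4 T')
    then have "P T'" by (intro less.hyps) auto
    then show ?thesis using 4 assms(5) less.prems by blast
  qed
qed

section \<open>Cuts of products, decouplings and rooted forests\<close>

lemma grading_eq: "lions_forest0 T \<Longrightarrow> grading \<alpha> \<alpha> T = \<alpha> * real (card (nodes T))"
  using lions_forest0D(2,6,11)[of T]
  by (simp add: grading_def card_Diff_subset of_nat_diff card_mono algebra_simps)

lemma forests_iff:
  "T \<in> forests \<gamma> \<alpha> \<alpha> \<longleftrightarrow> lions_forest0 T \<and> nodes T \<noteq> {} \<and> \<alpha> * real (card (nodes T)) \<le> \<gamma>"
  by (auto simp: forests_def lions_forest_iff grading_eq)

lemma forests\<^sub>0_iff:
  assumes "0 \<le> \<gamma>"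
  shows "T \<in> forests\<^sub>0 \<gamma> \<alpha> \<alpha> \<longleftrightarrow> lions_forest0 T \<and> \<alpha> * real (card (nodes T)) \<le> \<gamma>"
  using assms lions_forest0_nodes_empty_iff[of T]
  by (cases "T = empty_forest") (auto simp: forests\<^sub>0_def forests_iff lions_forest0_empty)

lemma subforest_nodes: "lions_forest0 T \<Longrightarrow> subforest T (nodes T) = T"
  using lions_forest0D(3,6)[of T] lions_forest0D(12,13)[of T]
  by (intro lforest_eqI) (auto simp: image_iff Int_absorb2 intro!: bexI)

lemma subforest_empty: "subforest T {} = empty_forest"
  by (intro lforest_eqI) auto

lemma decouple_untagged: "lions_forest0 T \<Longrightarrow> tagged T = {} \<Longrightarrow> decouple T = T"
  using lions_forest0D(12)[of T] by (intro lforest_eqI) (auto simp: all_hyps_def)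

lemma fprod_empty: "fprod empty_forest T = T" "fprod T empty_forest = T"
  by (simp_all add: lforest_eqI)

lemma hyp_args_Int:
  assumes "lions_forest0 T" "h \<in> hyps T" "h \<inter> A \<noteq> {}"
  shows "hyp_args T A \<omega> (h \<inter> A) = \<omega> h"
proof -
  have "(THE h'. h' \<in> hyps T \<and> h' \<inter> A = h \<inter> A) = h"
  proof (rule the_equality)
    fix h' assume h': "h' \<in> hyps T \<and> h' \<inter> A = h \<inter> A"
    then have "h' \<inter> h \<noteq> {}" using assms(3) by blast
    then show "h' = h" using lions_forest0D(15)[OF assms(1)] h' assms(2) by blast
  qed (use assms in simp)
  then show ?thesis using assms by (simp add: hyp_args_def)
qed

text \<open>The variables on a cut are defined by a description of h from
  \<open>h \<inter> A\<close>. Checking the values on these traces avoids handling the description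
  again for each kind of forest.\<close>

lemma hyp_args_eqI:
  assumes "lions_forest0 T" "f \<in> extensional (hyps (subforest T A))"
    and "\<And>h. h \<in> hyps T \<Longrightarrow> h \<inter> A \<noteq> {} \<Longrightarrow> f (h \<inter> A) = \<omega> h"
  shows "f = hyp_args T A \<omega>"
proof (rule extensionalityI[OF assms(2)])
  show "hyp_args T A \<omega> \<in> extensional (hyps (subforest T A))" by (simp add: hyp_args_def)
  fix g assume "g \<in> hyps (subforest T A)"
  then obtain h where "h \<in> hyps T" "g = h \<inter> A" "h \<inter> A \<noteq> {}" by auto
  then show "f g = hyp_args T A \<omega> g" using assms(3) by (simp add: hyp_args_Int[OF assms(1)])
qed

lemma hyp_args_PiE:
  assumes "lions_forest0 T" "\<omega> \<in> hyps T \<rightarrow>\<^sub>E X"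
  shows "hyp_args T A \<omega> \<in> hyps (subforest T A) \<rightarrow>\<^sub>E X"
proof (rule PiE_I)
  fix g assume "g \<in> hyps (subforest T A)"
  then obtain h where "h \<in> hyps T" "g = h \<inter> A" "h \<inter> A \<noteq> {}" by auto
  then show "hyp_args T A \<omega> g \<in> X" using assms(2) by (auto simp: hyp_args_Int[OF assms(1)])
qed (auto simp: hyp_args_def)

lemma hyp_args_nodes:
  assumes "lions_forest0 T" "\<omega> \<in> hyps T \<rightarrow>\<^sub>E X"
  shows "hyp_args T (nodes T) \<omega> = \<omega>"
proof (rule hyp_args_eqI[OF assms(1), symmetric])
  show "\<omega> \<in> extensional (hyps (subforest T (nodes T)))"
    using assms by (simp add: subforest_nodes[OF assms(1)] PiE_def del: forest_sel_simps)
  show "\<omega> (h \<inter> nodes T) = \<omega> h" if "h \<in> hyps T" for h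
    using lions_forest0D(13)[OF assms(1) that] by (simp add: Int_absorb2)
qed

lemma hyp_args_empty: "hyp_args T {} \<omega> = (\<lambda>_. undefined)"
  by (auto simp: hyp_args_def)

lemma ancestor_closed_simps:
  "ancestor_closed T {}" "lions_forest0 T \<Longrightarrow> ancestor_closed T (nodes T)"
  "ancestor_closed (decouple T) R \<longleftrightarrow> ancestor_closed T R"
  using lions_forest0D(3)[of T] by (auto simp: ancestor_closed_def)

lemma finite_ancestor_closed: "lions_forest0 T \<Longrightarrow> finite {R. ancestor_closed T R}"
  by (rule finite_subset[of _ "Pow (nodes T)"]) (auto simp: ancestor_closed_def dest: lions_forest0D(2))

lemma lions_forest0_subforest:
  assumes "lions_forest0 T" "ancestor_closed T R" "A = R \<or> A = nodes T - R"
  shows "lions_forest0 (subforest T A)" "card (nodes (subforest T A)) \<le> card (nodes T)" "A \<subseteq> nodes T"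
proof -
  show "lions_forest0 (subforest T A)"
    using assms lions_forest0_subforest_ancestor_closed lions_forest0_subforest_complement by blast
  show "A \<subseteq> nodes T" using assms by (auto simp: ancestor_closed_def)
  then show "card (nodes (subforest T A)) \<le> card (nodes T)"
    using lions_forest0D(2)[OF assms(1)] by (simp add: card_mono)
qed

lemma subforest_decouple: "subforest (decouple T) A = decouple (subforest T A)"
  by (intro lforest_eqI) (auto simp: all_hyps_def)

lemma hyp_args_decouple:
  assumes "lions_forest0 T" "lions_forest0 (decouple T)"
  shows "restrict (hyp_args (decouple T) A \<omega>) (hyps (subforest T A)) = hyp_args T A (restrict \<omega> (hyps T))"
    and "tagged T \<inter> A \<noteq> {} \<Longrightarrow> hyp_args (decouple T) A \<omega> (tagged T \<inter> A) = \<omega> (tagged T)"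
proof -
  show "restrict (hyp_args (decouple T) A \<omega>) (hyps (subforest T A)) = hyp_args T A (restrict \<omega> (hyps T))"
  proof (rule hyp_args_eqI[OF assms(1)])
    fix h assume h: "h \<in> hyps T" "h \<inter> A \<noteq> {}"
    then have "h \<in> hyps (decouple T)" by (auto simp: all_hyps_def)
    then show "restrict (hyp_args (decouple T) A \<omega>) (hyps (subforest T A)) (h \<inter> A) = restrict \<omega> (hyps T) h"
      using h by (simp add: hyp_args_Int[OF assms(2)])
  qed simp
  assume "tagged T \<inter> A \<noteq> {}"
  then show "hyp_args (decouple T) A \<omega> (tagged T \<inter> A) = \<omega> (tagged T)"
    by (subst hyp_args_Int[OF assms(2)]) (auto simp: all_hyps_def)
qed

lemma subforest_fprod:
  assumes "lions_forest0 T1" "lions_forest0 T2" "nodes T1 \<inter> nodes T2 = {}" "A1 \<subseteq> nodes T1" "A2 \<subseteq> nodes T2"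
  shows "subforest (fprod T1 T2) (A1 \<union> A2) = fprod (subforest T1 A1) (subforest T2 A2)"
proof (intro lforest_eqI)
  have "h \<inter> (A1 \<union> A2) = h \<inter> A1" if "h \<in> hyps T1" for h
    using lions_forest0D(13)[OF assms(1) that] assms by blast
  moreover have "h \<inter> (A1 \<union> A2) = h \<inter> A2" if "h \<in> hyps T2" for h
    using lions_forest0D(13)[OF assms(2) that] assms by blast
  ultimately have "(\<lambda>h. h \<inter> (A1 \<union> A2)) ` hyps T1 = (\<lambda>h. h \<inter> A1) ` hyps T1"
    "(\<lambda>h. h \<inter> (A1 \<union> A2)) ` hyps T2 = (\<lambda>h. h \<inter> A2) ` hyps T2" by (simp_all cong: image_cong)
  then show "hyps (subforest (fprod T1 T2) (A1 \<union> A2)) = hyps (fprod (subforest T1 A1) (subforest T2 A2))"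
    by (simp add: image_Un Un_Diff)
  show "edges (subforest (fprod T1 T2) (A1 \<union> A2)) = edges (fprod (subforest T1 A1) (subforest T2 A2))"
    using lions_forest0D(3)[OF assms(1)] lions_forest0D(3)[OF assms(2)] assms by auto
  show "tagged (subforest (fprod T1 T2) (A1 \<union> A2)) = tagged (fprod (subforest T1 A1) (subforest T2 A2))"
    using lions_forest0D(6)[OF assms(1)] lions_forest0D(6)[OF assms(2)] assms by auto
qed simp

lemma hyp_args_fprod:
  assumes "lions_forest0 T1" "lions_forest0 T2" "lions_forest0 (fprod T1 T2)"
    "nodes T1 \<inter> nodes T2 = {}" "A1 \<subseteq> nodes T1" "A2 \<subseteq> nodes T2"
  shows "restrict (hyp_args (fprod T1 T2) (A1 \<union> A2) \<omega>) (hyps (subforest T1 A1)) =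
      hyp_args T1 A1 (restrict \<omega> (hyps T1))"
    "restrict (hyp_args (fprod T1 T2) (A1 \<union> A2) \<omega>) (hyps (subforest T2 A2)) =
      hyp_args T2 A2 (restrict \<omega> (hyps T2))"
proof -
  have 1: "h \<inter> A1 = h \<inter> (A1 \<union> A2)" if "h \<in> hyps T1" for h
    using lions_forest0D(13)[OF assms(1) that] assms by blast
  have 2: "h \<inter> A2 = h \<inter> (A1 \<union> A2)" if "h \<in> hyps T2" for h
    using lions_forest0D(13)[OF assms(2) that] assms by blast
  show "restrict (hyp_args (fprod T1 T2) (A1 \<union> A2) \<omega>) (hyps (subforest T1 A1)) =
      hyp_args T1 A1 (restrict \<omega> (hyps T1))"
  proof (rule hyp_args_eqI[OF assms(1)])
    fix h assume h: "h \<in> hyps T1" "h \<inter> A1 \<noteq> {}"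
    then have "h \<inter> A1 \<in> hyps (subforest T1 A1)" by auto
    then show "restrict (hyp_args (fprod T1 T2) (A1 \<union> A2) \<omega>) (hyps (subforest T1 A1)) (h \<inter> A1) =
        restrict \<omega> (hyps T1) h"
      using hyp_args_Int[OF assms(3), of h "A1 \<union> A2" \<omega>] 1[OF h(1)] h
      by (simp del: forest_sel_simps(20))
  qed simp
  show "restrict (hyp_args (fprod T1 T2) (A1 \<union> A2) \<omega>) (hyps (subforest T2 A2)) =
      hyp_args T2 A2 (restrict \<omega> (hyps T2))"
  proof (rule hyp_args_eqI[OF assms(2)])
    fix h assume h: "h \<in> hyps T2" "h \<inter> A2 \<noteq> {}"
    then have "h \<inter> A2 \<in> hyps (subforest T2 A2)" by auto
    then show "restrict (hyp_args (fprod T1 T2) (A1 \<union> A2) \<omega>) (hyps (subforest T2 A2)) (h \<inter> A2) =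
        restrict \<omega> (hyps T2) h"
      using hyp_args_Int[OF assms(3), of h "A1 \<union> A2" \<omega>] 2[OF h(1)] h
      by (simp del: forest_sel_simps(20))
  qed simp
qed

lemma ancestor_closed_fprod:
  assumes "lions_forest0 T1" "lions_forest0 T2"
  shows "ancestor_closed (fprod T1 T2) R \<longleftrightarrow>
    R \<subseteq> nodes T1 \<union> nodes T2 \<and> ancestor_closed T1 (R \<inter> nodes T1) \<and> ancestor_closed T2 (R \<inter> nodes T2)"
proof
  assume L: "ancestor_closed (fprod T1 T2) R"
  then have "R \<subseteq> nodes T1 \<union> nodes T2" by (simp add: ancestor_closed_def)
  moreover have "z \<in> R" if "y \<in> R" "(y, z) \<in> edges T1 \<or> (y, z) \<in> edges T2" for y z
    using ancestor_closedD[OF L that(1), of z] that(2) by auto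
  ultimately show "R \<subseteq> nodes T1 \<union> nodes T2 \<and> ancestor_closed T1 (R \<inter> nodes T1) \<and>
      ancestor_closed T2 (R \<inter> nodes T2)"
    using lions_forest0D(3)[OF assms(1)] lions_forest0D(3)[OF assms(2)] unfolding ancestor_closed_def by blast
next
  assume R: "R \<subseteq> nodes T1 \<union> nodes T2 \<and> ancestor_closed T1 (R \<inter> nodes T1) \<and>
      ancestor_closed T2 (R \<inter> nodes T2)"
  have "z \<in> R" if "y \<in> R" "(y, z) \<in> edges T1" for y z
    using that R lions_forest0D(3)[OF assms(1)] ancestor_closedD[of T1 "R \<inter> nodes T1" y z] by blast
  moreover have "z \<in> R" if "y \<in> R" "(y, z) \<in> edges T2" for y z
    using that R lions_forest0D(3)[OF assms(2)] ancestor_closedD[of T2 "R \<inter> nodes T2" y z] by blast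
  ultimately show "ancestor_closed (fprod T1 T2) R"
    using R unfolding ancestor_closed_def[of "fprod T1 T2"] forest_sel_simps by blast
qed

lemma sum_ancestor_closed_fprod:
  assumes "lions_forest0 T1" "lions_forest0 T2" "nodes T1 \<inter> nodes T2 = {}"
  shows "(\<Sum>R | ancestor_closed (fprod T1 T2) R. F R) =
    (\<Sum>R1 | ancestor_closed T1 R1. \<Sum>R2 | ancestor_closed T2 R2. F (R1 \<union> R2))"
proof -
  let ?j = "\<lambda>(R1, R2). R1 \<union> R2 :: nat set"
  have j: "ancestor_closed (fprod T1 T2) (R1 \<union> R2)" "((R1 \<union> R2) \<inter> nodes T1, (R1 \<union> R2) \<inter> nodes T2) = (R1, R2)"
    if "ancestor_closed T1 R1" "ancestor_closed T2 R2" for R1 R2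
  proof -
    have *: "R1 \<union> R2 \<subseteq> nodes T1 \<union> nodes T2" "(R1 \<union> R2) \<inter> nodes T1 = R1" "(R1 \<union> R2) \<inter> nodes T2 = R2"
      using that[THEN ancestor_closed_subset] assms(3) by blast+
    then show "((R1 \<union> R2) \<inter> nodes T1, (R1 \<union> R2) \<inter> nodes T2) = (R1, R2)" by simp
    show "ancestor_closed (fprod T1 T2) (R1 \<union> R2)"
      unfolding ancestor_closed_fprod[OF assms(1,2)] * using that *(1) by blast
  qed
  have "(\<Sum>R1 | ancestor_closed T1 R1. \<Sum>R2 | ancestor_closed T2 R2. F (R1 \<union> R2)) =
      (\<Sum>(R1, R2)\<in>{R1. ancestor_closed T1 R1} \<times> {R2. ancestor_closed T2 R2}. F (R1 \<union> R2))"
    by (rule sum.cartesian_product)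
  also have "\<dots> = (\<Sum>R | ancestor_closed (fprod T1 T2) R. F R)"
  proof (rule sum.reindex_bij_witness[where i = "\<lambda>R. (R \<inter> nodes T1, R \<inter> nodes T2)" and j = ?j])
    fix R assume "R \<in> {R. ancestor_closed (fprod T1 T2) R}"
    then have R: "R \<subseteq> nodes T1 \<union> nodes T2" "ancestor_closed T1 (R \<inter> nodes T1)" "ancestor_closed T2 (R \<inter> nodes T2)"
      by (simp_all add: ancestor_closed_fprod[OF assms(1,2)])
    then show "?j (R \<inter> nodes T1, R \<inter> nodes T2) = R" by auto
    show "(R \<inter> nodes T1, R \<inter> nodes T2) \<in> {R1. ancestor_closed T1 R1} \<times> {R2. ancestor_closed T2 R2}"
      using R by simp
  next
    fix p assume "p \<in> {R1. ancestor_closed T1 R1} \<times> {R2. ancestor_closed T2 R2}"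
    then obtain R1 R2 where p: "p = (R1, R2)" "ancestor_closed T1 R1" "ancestor_closed T2 R2" by auto
    show "(?j p \<inter> nodes T1, ?j p \<inter> nodes T2) = p" "?j p \<in> {R. ancestor_closed (fprod T1 T2) R}"
      using j[OF p(2,3)] p(1) by simp_all
    show "F (?j p) = (case p of (R1, R2) \<Rightarrow> F (R1 \<union> R2))" using p(1) by simp
  qed
  finally show ?thesis ..
qed

lemma subforest_rooting_insert:
  assumes "lions_forest0 T" "x \<notin> nodes T" "ancestor_closed T R"
  shows "subforest (rooting x T) (insert x R) = rooting x (subforest T R)"
proof (intro lforest_eqI)
  have "h \<inter> insert x R = h \<inter> R" if "h \<in> hyps T" for h
    using lions_forest0D(13)[OF assms(1) that] assms(2) by blast
  then show "hyps (subforest (rooting x T) (insert x R)) = hyps (rooting x (subforest T R))"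
    by (simp cong: image_cong)
  have R: "R \<subseteq> nodes T" using assms(3) by (rule ancestor_closed_subset)
  \<comment> \<open>No node of R loses its parent, so the cut creates no new roots that rooting
    would attach to x.\<close>
  have "roots (subforest T R) = roots T \<inter> R"
    using R ancestor_closedD[OF assms(3)] by (auto simp: roots_def)
  then show "edges (subforest (rooting x T) (insert x R)) = edges (rooting x (subforest T R))"
    using lions_forest0D(3)[OF assms(1)] assms(2) by (auto simp: roots_def)
  show "tagged (subforest (rooting x T) (insert x R)) = tagged (rooting x (subforest T R))" by auto
qed simp

lemma subforest_rooting:
  assumes "x \<notin> A"
  shows "subforest (rooting x T) A = subforest T A"
  using assms by (intro lforest_eqI) auto

lemma hyp_args_rooting: "hyp_args (rooting x T) A \<omega> = hyp_args T A \<omega>"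
  by (simp add: hyp_args_def)

lemma hyp_args_insert:
  assumes "lions_forest0 T" "x \<notin> nodes T"
  shows "hyp_args T (insert x R) \<omega> = hyp_args T R \<omega>"
proof (rule hyp_args_eqI[OF assms(1)])
  have *: "h \<inter> insert x R = h \<inter> R" if "h \<in> hyps T" for h
    using lions_forest0D(13)[OF assms(1) that] assms(2) by blast
  then have "hyps (subforest T (insert x R)) = hyps (subforest T R)" by (simp cong: image_cong)
  moreover have "hyp_args T (insert x R) \<omega> \<in> extensional (hyps (subforest T (insert x R)))"
    by (simp add: hyp_args_def)
  ultimately show "hyp_args T (insert x R) \<omega> \<in> extensional (hyps (subforest T R))" by metis
  fix h assume "h \<in> hyps T" "h \<inter> R \<noteq> {}"
  then show "hyp_args T (insert x R) \<omega> (h \<inter> R) = \<omega> h"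
    using hyp_args_Int[OF assms(1), of h "insert x R" \<omega>] *[of h] by simp
qed

text \<open>From any node of T the climb ends at a root of T and then at x, so a nonempty
  ancestor-closed set contains x. The rooting step of Chen's relation treats the two kinds of cuts
  separately.\<close>

lemma ancestor_closed_rooting:
  assumes "lions_forest0 T" "x \<notin> nodes T"
  shows "{R. ancestor_closed (rooting x T) R} = insert {} (insert x ` {R. ancestor_closed T R})"
proof (intro equalityI subsetI)
  fix R assume "R \<in> insert {} (insert x ` {R. ancestor_closed T R})"
  then show "R \<in> {R. ancestor_closed (rooting x T) R}"
    using lions_forest0D(3)[OF assms(1)] assms(2) by (auto simp: ancestor_closed_def)
next
  fix R assume "R \<in> {R. ancestor_closed (rooting x T) R}"
  then have R: "ancestor_closed (rooting x T) R" by simp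
  show "R \<in> insert {} (insert x ` {R. ancestor_closed T R})"
  proof (cases "R = {}")
    case False
    then obtain y where y: "y \<in> R" by auto
    have "x \<in> R"
    proof (cases "y = x")
      case False
      then have "y \<in> nodes T" using y ancestor_closed_subset[OF R] by auto
      then obtain t where t: "t \<in> nodes T" "(y, t) \<in> (edges T)\<^sup>*" "edges T `` {t} \<inter> nodes T = {}"
        using exists_top[OF lions_forest0D(5)[OF assms(1)]] by blast
      then have "t \<in> roots T" using lions_forest0D(3)[OF assms(1)] by (auto simp: roots_def)
      then have "(t, x) \<in> edges (rooting x T)" by simp
      moreover have "(y, t) \<in> (edges (rooting x T))\<^sup>*"
        using t(2) by (rule rtrancl_mono[THEN subsetD, rotated]) auto
      ultimately show ?thesis using ancestor_closed_rtrancl[OF R _ y] ancestor_closedD[OF R] by blast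
    qed (use y in simp)
    moreover have "ancestor_closed T (R - {x})"
      using R lions_forest0D(3)[OF assms(1)] assms(2) by (auto simp: ancestor_closed_def)
    ultimately show ?thesis by (intro insertI2 image_eqI[of _ _ "R - {x}"]) auto
  qed simp
qed

lemma sum_ancestor_closed_rooting:
  assumes "lions_forest0 T" "x \<notin> nodes T"
  shows "(\<Sum>R | ancestor_closed (rooting x T) R. F R) = F {} + (\<Sum>R | ancestor_closed T R. F (insert x R))"
proof -
  have x: "x \<notin> R" if "ancestor_closed T R" for R
    using ancestor_closed_subset[OF that] assms(2) by blast
  have inj: "inj_on (insert x) {R. ancestor_closed T R}"
  proof (rule inj_onI)
    fix R R' assume "R \<in> {R. ancestor_closed T R}" "R' \<in> {R. ancestor_closed T R}" "insert x R = insert x R'"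
    then show "R = R'" using x insert_ident[of x R R'] by simp
  qed
  have "(\<Sum>R | ancestor_closed (rooting x T) R. F R) = F {} + (\<Sum>R\<in>insert x ` {R. ancestor_closed T R}. F R)"
    unfolding ancestor_closed_rooting[OF assms]
    by (rule sum.insert) (use finite_ancestor_closed[OF assms(1)] in blast)+
  then show ?thesis using sum.reindex[OF inj, of F] by (simp add: comp_def)
qed

section \<open>Iterated integrals\<close>

lemma c1_space_derivative:
  fixes x :: "real \<Rightarrow> 'v::real_normed_vector"
  assumes "x \<in> c1_space"
  shows "t \<in> {0..1} \<Longrightarrow> (x has_vector_derivative path_deriv x t) (at t within {0..1})"
    and "continuous_on {0..1} (path_deriv x)"
proof -
  obtain x' where c: "continuous_on {0..1} x'"
    and d: "\<And>t. t \<in> {0..1} \<Longrightarrow> (x has_vector_derivative x' t) (at t within {0..1})"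
    using assms unfolding c1_space_def by blast
  have eq: "path_deriv x t = x' t" if "t \<in> {0..1}" for t
    unfolding path_deriv_def
    by (rule vector_derivative_within[OF _ d[OF that]])
      (use that in \<open>auto simp: trivial_limit_within islimpt_Icc\<close>)
  show "t \<in> {0..1} \<Longrightarrow> (x has_vector_derivative path_deriv x t) (at t within {0..1})"
    using d eq by simp
  show "continuous_on {0..1} (path_deriv x)"
    using c eq continuous_on_cong[of "{0..1}" "{0..1}" "path_deriv x" x'] by blast
qed

lemma LBINT_eq_diff:
  fixes g G :: "real \<Rightarrow> real"
  assumes "continuous_on {0..1} g" "s \<in> {0..1}" "t \<in> {0..1}"
    and "\<And>r. r \<in> {0..1} \<Longrightarrow> (G has_vector_derivative g r) (at r within {0..1})"
  shows "(LBINT r=s..t. g r) = G t - G s"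
proof (rule interval_integral_FTC_finite)
  have sub: "{min s t..max s t} \<subseteq> {0..1}" using assms(2,3) by auto
  show "continuous_on {min s t..max s t} g" using assms(1) sub by (rule continuous_on_subset)
  show "(G has_vector_derivative g r) (at r within {min s t..max s t})"
    if "min s t \<le> r" "r \<le> max s t" for r
  proof -
    have "r \<in> {0..1}" using subsetD[OF sub, of r] that by simp
    then show ?thesis by (intro has_vector_derivative_within_subset[OF _ sub] assms(4))
  qed
qed

text \<open>One G serves all pairs s, t in either order, so that additivity of the integral becomes
  cancellation of values of G.\<close>

lemma LBINT_antiderivative:
  fixes g :: "real \<Rightarrow> real"
  assumes "continuous_on {0..1} g"
  obtains G where "\<And>r. r \<in> {0..1} \<Longrightarrow> (G has_vector_derivative g r) (at r within {0..1})"
    "continuous_on {0..1} G"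
    "\<And>s t. s \<in> {0..1} \<Longrightarrow> t \<in> {0..1} \<Longrightarrow> (LBINT r=s..t. g r) = G t - G s"
proof -
  obtain G where G: "\<And>r. r \<in> {0..1} \<Longrightarrow> (G has_vector_derivative g r) (at r within {0..1})"
    using antiderivative_continuous[OF assms] by blast
  then have "continuous_on {0..1} G" by (rule continuous_on_vector_derivative)
  then show thesis using that G LBINT_eq_diff[OF assms _ _ G] by blast
qed

lemma LBINT_cong_unit:
  fixes f g :: "real \<Rightarrow> real" and s t :: real
  assumes "s \<in> {0..1}" "t \<in> {0..1}" "\<And>r. r \<in> {0..1} \<Longrightarrow> f r = g r"
  shows "(LBINT r=s..t. f r) = (LBINT r=s..t. g r)"
  by (rule interval_integral_cong) (use assms in \<open>auto simp: einterval_def min_def max_def split: if_splits\<close>)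

text \<open>This is the mean value inequality for an antiderivative. The condition
  \<open>\<bar>r - s\<bar> \<le> \<bar>t - s\<bar>\<close> holds on the segment between s and t
  whichever of them is larger, and inductive bounds in terms of \<open>\<bar>r - s\<bar>\<close> can
  be inserted directly.\<close>

lemma LBINT_abs_le:
  fixes g :: "real \<Rightarrow> real"
  assumes "continuous_on {0..1} g" "s \<in> {0..1}" "t \<in> {0..1}"
    and "\<And>r. r \<in> {0..1} \<Longrightarrow> \<bar>r - s\<bar> \<le> \<bar>t - s\<bar> \<Longrightarrow> \<bar>g r\<bar> \<le> B"
  shows "\<bar>LBINT r=s..t. g r\<bar> \<le> B * \<bar>t - s\<bar>"
proof -
  obtain G where G: "\<And>r. r \<in> {0..1} \<Longrightarrow> (G has_vector_derivative g r) (at r within {0..1})"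
    and "continuous_on {0..1} G"
    and eq: "\<And>s t. s \<in> {0..1} \<Longrightarrow> t \<in> {0..1} \<Longrightarrow> (LBINT r=s..t. g r) = G t - G s"
    by (rule LBINT_antiderivative[OF assms(1)]) blast
  let ?S = "{min s t..max s t}"
  have sub: "?S \<subseteq> {0..1}" using assms(2,3) by auto
  have "norm (G t - G s) \<le> B * norm (t - s)"
  proof (rule field_differentiable_bound[of ?S])
    fix r assume r: "r \<in> ?S"
    then have r': "r \<in> {0..1}" using sub by blast
    show "(G has_field_derivative g r) (at r within ?S)"
      using has_vector_derivative_within_subset[OF G[OF r'] sub]
      by (simp add: has_real_derivative_iff_has_vector_derivative)
    have "\<bar>r - s\<bar> \<le> \<bar>t - s\<bar>" using r by auto
    then show "norm (g r) \<le> B" using assms(4)[OF r'] by simp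
  qed auto
  then show ?thesis using eq[OF assms(2,3)] by simp
qed

lemma tprod_tensors:
  assumes "v \<in> tensors A" "w \<in> tensors B"
  shows "tprod v w \<in> tensors (A \<union> B)"
proof -
  have "tprod v w c = tprod v w c'" if "\<forall>x\<in>A \<union> B. c x = c' x" for c c'
  proof -
    have "v c = v c'" "w c = w c'" using assms that by (auto simp: tensors_def)
    then show ?thesis by (simp add: tprod_def)
  qed
  then show ?thesis by (simp add: tensors_def)
qed

text \<open>One sample is fixed here, with w its paths, so that the rest is deterministic analysis.
  \<open>0 \<le> \<gamma>\<close> lets the empty forest obey the same size bound as the other
  members of \<open>forests\<^sub>0\<close>.\<close>

locale iterated_integral_family =
  fixes N :: nat and \<gamma> \<alpha> :: real and w :: "nat \<Rightarrow> real \<Rightarrow> real ^ 'd::finite"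
    and I :: "real \<Rightarrow> real \<Rightarrow> (nat, 'd) mv_family"
  assumes alpha: "0 < \<alpha>" and gamma: "0 \<le> \<gamma>"
    and w: "\<And>i. i \<in> {1..N} \<Longrightarrow> w i \<in> c1_space"
    and I: "iterated_integrals N \<gamma> \<alpha> w I"
begin

lemma mem_iff: "T \<in> forests\<^sub>0 \<gamma> \<alpha> \<alpha> \<longleftrightarrow> lions_forest0 T \<and> \<alpha> * real (card (nodes T)) \<le> \<gamma>"
  using gamma by (rule forests\<^sub>0_iff)

lemma mem_forests: "T \<in> forests\<^sub>0 \<gamma> \<alpha> \<alpha> \<Longrightarrow> nodes T \<noteq> {} \<Longrightarrow> T \<in> forests \<gamma> \<alpha> \<alpha>"
  by (auto simp: mem_iff forests_iff)

lemma mem_mono: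
  assumes "lions_forest0 T" "T' \<in> forests\<^sub>0 \<gamma> \<alpha> \<alpha>" "card (nodes T) \<le> card (nodes T')"
  shows "T \<in> forests\<^sub>0 \<gamma> \<alpha> \<alpha>"
proof -
  have "\<alpha> * real (card (nodes T)) \<le> \<alpha> * real (card (nodes T'))"
    using alpha assms(3) by (intro mult_left_mono) auto
  then show ?thesis using assms by (auto simp: mem_iff)
qed

lemma mem_subforest:
  assumes "T \<in> forests\<^sub>0 \<gamma> \<alpha> \<alpha>" "ancestor_closed T R" "A = R \<or> A = nodes T - R"
  shows "subforest T A \<in> forests\<^sub>0 \<gamma> \<alpha> \<alpha>"
  using assms lions_forest0_subforest[of T R A] mem_mono mem_iff by blast

lemma mem_rootingD:
  assumes "rooting x T \<in> forests\<^sub>0 \<gamma> \<alpha> \<alpha>" "lions_forest0 T" "x \<notin> nodes T"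
  shows "T \<in> forests\<^sub>0 \<gamma> \<alpha> \<alpha>"
  by (rule mem_mono[OF assms(2,1)]) (use assms lions_forest0D(2)[OF assms(2)] in auto)

lemma mem_fprodD:
  assumes "fprod T1 T2 \<in> forests\<^sub>0 \<gamma> \<alpha> \<alpha>" "lions_forest0 T1" "lions_forest0 T2"
  shows "T1 \<in> forests\<^sub>0 \<gamma> \<alpha> \<alpha>" "T2 \<in> forests\<^sub>0 \<gamma> \<alpha> \<alpha>"
  by (rule mem_mono[OF assms(2,1)], use lions_forest0D(2)[OF assms(2)] lions_forest0D(2)[OF assms(3)] in \<open>simp add: card_mono\<close>)
    (rule mem_mono[OF assms(3,1)], use lions_forest0D(2)[OF assms(2)] lions_forest0D(2)[OF assms(3)] in \<open>simp add: card_mono\<close>)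

lemma mem_decoupleD:
  assumes "decouple T \<in> forests\<^sub>0 \<gamma> \<alpha> \<alpha>" "lions_forest0 T"
  shows "T \<in> forests\<^sub>0 \<gamma> \<alpha> \<alpha>"
  by (rule mem_mono[OF assms(2,1)]) simp

text \<open>Each operation yields at least as many nodes as its arguments have, so membership passes
  down and the structural induction stays within the truncation.\<close>

lemma mem_induct [consumes 1, case_names empty rooting fprod decouple]:
  assumes "T \<in> forests\<^sub>0 \<gamma> \<alpha> \<alpha>" and "P empty_forest"
    and "\<And>x T. T \<in> forests\<^sub>0 \<gamma> \<alpha> \<alpha> \<Longrightarrow> x \<notin> nodes T \<Longrightarrow> rooting x T \<in> forests\<^sub>0 \<gamma> \<alpha> \<alpha> \<Longrightarrow> P T \<Longrightarrow>
      P (rooting x T)"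
    and "\<And>T1 T2. T1 \<in> forests\<^sub>0 \<gamma> \<alpha> \<alpha> \<Longrightarrow> T2 \<in> forests\<^sub>0 \<gamma> \<alpha> \<alpha> \<Longrightarrow> nodes T1 \<inter> nodes T2 = {} \<Longrightarrow>
      fprod T1 T2 \<in> forests\<^sub>0 \<gamma> \<alpha> \<alpha> \<Longrightarrow> P T1 \<Longrightarrow> P T2 \<Longrightarrow> P (fprod T1 T2)"
    and "\<And>T. T \<in> forests\<^sub>0 \<gamma> \<alpha> \<alpha> \<Longrightarrow> tagged T \<noteq> {} \<Longrightarrow> decouple T \<in> forests\<^sub>0 \<gamma> \<alpha> \<alpha> \<Longrightarrow> P T \<Longrightarrow>
      P (decouple T)"
  shows "P T"
proof -
  have "lions_forest0 T" using assms(1) by (simp add: mem_iff)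
  then have "T \<in> forests\<^sub>0 \<gamma> \<alpha> \<alpha> \<longrightarrow> P T"
  proof (induction rule: lions_forest0_induct)
    case empty
    then show ?case using assms(2) by simp
  next
    case (rooting x T)
    then show ?case using assms(3) mem_rootingD by blast
  next
    case (fprod T1 T2)
    then show ?case using assms(4) mem_fprodD by blast
  next
    case (decouple T)
    then show ?case using assms(5) mem_decoupleD by blast
  qed
  then show ?thesis using assms(1) by simp
qed

lemma deriv_continuous: "i \<in> {1..N} \<Longrightarrow> continuous_on {0..1} (\<lambda>r. path_deriv (w i) r $ k)"
  using c1_space_derivative(2)[OF w] by (intro continuous_on_component)

lemma I_empty:
  assumes "s \<in> {0..1}" "t \<in> {0..1}" "i \<in> {1..N}"
  shows "I s t empty_forest i (\<lambda>_. undefined) = (\<lambda>_. 1)"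
  using I assms unfolding iterated_integrals_def by blast

text \<open>Cuts of a product may have an empty factor, which the rule in
  \<open>iterated_integrals\<close> excludes; there the claim reduces to \<open>I_empty\<close>,
  since the empty forest is neutral for \<open>fprod\<close>.\<close>

lemma I_fprod:
  assumes "s \<in> {0..1}" "t \<in> {0..1}" "i \<in> {1..N}" "lions_forest0 T1" "lions_forest0 T2" "nodes T1 \<inter> nodes T2 = {}"
    and T: "fprod T1 T2 \<in> forests\<^sub>0 \<gamma> \<alpha> \<alpha>" and \<iota>: "\<iota> \<in> hyps (fprod T1 T2) \<rightarrow>\<^sub>E {1..N}"
  shows "I s t (fprod T1 T2) i \<iota> =
    tprod (I s t T1 i (restrict \<iota> (hyps T1))) (I s t T2 i (restrict \<iota> (hyps T2)))"
proof -
  have [simp]: "restrict \<iota> {} = (\<lambda>_. undefined)" by (simp add: restrict_def)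
  consider "T1 = empty_forest" | "T2 = empty_forest" | "nodes T1 \<noteq> {}" "nodes T2 \<noteq> {}"
    using assms(4,5) lions_forest0_nodes_empty_iff by blast
  then show ?thesis
  proof cases
    case 1
    then have "restrict \<iota> (hyps T2) = \<iota>" using \<iota> by (simp add: PiE_restrict)
    then show ?thesis using 1 I_empty[OF assms(1-3)] by (simp add: fprod_empty tprod_def)
  next
    case 2
    then have "restrict \<iota> (hyps T1) = \<iota>" using \<iota> by (simp add: PiE_restrict)
    then show ?thesis using 2 I_empty[OF assms(1-3)] by (simp add: fprod_empty tprod_def)
  next
    case 3
    then have "lions_forest T1" "lions_forest T2" "fprod T1 T2 \<in> forests \<gamma> \<alpha> \<alpha>"
      using assms(4,5) mem_forests[OF T] by (simp_all add: lions_forest_iff)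
    then show ?thesis using I assms(1-3,6) \<iota> unfolding iterated_integrals_def by blast
  qed
qed

text \<open>The rule for a single node becomes the case of the empty forest: an increment of the
  path is the integral of 1 against dw, by the fundamental theorem. Inductions then need only one
  rooting case.\<close>

lemma I_rooting:
  assumes "s \<in> {0..1}" "t \<in> {0..1}" "i \<in> {1..N}" "lions_forest0 T" "x \<notin> nodes T"
    and T: "rooting x T \<in> forests\<^sub>0 \<gamma> \<alpha> \<alpha>" and \<iota>: "\<iota> \<in> hyps T \<rightarrow>\<^sub>E {1..N}"
  shows "I s t (rooting x T) i \<iota> c = (LBINT r=s..t. I s r T i \<iota> c * path_deriv (w i) r $ c x)"
proof -
  have T': "rooting x T \<in> forests \<gamma> \<alpha> \<alpha>" using mem_forests[OF T] by simp
  show ?thesis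
  proof (cases "T = empty_forest")
    case True
    then have [simp]: "\<iota> = (\<lambda>_. undefined)" using \<iota> by simp
    have "I s t (rooting x T) i \<iota> c = (w i t - w i s) $ c x"
      using I assms(1-3) T' True unfolding iterated_integrals_def by simp
    also have "\<dots> = w i t $ c x - w i s $ c x" by simp
    also have "\<dots> = (LBINT r=s..t. path_deriv (w i) r $ c x)"
      using c1_space_derivative(1)[OF w[OF assms(3)]]
      by (intro LBINT_eq_diff[symmetric] deriv_continuous assms)
        (intro bounded_linear.has_vector_derivative[OF bounded_linear_vec_nth])
    also have "\<dots> = (LBINT r=s..t. I s r T i \<iota> c * path_deriv (w i) r $ c x)"
      by (rule LBINT_cong_unit) (use assms True I_empty in auto)
    finally show ?thesis .
  next
    case False
    then have "lions_forest T" using assms(4) lions_forest0_nodes_empty_iff by (auto simp: lions_forest_iff)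
    then have "I s t (rooting x T) i \<iota> = (\<lambda>c. LBINT r=s..t. I s r T i \<iota> c * path_deriv (w i) r $ c x)"
      using I assms(1-3,5) T' \<iota> unfolding iterated_integrals_def by blast
    then show ?thesis by simp
  qed
qed

lemma restrict_PiE: "\<iota> \<in> A \<rightarrow>\<^sub>E X \<Longrightarrow> B \<subseteq> A \<Longrightarrow> restrict \<iota> B \<in> B \<rightarrow>\<^sub>E X"
  by auto

lemma restrict_decouple: "lions_forest0 T \<Longrightarrow> \<iota> \<in> hyps (decouple T) \<rightarrow>\<^sub>E X \<Longrightarrow> restrict \<iota> (hyps T) \<in> hyps T \<rightarrow>\<^sub>E X"
  by (rule restrict_PiE) (use lions_forest0D(12)[of T] in \<open>auto simp: all_hyps_def\<close>)

lemma decouple_arg: "\<iota> \<in> hyps (decouple T) \<rightarrow>\<^sub>E X \<Longrightarrow> tagged T \<noteq> {} \<Longrightarrow> \<iota> (tagged T) \<in> X"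
  by (erule PiE_mem) (simp add: all_hyps_def)

lemma I_decouple_tagged:
  assumes "s \<in> {0..1}" "t \<in> {0..1}" "i \<in> {1..N}" "lions_forest0 T" "tagged T \<noteq> {}"
    and T: "decouple T \<in> forests\<^sub>0 \<gamma> \<alpha> \<alpha>" and \<iota>: "\<iota> \<in> hyps (decouple T) \<rightarrow>\<^sub>E {1..N}"
  shows "I s t (decouple T) i \<iota> = I s t T (\<iota> (tagged T)) (restrict \<iota> (hyps T))"
proof -
  have "nodes T \<noteq> {}" using assms(5) lions_forest0D(6)[OF assms(4)] by auto
  then have "lions_forest T" "decouple T \<in> forests \<gamma> \<alpha> \<alpha>"
    using assms(4) mem_forests[OF T] by (simp_all add: lions_forest_iff)
  then show ?thesis using I assms(1-3,5) \<iota> unfolding iterated_integrals_def by blast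
qed

text \<open>The outermost operation is never a rooting, as that tags a node; products have untagged
  factors, and the decoupling of a tagged forest takes its index from \<iota> instead of i.\<close>

lemma I_untagged:
  assumes "s \<in> {0..1}" "t \<in> {0..1}" "i \<in> {1..N}" "j \<in> {1..N}" "T \<in> forests\<^sub>0 \<gamma> \<alpha> \<alpha>"
    "tagged T = {}" "\<iota> \<in> hyps T \<rightarrow>\<^sub>E {1..N}"
  shows "I s t T i \<iota> = I s t T j \<iota>"
  using assms(5-)
proof (induction arbitrary: \<iota> rule: mem_induct)
  case empty
  then show ?case using I_empty assms(1-4) by simp
next
  case (fprod T1 T2)
  have "restrict \<iota> (hyps T1) \<in> hyps T1 \<rightarrow>\<^sub>E {1..N}" "restrict \<iota> (hyps T2) \<in> hyps T2 \<rightarrow>\<^sub>E {1..N}"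
    using fprod.prems(2) by (auto intro: restrict_PiE)
  then have "I s t T1 i (restrict \<iota> (hyps T1)) = I s t T1 j (restrict \<iota> (hyps T1))"
    "I s t T2 i (restrict \<iota> (hyps T2)) = I s t T2 j (restrict \<iota> (hyps T2))"
    using fprod.IH fprod.prems(1) by auto
  then show ?case
    using I_fprod[OF assms(1,2) _ _ _ fprod.hyps(3,4) fprod.prems(2)] fprod.hyps(1,2) assms(3,4)
    by (simp add: mem_iff)
next
  case (decouple T)
  then show ?case using I_decouple_tagged[OF assms(1,2) _ _ decouple.hyps(2,3) decouple.prems(2)] assms(3,4)
    by (simp add: mem_iff)
qed simp

text \<open>A cut of a tagged forest may retain no tagged node. Then \<open>decouple\<close> does
  nothing and, by \<open>I_untagged\<close>, any index j serves.\<close>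

lemma I_decouple:
  assumes "s \<in> {0..1}" "t \<in> {0..1}" "i \<in> {1..N}" "j \<in> {1..N}" "lions_forest0 T"
    and T: "decouple T \<in> forests\<^sub>0 \<gamma> \<alpha> \<alpha>" and \<iota>: "\<iota> \<in> hyps (decouple T) \<rightarrow>\<^sub>E {1..N}"
    and j: "tagged T \<noteq> {} \<Longrightarrow> j = \<iota> (tagged T)"
  shows "I s t (decouple T) i \<iota> = I s t T j (restrict \<iota> (hyps T))"
proof (cases "tagged T = {}")
  case True
  then have eq: "decouple T = T" by (rule decouple_untagged[OF assms(5)])
  have "I s t T i \<iota> = I s t T j \<iota>" using I_untagged[OF assms(1-4)] T \<iota> True eq by simp
  moreover have "restrict \<iota> (hyps T) = \<iota>" using \<iota> eq by (simp add: PiE_restrict)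
  ultimately show ?thesis using eq by simp
qed (use I_decouple_tagged[OF assms(1-3,5) _ T \<iota>] j in simp)

lemma I_tensors:
  assumes "T \<in> forests\<^sub>0 \<gamma> \<alpha> \<alpha>" "s \<in> {0..1}" "t \<in> {0..1}" "i \<in> {1..N}" "\<iota> \<in> hyps T \<rightarrow>\<^sub>E {1..N}"
  shows "I s t T i \<iota> \<in> tensors (nodes T)"
  using assms
proof (induction arbitrary: s t i \<iota> rule: mem_induct)
  case empty
  then show ?case by (simp add: I_empty tensors_def)
next
  case (rooting x T)
  have T: "lions_forest0 T" using rooting.hyps(1) by (simp add: mem_iff)
  have \<iota>: "\<iota> \<in> hyps T \<rightarrow>\<^sub>E {1..N}" using rooting.prems(4) by simp
  have "I s t (rooting x T) i \<iota> c = I s t (rooting x T) i \<iota> c'"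
    if c: "\<forall>y\<in>insert x (nodes T). c y = c' y" for c c'
    unfolding I_rooting[OF rooting.prems(1-3) T rooting.hyps(2,3) \<iota>]
  proof (rule LBINT_cong_unit[OF rooting.prems(1,2)])
    fix r :: real assume r: "r \<in> {0..1}"
    have "I s r T i \<iota> c = I s r T i \<iota> c'"
      using rooting.IH[OF rooting.prems(1) r rooting.prems(3) \<iota>] c by (simp add: tensors_def)
    then show "I s r T i \<iota> c * path_deriv (w i) r $ c x = I s r T i \<iota> c' * path_deriv (w i) r $ c' x"
      using c by simp
  qed
  then show ?case by (simp add: tensors_def)
next
  case (fprod T1 T2)
  have \<iota>: "restrict \<iota> (hyps T1) \<in> hyps T1 \<rightarrow>\<^sub>E {1..N}" "restrict \<iota> (hyps T2) \<in> hyps T2 \<rightarrow>\<^sub>E {1..N}"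
    using fprod.prems(4) by (auto intro: restrict_PiE)
  have T: "lions_forest0 T1" "lions_forest0 T2" using fprod.hyps(1,2) by (simp_all add: mem_iff)
  show ?case
    unfolding I_fprod[OF fprod.prems(1-3) T fprod.hyps(3,4) fprod.prems(4)] forest_sel_simps
    by (intro tprod_tensors fprod.IH fprod.prems(1-3) \<iota>)
next
  case (decouple T)
  have T: "lions_forest0 T" using decouple.hyps(1) by (simp add: mem_iff)
  show ?case
    unfolding I_decouple_tagged[OF decouple.prems(1-3) T decouple.hyps(2,3) decouple.prems(4)] forest_sel_simps
    by (rule decouple.IH[OF decouple.prems(1,2) decouple_arg[OF decouple.prems(4) decouple.hyps(2)]
      restrict_decouple[OF T decouple.prems(4)]])
qed

text \<open>The fundamental theorem needs a continuous integrand in the rooting rule. In the rooting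
  case itself the function is an antiderivative up to a constant.\<close>

lemma I_continuous:
  assumes "T \<in> forests\<^sub>0 \<gamma> \<alpha> \<alpha>" "s \<in> {0..1}" "i \<in> {1..N}" "\<iota> \<in> hyps T \<rightarrow>\<^sub>E {1..N}"
  shows "continuous_on {0..1} (\<lambda>r. I s r T i \<iota> c)"
  using assms
proof (induction arbitrary: i \<iota> rule: mem_induct)
  case empty
  have "continuous_on {0..1} (\<lambda>r. I s r empty_forest i \<iota> c) \<longleftrightarrow> continuous_on {0..1} (\<lambda>r::real. 1::real)"
    by (rule continuous_on_cong) (use empty I_empty in auto)
  then show ?case by simp
next
  case (rooting x T)
  have T: "lions_forest0 T" using rooting.hyps(1) by (simp add: mem_iff)
  have \<iota>: "\<iota> \<in> hyps T \<rightarrow>\<^sub>E {1..N}" using rooting.prems(3) by simp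
  have "continuous_on {0..1} (\<lambda>r. I s r T i \<iota> c * path_deriv (w i) r $ c x)"
    by (intro continuous_on_mult rooting.IH rooting.prems \<iota> deriv_continuous)
  then obtain G where
    "\<And>r. r \<in> {0..1} \<Longrightarrow> (G has_vector_derivative I s r T i \<iota> c * path_deriv (w i) r $ c x) (at r within {0..1})"
    and G: "continuous_on {0..1} G"
    "\<And>s' t. s' \<in> {0..1} \<Longrightarrow> t \<in> {0..1} \<Longrightarrow> (LBINT r=s'..t. I s r T i \<iota> c * path_deriv (w i) r $ c x) = G t - G s'"
    by (rule LBINT_antiderivative) blast
  have "continuous_on {0..1} (\<lambda>r. I s r (rooting x T) i \<iota> c) \<longleftrightarrow> continuous_on {0..1} (\<lambda>r. G r - G s)"
    by (rule continuous_on_cong)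
      (use I_rooting[OF rooting.prems(1) _ rooting.prems(2) T rooting.hyps(2,3) \<iota>] G(2)[OF rooting.prems(1)] in auto)
  then show ?case using G(1) by (simp add: continuous_on_diff)
next
  case (fprod T1 T2)
  have \<iota>: "restrict \<iota> (hyps T1) \<in> hyps T1 \<rightarrow>\<^sub>E {1..N}" "restrict \<iota> (hyps T2) \<in> hyps T2 \<rightarrow>\<^sub>E {1..N}"
    using fprod.prems(3) by (auto intro: restrict_PiE)
  have "continuous_on {0..1} (\<lambda>r. I s r (fprod T1 T2) i \<iota> c) \<longleftrightarrow>
      continuous_on {0..1} (\<lambda>r. I s r T1 i (restrict \<iota> (hyps T1)) c * I s r T2 i (restrict \<iota> (hyps T2)) c)"
    by (rule continuous_on_cong)
      (use I_fprod[OF fprod.prems(1) _ fprod.prems(2) _ _ fprod.hyps(3,4) fprod.prems(3)] fprod.hyps(1,2)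
        in \<open>auto simp: mem_iff tprod_def\<close>)
  then show ?case
    using fprod.IH(1)[OF fprod.prems(1,2) \<iota>(1)] fprod.IH(2)[OF fprod.prems(1,2) \<iota>(2)]
    by (simp add: continuous_on_mult)
next
  case (decouple T)
  have T: "lions_forest0 T" using decouple.hyps(1) by (simp add: mem_iff)
  have \<iota>: "\<iota> (tagged T) \<in> {1..N}" by (rule decouple_arg[OF decouple.prems(3) decouple.hyps(2)])
  have "continuous_on {0..1} (\<lambda>r. I s r (decouple T) i \<iota> c) \<longleftrightarrow>
      continuous_on {0..1} (\<lambda>r. I s r T (\<iota> (tagged T)) (restrict \<iota> (hyps T)) c)"
    by (rule continuous_on_cong)
      (use I_decouple_tagged[OF decouple.prems(1) _ decouple.prems(2) T decouple.hyps(2,3) decouple.prems(3)]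
        in auto)
  also have \<dots>
    by (rule decouple.IH[OF decouple.prems(1) \<iota> restrict_decouple[OF T decouple.prems(3)]])
  finally show ?case .
qed

lemma exists_deriv_bound: "\<exists>K\<ge>0. \<forall>i\<in>{1..N}. \<forall>r\<in>{0..1}. \<forall>k. \<bar>path_deriv (w i) r $ k\<bar> \<le> K"
proof -
  have "\<exists>B. \<forall>r\<in>{0..1}. norm (path_deriv (w i) r) \<le> B" if "i \<in> {1..N}" for i
  proof -
    have "bounded (path_deriv (w i) ` {0..1})"
      using c1_space_derivative(2)[OF w[OF that]] by (intro compact_imp_bounded compact_continuous_image) auto
    then show ?thesis by (auto simp: bounded_iff)
  qed
  then obtain B where B: "\<And>i r. i \<in> {1..N} \<Longrightarrow> r \<in> {0..1} \<Longrightarrow> norm (path_deriv (w i) r) \<le> B i" by metis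
  \<comment> \<open>Summing over the finitely many indices gives a common bound without a maximum
    over a possibly empty set.\<close>
  have "\<bar>path_deriv (w i) r $ k\<bar> \<le> (\<Sum>i\<in>{1..N}. \<bar>B i\<bar>)" if "i \<in> {1..N}" "r \<in> {0..1}" for i r k
  proof -
    have "\<bar>path_deriv (w i) r $ k\<bar> \<le> norm (path_deriv (w i) r)" by (rule component_le_norm_cart)
    also have "\<dots> \<le> \<bar>B i\<bar>" using B[OF that] by linarith
    also have "\<dots> \<le> (\<Sum>i\<in>{1..N}. \<bar>B i\<bar>)" using that(1) by (intro member_le_sum) auto
    finally show ?thesis .
  qed
  then show ?thesis by (intro exI[of _ "\<Sum>i\<in>{1..N}. \<bar>B i\<bar>"]) (auto simp: sum_nonneg)
qed

text \<open>Each node contributes one factor \<open>K * \<bar>t - s\<bar>\<close>: on rooting, the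
  inductive bound at r is replaced by its value at t, and the integral adds K times the length. The
  index i is generalised because decoupling changes it.\<close>

lemma I_bound:
  assumes K: "0 \<le> K" "\<And>i r k. i \<in> {1..N} \<Longrightarrow> r \<in> {0..1} \<Longrightarrow> \<bar>path_deriv (w i) r $ k\<bar> \<le> K"
    and "T \<in> forests\<^sub>0 \<gamma> \<alpha> \<alpha>" "s \<in> {0..1}" "t \<in> {0..1}" "i \<in> {1..N}" "\<iota> \<in> hyps T \<rightarrow>\<^sub>E {1..N}"
  shows "\<bar>I s t T i \<iota> c\<bar> \<le> (K * \<bar>t - s\<bar>) ^ card (nodes T)"
  using assms(3-)
proof (induction arbitrary: t i \<iota> rule: mem_induct)
  case empty
  then show ?case by (simp add: I_empty)
next
  case (rooting x T)
  have T: "lions_forest0 T" using rooting.hyps(1) by (simp add: mem_iff)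
  have \<iota>: "\<iota> \<in> hyps T \<rightarrow>\<^sub>E {1..N}" using rooting.prems(4) by simp
  have "\<bar>I s t (rooting x T) i \<iota> c\<bar> \<le> ((K * \<bar>t - s\<bar>) ^ card (nodes T) * K) * \<bar>t - s\<bar>"
    unfolding I_rooting[OF rooting.prems(1-3) T rooting.hyps(2,3) \<iota>]
  proof (rule LBINT_abs_le)
    show "continuous_on {0..1} (\<lambda>r. I s r T i \<iota> c * path_deriv (w i) r $ c x)"
      by (intro continuous_on_mult I_continuous rooting.hyps rooting.prems \<iota> deriv_continuous)
    fix r :: real assume r: "r \<in> {0..1}" "\<bar>r - s\<bar> \<le> \<bar>t - s\<bar>"
    have "\<bar>I s r T i \<iota> c\<bar> \<le> (K * \<bar>r - s\<bar>) ^ card (nodes T)"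
      by (rule rooting.IH[OF rooting.prems(1) r(1) rooting.prems(3) \<iota>])
    also have "\<dots> \<le> (K * \<bar>t - s\<bar>) ^ card (nodes T)"
      using r(2) K(1) by (intro power_mono mult_left_mono) auto
    finally show "\<bar>I s r T i \<iota> c * path_deriv (w i) r $ c x\<bar> \<le> (K * \<bar>t - s\<bar>) ^ card (nodes T) * K"
      using K(1) K(2)[OF rooting.prems(3) r(1)] by (simp add: abs_mult mult_mono)
  qed (use rooting.prems in auto)
  also have "\<dots> = (K * \<bar>t - s\<bar>) ^ card (nodes (rooting x T))"
    using rooting.hyps(2) lions_forest0D(2)[OF T] by simp
  finally show ?case .
next
  case (fprod T1 T2)
  have \<iota>: "restrict \<iota> (hyps T1) \<in> hyps T1 \<rightarrow>\<^sub>E {1..N}" "restrict \<iota> (hyps T2) \<in> hyps T2 \<rightarrow>\<^sub>E {1..N}"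
    using fprod.prems(4) by (auto intro: restrict_PiE)
  have T: "lions_forest0 T1" "lions_forest0 T2" using fprod.hyps(1,2) by (simp_all add: mem_iff)
  have "\<bar>I s t (fprod T1 T2) i \<iota> c\<bar> =
      \<bar>I s t T1 i (restrict \<iota> (hyps T1)) c\<bar> * \<bar>I s t T2 i (restrict \<iota> (hyps T2)) c\<bar>"
    using I_fprod[OF fprod.prems(1-3) T fprod.hyps(3,4) fprod.prems(4)] by (simp add: tprod_def abs_mult)
  also have "\<dots> \<le> (K * \<bar>t - s\<bar>) ^ card (nodes T1) * (K * \<bar>t - s\<bar>) ^ card (nodes T2)"
    by (intro mult_mono fprod.IH fprod.prems(1-3) \<iota>) (use K(1) in auto)
  also have "\<dots> = (K * \<bar>t - s\<bar>) ^ card (nodes (fprod T1 T2))"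
    using lions_forest0D(2)[OF T(1)] lions_forest0D(2)[OF T(2)] fprod.hyps(3) by (simp add: card_Un_disjoint power_add)
  finally show ?case .
next
  case (decouple T)
  have T: "lions_forest0 T" using decouple.hyps(1) by (simp add: mem_iff)
  show ?case
    unfolding I_decouple_tagged[OF decouple.prems(1-3) T decouple.hyps(2,3) decouple.prems(4)] forest_sel_simps
    by (rule decouple.IH[OF decouple.prems(1,2) decouple_arg[OF decouple.prems(4) decouple.hyps(2)]
      restrict_decouple[OF T decouple.prems(4)]])
qed

text \<open>At \<open>t = s\<close> the bound is a power of 0, which vanishes for a positive number
  of nodes.\<close>

lemma I_diagonal:
  assumes "T \<in> forests\<^sub>0 \<gamma> \<alpha> \<alpha>" "s \<in> {0..1}" "i \<in> {1..N}" "\<iota> \<in> hyps T \<rightarrow>\<^sub>E {1..N}"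
  shows "I s s T i \<iota> = mv_unit T i \<iota>"
proof (cases "T = empty_forest")
  case True
  then show ?thesis using assms I_empty by (simp add: mv_unit_def)
next
  case False
  have T: "lions_forest0 T" using assms(1) by (simp add: mem_iff)
  then have "card (nodes T) > 0"
    using False lions_forest0D(2) lions_forest0_nodes_empty_iff by (auto simp: card_gt_0_iff)
  moreover obtain K where "0 \<le> K"
    "\<And>i r k. i \<in> {1..N} \<Longrightarrow> r \<in> {0..1} \<Longrightarrow> \<bar>path_deriv (w i) r $ k\<bar> \<le> K"
    using exists_deriv_bound by blast
  ultimately have "I s s T i \<iota> c = 0" for c
    using I_bound[of K T s s i \<iota> c] assms by (simp add: power_0_left)
  then show ?thesis using False by (auto simp: mv_unit_def)
qed

end

section \<open>Relabelling and Chen's relation\<close>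

lemma roots_relabel:
  assumes "lions_forest0 T" "inj_on \<phi> (nodes T)"
  shows "roots (relabel \<phi> T) = \<phi> ` roots T"
proof -
  note D = lions_forest0D[OF assms(1)]
  have "\<phi> x \<in> roots (relabel \<phi> T) \<longleftrightarrow> x \<in> roots T" if x: "x \<in> nodes T" for x
  proof -
    have "(\<exists>z. (\<phi> x, z) \<in> map_prod \<phi> \<phi> ` edges T) \<longleftrightarrow> (\<exists>z. (x, z) \<in> edges T)"
    proof (intro iffI; elim exE)
      fix z assume "(\<phi> x, z) \<in> map_prod \<phi> \<phi> ` edges T"
      then obtain a b where ab: "(a, b) \<in> edges T" "\<phi> x = \<phi> a" by auto
      then have "x = a" using inj_onD[OF assms(2) ab(2)] x D(3) by auto
      then show "\<exists>z. (x, z) \<in> edges T" using ab by blast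
    next
      fix z assume "(x, z) \<in> edges T"
      then have "(\<phi> x, \<phi> z) \<in> map_prod \<phi> \<phi> ` edges T" by (rule rev_image_eqI) simp
      then show "\<exists>z. (\<phi> x, z) \<in> map_prod \<phi> \<phi> ` edges T" ..
    qed
    then show ?thesis using x by (simp add: roots_def) meson
  qed
  moreover have "roots T \<subseteq> nodes T" by (auto simp: roots_def)
  moreover have "roots (relabel \<phi> T) \<subseteq> nodes (relabel \<phi> T)" unfolding roots_def by blast
  then have "roots (relabel \<phi> T) \<subseteq> \<phi> ` nodes T" by simp
  ultimately show ?thesis by blast
qed

lemma relabel_rooting:
  assumes "lions_forest0 T" "inj_on \<phi> (insert x (nodes T))"
  shows "relabel \<phi> (rooting x T) = rooting (\<phi> x) (relabel \<phi> T)"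
proof -
  have "inj_on \<phi> (nodes T)" using assms(2) by (rule inj_on_subset) blast
  then show ?thesis
    by (intro lforest_eqI) (auto simp: roots_relabel[OF assms(1)] image_Un)
qed

lemma relabel_fprod: "relabel \<phi> (fprod T1 T2) = fprod (relabel \<phi> T1) (relabel \<phi> T2)"
  by (intro lforest_eqI) (auto simp: image_Un)

lemma relabel_decouple: "relabel \<phi> (decouple T) = decouple (relabel \<phi> T)"
  by (intro lforest_eqI) (auto simp: all_hyps_def)

lemma relabel_empty: "relabel \<phi> empty_forest = empty_forest"
  by (intro lforest_eqI) auto

lemma relabel_args_PiE:
  "\<iota> \<in> hyps (relabel \<phi> T) \<rightarrow>\<^sub>E X \<Longrightarrow> (\<lambda>h\<in>hyps T. \<iota> (\<phi> ` h)) \<in> hyps T \<rightarrow>\<^sub>E X"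
  by (rule PiE_I) auto

context iterated_integral_family
begin

lemma mem_relabel:
  assumes "T \<in> forests\<^sub>0 \<gamma> \<alpha> \<alpha>" "inj_on \<phi> (nodes T)"
  shows "relabel \<phi> T \<in> forests\<^sub>0 \<gamma> \<alpha> \<alpha>"
  using assms lions_forest0_relabel by (simp add: mem_iff card_image)

text \<open>The rules in \<open>iterated_integrals\<close> speak of concrete node sets and do not
  postulate the compatibility with isomorphisms that \<open>mv_characters\<close> demands. It
  follows by induction because relabelling commutes with the three operations.\<close>

lemma I_relabel:
  assumes "T \<in> forests\<^sub>0 \<gamma> \<alpha> \<alpha>" "inj_on \<phi> (nodes T)" "s \<in> {0..1}" "t \<in> {0..1}" "i \<in> {1..N}"
    "\<iota> \<in> hyps (relabel \<phi> T) \<rightarrow>\<^sub>E {1..N}"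
  shows "I s t (relabel \<phi> T) i \<iota> c = I s t T i (\<lambda>h\<in>hyps T. \<iota> (\<phi> ` h)) (c \<circ> \<phi>)"
  using assms
proof (induction arbitrary: t i \<iota> rule: mem_induct)
  case empty
  moreover have "(\<lambda>h\<in>hyps empty_forest. \<iota> (\<phi> ` h)) = (\<lambda>_. undefined)" by auto
  ultimately show ?case by (simp add: relabel_empty I_empty)
next
  case (rooting x T)
  have T: "lions_forest0 T" using rooting.hyps(1) by (simp add: mem_iff)
  have inj: "inj_on \<phi> (nodes T)" "\<phi> x \<notin> nodes (relabel \<phi> T)"
    using rooting.prems(1) rooting.hyps(2) by (auto simp: inj_on_def)
  have eq: "relabel \<phi> (rooting x T) = rooting (\<phi> x) (relabel \<phi> T)"
    using relabel_rooting[OF T] rooting.prems(1) by simp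
  have R: "rooting (\<phi> x) (relabel \<phi> T) \<in> forests\<^sub>0 \<gamma> \<alpha> \<alpha>" "lions_forest0 (relabel \<phi> T)"
    using mem_relabel[OF rooting.hyps(3) rooting.prems(1)] eq lions_forest0_relabel[OF T inj(1)] by simp_all
  have \<iota>: "\<iota> \<in> hyps (relabel \<phi> T) \<rightarrow>\<^sub>E {1..N}" using rooting.prems(5) by simp
  have "I s t (relabel \<phi> (rooting x T)) i \<iota> c =
      (LBINT r=s..t. I s r (relabel \<phi> T) i \<iota> c * path_deriv (w i) r $ c (\<phi> x))"
    unfolding eq by (rule I_rooting[OF rooting.prems(2-4) R(2) inj(2) R(1) \<iota>])
  also have "\<dots> = (LBINT r=s..t. I s r T i (\<lambda>h\<in>hyps T. \<iota> (\<phi> ` h)) (c \<circ> \<phi>) * path_deriv (w i) r $ (c \<circ> \<phi>) x)"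
  proof (rule LBINT_cong_unit[OF rooting.prems(2,3)])
    fix r :: real assume r: "r \<in> {0..1}"
    show "I s r (relabel \<phi> T) i \<iota> c * path_deriv (w i) r $ c (\<phi> x) =
        I s r T i (\<lambda>h\<in>hyps T. \<iota> (\<phi> ` h)) (c \<circ> \<phi>) * path_deriv (w i) r $ (c \<circ> \<phi>) x"
      unfolding rooting.IH[OF inj(1) rooting.prems(2) r rooting.prems(4) \<iota>] comp_apply ..
  qed
  also have "\<dots> = I s t (rooting x T) i (\<lambda>h\<in>hyps T. \<iota> (\<phi> ` h)) (c \<circ> \<phi>)"
    by (rule I_rooting[OF rooting.prems(2-4) T rooting.hyps(2,3) relabel_args_PiE[OF \<iota>], symmetric])
  finally show ?case by (simp only: forest_sel_simps)
next
  case (fprod T1 T2)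
  have T: "lions_forest0 T1" "lions_forest0 T2" using fprod.hyps(1,2) by (simp_all add: mem_iff)
  have inj: "inj_on \<phi> (nodes T1)" "inj_on \<phi> (nodes T2)"
    using fprod.prems(1) by (auto simp: inj_on_def)
  have disj: "nodes (relabel \<phi> T1) \<inter> nodes (relabel \<phi> T2) = {}"
    using fprod.prems(1) fprod.hyps(3) by (auto simp: inj_on_def)
  have \<iota>: "\<iota> \<in> hyps (fprod (relabel \<phi> T1) (relabel \<phi> T2)) \<rightarrow>\<^sub>E {1..N}"
    using fprod.prems(5) by (simp add: relabel_fprod)
  have \<iota>': "restrict \<iota> (hyps (relabel \<phi> T1)) \<in> hyps (relabel \<phi> T1) \<rightarrow>\<^sub>E {1..N}"
    "restrict \<iota> (hyps (relabel \<phi> T2)) \<in> hyps (relabel \<phi> T2) \<rightarrow>\<^sub>E {1..N}"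
    by (rule restrict_PiE[OF \<iota>], simp)+
  let ?\<iota> = "\<lambda>h\<in>hyps (fprod T1 T2). \<iota> (\<phi> ` h)"
  have arg: "(\<lambda>h\<in>hyps T1. restrict \<iota> (hyps (relabel \<phi> T1)) (\<phi> ` h)) = restrict ?\<iota> (hyps T1)"
    "(\<lambda>h\<in>hyps T2. restrict \<iota> (hyps (relabel \<phi> T2)) (\<phi> ` h)) = restrict ?\<iota> (hyps T2)"
    by (auto simp: restrict_def)
  have "I s t (relabel \<phi> (fprod T1 T2)) i \<iota> c =
      I s t (relabel \<phi> T1) i (restrict \<iota> (hyps (relabel \<phi> T1))) c *
      I s t (relabel \<phi> T2) i (restrict \<iota> (hyps (relabel \<phi> T2))) c"
    unfolding relabel_fprod
      I_fprod[OF fprod.prems(2-4) lions_forest0_relabel[OF T(1) inj(1)] lions_forest0_relabel[OF T(2) inj(2)] disj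
        mem_relabel[OF fprod.hyps(4) fprod.prems(1), unfolded relabel_fprod] \<iota>]
    by (simp add: tprod_def)
  also have "\<dots> = I s t T1 i (restrict ?\<iota> (hyps T1)) (c \<circ> \<phi>) * I s t T2 i (restrict ?\<iota> (hyps T2)) (c \<circ> \<phi>)"
    unfolding fprod.IH(1)[OF inj(1) fprod.prems(2-4) \<iota>'(1)] fprod.IH(2)[OF inj(2) fprod.prems(2-4) \<iota>'(2)] arg ..
  also have "\<dots> = I s t (fprod T1 T2) i ?\<iota> (c \<circ> \<phi>)"
    unfolding I_fprod[OF fprod.prems(2-4) T fprod.hyps(3,4) relabel_args_PiE[OF fprod.prems(5)]]
    by (simp add: tprod_def)
  finally show ?case .
next
  case (decouple T)
  have T: "lions_forest0 T" using decouple.hyps(1) by (simp add: mem_iff)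
  have inj: "inj_on \<phi> (nodes T)" using decouple.prems(1) by simp
  have \<iota>: "\<iota> \<in> hyps (decouple (relabel \<phi> T)) \<rightarrow>\<^sub>E {1..N}" using decouple.prems(5) by (simp only: relabel_decouple)
  have R: "lions_forest0 (relabel \<phi> T)" "tagged (relabel \<phi> T) \<noteq> {}"
    using lions_forest0_relabel[OF T inj] decouple.hyps(2) by simp_all
  let ?\<iota> = "\<lambda>h\<in>hyps (decouple T). \<iota> (\<phi> ` h)"
  have arg: "(\<lambda>h\<in>hyps T. restrict \<iota> (hyps (relabel \<phi> T)) (\<phi> ` h)) = restrict ?\<iota> (hyps T)"
    using lions_forest0D(12)[OF T] by (auto simp: restrict_def all_hyps_def)
  have arg0: "\<iota> (tagged (relabel \<phi> T)) = ?\<iota> (tagged T)"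
    using decouple.hyps(2) by (simp add: all_hyps_def)
  have "I s t (relabel \<phi> (decouple T)) i \<iota> c =
      I s t (relabel \<phi> T) (\<iota> (tagged (relabel \<phi> T))) (restrict \<iota> (hyps (relabel \<phi> T))) c"
    unfolding relabel_decouple
    by (simp only: I_decouple_tagged[OF decouple.prems(2-4) R
        mem_relabel[OF decouple.hyps(3) decouple.prems(1), unfolded relabel_decouple] \<iota>])
  also have "\<dots> = I s t T (?\<iota> (tagged T)) (restrict ?\<iota> (hyps T)) (c \<circ> \<phi>)"
    unfolding arg[symmetric] arg0[symmetric]
    by (rule decouple.IH[OF inj decouple.prems(2,3) decouple_arg[OF \<iota> R(2)] restrict_decouple[OF R(1) \<iota>]])
  also have "\<dots> = I s t (decouple T) i ?\<iota> (c \<circ> \<phi>)"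
    by (simp only: I_decouple_tagged[OF decouple.prems(2-4) T decouple.hyps(2,3) relabel_args_PiE[OF decouple.prems(5)]])
  finally show ?case .
qed

text \<open>This forest is the upper part of the cut of \<open>rooting x T\<close> at
  \<open>insert x R\<close>, so it inherits the size bound.\<close>

lemma mem_rooting_subforest:
  assumes "lions_forest0 T" "x \<notin> nodes T" "rooting x T \<in> forests\<^sub>0 \<gamma> \<alpha> \<alpha>" "ancestor_closed T R"
  shows "rooting x (subforest T R) \<in> forests\<^sub>0 \<gamma> \<alpha> \<alpha>"
proof -
  have "ancestor_closed (rooting x T) (insert x R)"
    using ancestor_closed_rooting[OF assms(1,2)] assms(4) by blast
  then show ?thesis
    using mem_subforest[OF assms(3)] subforest_rooting_insert[OF assms(1,2,4)] by metis
qed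

text \<open>
  For a rooted forest, the empty cut and the remaining cuts contribute the two parts of the integral
  over \<open>[s, u]\<close> split at \<open>t\<close>.
\<close>

lemma chen:
  assumes "T \<in> forests\<^sub>0 \<gamma> \<alpha> \<alpha>" "s \<in> {0..1}" "t \<in> {0..1}" "u \<in> {0..1}" "i \<in> {1..N}"
    "\<iota> \<in> hyps T \<rightarrow>\<^sub>E {1..N}"
  shows "mv_conv (I s t) (I t u) T i \<iota> = I s u T i \<iota>"
  using assms
proof (induction arbitrary: u i \<iota> rule: mem_induct)
  case empty
  have "{R. ancestor_closed empty_forest R} = {{}}" by (auto simp: ancestor_closed_def)
  then show ?case using empty
    by (simp add: mv_conv_def tprod_def I_empty hyp_args_empty subforest_empty)
next
  case (rooting x T)
  have T: "lions_forest0 T" "lions_forest0 (rooting x T)" using rooting.hyps(1,3) by (simp_all add: mem_iff)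
  have \<iota>: "\<iota> \<in> hyps T \<rightarrow>\<^sub>E {1..N}" using rooting.prems(5) by simp
  note x = rooting.hyps(2)
  note s = rooting.prems(1) and t = rooting.prems(2) and u = rooting.prems(3) and i = rooting.prems(4)
  let ?A = "{R. ancestor_closed T R}"
  show ?case
  proof
    fix c
    define p where "p r = path_deriv (w i) r $ c x" for r
    \<comment> \<open>For a cut R of T, the lower part over [s,t] gives the constant
      \<open>a R\<close>, and the upper part over [t,r] gives the function \<open>b R r\<close> of
      the integration variable.\<close>
    define a where "a R = I s t (subforest T (nodes T - R)) i (hyp_args T (nodes T - R) \<iota>) c" for R
    define b where "b R r = I t r (subforest T R) i (hyp_args T R \<iota>) c" for R r
    have p: "continuous_on {0..1} p" unfolding p_def by (rule deriv_continuous[OF i])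
    have "\<exists>G. (\<forall>r\<in>{0..1}. (G has_vector_derivative b R r * p r) (at r within {0..1})) \<and>
        I t u (rooting x (subforest T R)) i (hyp_args T R \<iota>) c = G u - G t" if R: "R \<in> ?A" for R
    proof -
      have R': "ancestor_closed T R" using R by simp
      note S = lions_forest0_subforest(1)[OF T(1) R', of R]
      have arg: "hyp_args T R \<iota> \<in> hyps (subforest T R) \<rightarrow>\<^sub>E {1..N}" by (rule hyp_args_PiE[OF T(1) \<iota>])
      have "continuous_on {0..1} (\<lambda>r. b R r * p r)"
        unfolding b_def by (intro continuous_on_mult p I_continuous mem_subforest[OF rooting.hyps(1) R'] t i arg) simp
      then obtain G where G: "\<And>r. r \<in> {0..1} \<Longrightarrow> (G has_vector_derivative b R r * p r) (at r within {0..1})"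
        "\<And>s t. s \<in> {0..1} \<Longrightarrow> t \<in> {0..1} \<Longrightarrow> (LBINT r=s..t. b R r * p r) = G t - G s"
        by (rule LBINT_antiderivative) blast
      have "x \<notin> nodes (subforest T R)" using x ancestor_closed_subset[OF R'] by auto
      then have "I t u (rooting x (subforest T R)) i (hyp_args T R \<iota>) c = (LBINT r=t..u. b R r * p r)"
        unfolding b_def p_def
        using I_rooting[OF t u i S _ mem_rooting_subforest[OF T(1) x rooting.hyps(3) R'] arg] by simp
      then show ?thesis using G(1) G(2)[OF t u] by (intro exI[of _ G]) simp
    qed
    then obtain G where G: "\<And>R r. R \<in> ?A \<Longrightarrow> r \<in> {0..1} \<Longrightarrow>
        (G R has_vector_derivative b R r * p r) (at r within {0..1})"
      and bG: "\<And>R. R \<in> ?A \<Longrightarrow> I t u (rooting x (subforest T R)) i (hyp_args T R \<iota>) c = G R u - G R t"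
      by metis
    \<comment> \<open>The induction hypothesis is used at every upper endpoint r, which is why u is
      generalised in the induction.\<close>
    have conv: "I s r T i \<iota> c * p r = (\<Sum>R\<in>?A. a R * (b R r * p r))" if "r \<in> {0..1}" for r
      using fun_cong[OF rooting.IH[OF s t that i \<iota>], of c, symmetric]
      by (simp add: mv_conv_def tprod_def a_def b_def sum_distrib_right mult.assoc)
    have cont: "continuous_on {0..1} (\<lambda>r. I s r T i \<iota> c * p r)"
      by (intro continuous_on_mult p I_continuous rooting.hyps s i \<iota>)
    \<comment> \<open>The antiderivatives for the single cuts combine to one of the whole integrand;
      this replaces interchanging the finite sum with the integral.\<close>
    have "((\<lambda>r. \<Sum>R\<in>?A. a R * G R r) has_vector_derivative I s r T i \<iota> c * p r) (at r within {0..1})"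
      if "r \<in> {0..1}" for r
      unfolding conv[OF that] using G[OF _ that]
      by (intro has_vector_derivative_sum bounded_linear.has_vector_derivative[OF bounded_linear_mult_right])
    from LBINT_eq_diff[OF cont t u this]
    have tu: "(LBINT r=t..u. I s r T i \<iota> c * p r) = (\<Sum>R\<in>?A. a R * (G R u - G R t))"
      by (simp add: sum_subtractf right_diff_distrib)
    \<comment> \<open>One F serves the integrals over [s,t], [t,u] and [s,u], so that the splitting
      at t is a telescoping of its values.\<close>
    obtain F :: "real \<Rightarrow> real" where F: "\<And>s' t'. s' \<in> {0..1} \<Longrightarrow> t' \<in> {0..1} \<Longrightarrow>
        (LBINT r=s'..t'. I s r T i \<iota> c * p r) = F t' - F s'"
      by (rule LBINT_antiderivative[OF cont]) blast
    have Iroot: "I s r (rooting x T) i \<iota> c = F r - F s" if "r \<in> {0..1}" for r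
      using I_rooting[OF s that i T(1) x rooting.hyps(3) \<iota>] F[OF s that] by (simp add: p_def)
    have "mv_conv (I s t) (I t u) (rooting x T) i \<iota> c = I s t (rooting x T) i \<iota> c +
        (\<Sum>R\<in>?A. a R * I t u (rooting x (subforest T R)) i (hyp_args T R \<iota>) c)"
    proof -
      let ?F = "\<lambda>R. I s t (subforest (rooting x T) (nodes (rooting x T) - R)) i
          (hyp_args (rooting x T) (nodes (rooting x T) - R) \<iota>) c *
          I t u (subforest (rooting x T) R) i (hyp_args (rooting x T) R \<iota>) c"
      have "?F {} = I s t (rooting x T) i \<iota> c"
        unfolding Diff_empty subforest_nodes[OF T(2)] hyp_args_nodes[OF T(2) rooting.prems(5)]
        by (simp add: subforest_empty hyp_args_empty I_empty[OF t u i])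
      moreover have "?F (insert x R) = a R * I t u (rooting x (subforest T R)) i (hyp_args T R \<iota>) c"
        if "R \<in> ?A" for R
      proof -
        have R: "ancestor_closed T R" using that by simp
        have "nodes (rooting x T) - insert x R = nodes T - R" using x by auto
        then show ?thesis
          using x subforest_rooting_insert[OF T(1) x R] subforest_rooting[of x "nodes T - R" T]
          by (simp add: a_def hyp_args_rooting hyp_args_insert[OF T(1) x] del: forest_sel_simps)
      qed
      ultimately show ?thesis
        unfolding mv_conv_def tprod_def sum_ancestor_closed_rooting[OF T(1) x] by simp
    qed
    also have "\<dots> = F t - F s + (LBINT r=t..u. I s r T i \<iota> c * p r)"
      using Iroot[OF t] tu bG by simp
    also have "\<dots> = I s u (rooting x T) i \<iota> c" using Iroot[OF u] F[OF t u] by simp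
    finally show "mv_conv (I s t) (I t u) (rooting x T) i \<iota> c = I s u (rooting x T) i \<iota> c" .
  qed
next
  case (fprod T1 T2)
  have T: "lions_forest0 T1" "lions_forest0 T2" "lions_forest0 (fprod T1 T2)" using fprod.hyps(1,2,4) by (simp_all add: mem_iff)
  note s = fprod.prems(1) and t = fprod.prems(2) and u = fprod.prems(3) and i = fprod.prems(4)
  have \<iota>: "restrict \<iota> (hyps T1) \<in> hyps T1 \<rightarrow>\<^sub>E {1..N}" "restrict \<iota> (hyps T2) \<in> hyps T2 \<rightarrow>\<^sub>E {1..N}"
    by (rule restrict_PiE[OF fprod.prems(5)], simp)+
  \<comment> \<open>Both pieces of a cut, the upper R and the lower complement, are covered by the
    alternative for A1 and A2; either piece may have an empty factor.\<close>
  have part: "I s' t' (subforest (fprod T1 T2) (A1 \<union> A2)) i (hyp_args (fprod T1 T2) (A1 \<union> A2) \<iota>) c =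
      I s' t' (subforest T1 A1) i (hyp_args T1 A1 (restrict \<iota> (hyps T1))) c *
      I s' t' (subforest T2 A2) i (hyp_args T2 A2 (restrict \<iota> (hyps T2))) c"
    if R: "ancestor_closed T1 R1" "ancestor_closed T2 R2"
      and A: "A1 = R1 \<and> A2 = R2 \<or> A1 = nodes T1 - R1 \<and> A2 = nodes T2 - R2"
      and st: "s' \<in> {0..1}" "t' \<in> {0..1}" for R1 R2 A1 A2 s' t' c
  proof -
    have A': "A1 = R1 \<or> A1 = nodes T1 - R1" "A2 = R2 \<or> A2 = nodes T2 - R2" using A by blast+
    note A1 = lions_forest0_subforest(1,3)[OF T(1) R(1) A'(1)] and A2 = lions_forest0_subforest(1,3)[OF T(2) R(2) A'(2)]
    have disj: "nodes (subforest T1 A1) \<inter> nodes (subforest T2 A2) = {}" using A1 A2 fprod.hyps(3) by auto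
    have eq: "subforest (fprod T1 T2) (A1 \<union> A2) = fprod (subforest T1 A1) (subforest T2 A2)"
      by (rule subforest_fprod[OF T(1,2) fprod.hyps(3) A1(2) A2(2)])
    have "R1 \<subseteq> nodes T1" "R2 \<subseteq> nodes T2" using R by (auto dest: ancestor_closed_subset)
    then have int: "(R1 \<union> R2) \<inter> nodes T1 = R1" "(R1 \<union> R2) \<inter> nodes T2 = R2"
      "nodes T1 - R1 \<union> (nodes T2 - R2) = nodes (fprod T1 T2) - (R1 \<union> R2)"
      using fprod.hyps(3) by auto
    have anc: "ancestor_closed (fprod T1 T2) (R1 \<union> R2)"
      unfolding ancestor_closed_fprod[OF T(1,2)] int using R \<open>R1 \<subseteq> nodes T1\<close> \<open>R2 \<subseteq> nodes T2\<close> by blast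
    have "A1 \<union> A2 = R1 \<union> R2 \<or> A1 \<union> A2 = nodes (fprod T1 T2) - (R1 \<union> R2)" using A int(3) by metis
    then have mem: "fprod (subforest T1 A1) (subforest T2 A2) \<in> forests\<^sub>0 \<gamma> \<alpha> \<alpha>"
      using mem_subforest[OF fprod.hyps(4) anc] eq by metis
    have arg: "hyp_args (fprod T1 T2) (A1 \<union> A2) \<iota> \<in> hyps (fprod (subforest T1 A1) (subforest T2 A2)) \<rightarrow>\<^sub>E {1..N}"
      using hyp_args_PiE[OF T(3) fprod.prems(5), of "A1 \<union> A2"] unfolding eq .
    show ?thesis
      unfolding eq I_fprod[OF st i A1(1) A2(1) disj mem arg]
        hyp_args_fprod[OF T fprod.hyps(3) A1(2) A2(2)] tprod_def ..
  qed
  show ?case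
  proof
    fix c
    let ?i1 = "restrict \<iota> (hyps T1)" and ?i2 = "restrict \<iota> (hyps T2)"
    have "mv_conv (I s t) (I t u) (fprod T1 T2) i \<iota> c =
      (\<Sum>R1 | ancestor_closed T1 R1. \<Sum>R2 | ancestor_closed T2 R2.
        (I s t (subforest T1 (nodes T1 - R1)) i (hyp_args T1 (nodes T1 - R1) ?i1) c *
         I t u (subforest T1 R1) i (hyp_args T1 R1 ?i1) c) *
        (I s t (subforest T2 (nodes T2 - R2)) i (hyp_args T2 (nodes T2 - R2) ?i2) c *
         I t u (subforest T2 R2) i (hyp_args T2 R2 ?i2) c))"
      unfolding mv_conv_def tprod_def sum_ancestor_closed_fprod[OF T(1,2) fprod.hyps(3)]
    proof (intro sum.cong refl)
      fix R1 R2 assume "R1 \<in> {R1. ancestor_closed T1 R1}" "R2 \<in> {R2. ancestor_closed T2 R2}"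
      then have R: "ancestor_closed T1 R1" "ancestor_closed T2 R2" by auto
      then have "R1 \<subseteq> nodes T1" "R2 \<subseteq> nodes T2" by (auto dest: ancestor_closed_subset)
      then have int: "nodes (fprod T1 T2) - (R1 \<union> R2) = nodes T1 - R1 \<union> (nodes T2 - R2)"
        using fprod.hyps(3) by auto
      show "I s t (subforest (fprod T1 T2) (nodes (fprod T1 T2) - (R1 \<union> R2))) i
          (hyp_args (fprod T1 T2) (nodes (fprod T1 T2) - (R1 \<union> R2)) \<iota>) c *
        I t u (subforest (fprod T1 T2) (R1 \<union> R2)) i (hyp_args (fprod T1 T2) (R1 \<union> R2) \<iota>) c =
        (I s t (subforest T1 (nodes T1 - R1)) i (hyp_args T1 (nodes T1 - R1) ?i1) c *
         I t u (subforest T1 R1) i (hyp_args T1 R1 ?i1) c) *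
        (I s t (subforest T2 (nodes T2 - R2)) i (hyp_args T2 (nodes T2 - R2) ?i2) c *
         I t u (subforest T2 R2) i (hyp_args T2 R2 ?i2) c)"
        unfolding int part[OF R disjI1[OF conjI[OF refl refl]] t u]
          part[OF R disjI2[OF conjI[OF refl refl]] s t] by (simp only: ac_simps)
    qed
    also have "\<dots> = mv_conv (I s t) (I t u) T1 i ?i1 c * mv_conv (I s t) (I t u) T2 i ?i2 c"
      unfolding mv_conv_def tprod_def sum_product ..
    also have "\<dots> = I s u (fprod T1 T2) i \<iota> c"
      unfolding fprod.IH(1)[OF s t u i \<iota>(1)] fprod.IH(2)[OF s t u i \<iota>(2)]
        I_fprod[OF s u i T(1,2) fprod.hyps(3,4) fprod.prems(5)] tprod_def ..
    finally show "mv_conv (I s t) (I t u) (fprod T1 T2) i \<iota> c = I s u (fprod T1 T2) i \<iota> c" .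
  qed
next
  case (decouple T)
  have T: "lions_forest0 T" "lions_forest0 (decouple T)" using decouple.hyps(1,3) by (simp_all add: mem_iff)
  note s = decouple.prems(1) and t = decouple.prems(2) and u = decouple.prems(3) and i = decouple.prems(4)
  let ?j = "\<iota> (tagged T)" and ?\<iota> = "restrict \<iota> (hyps T)"
  have j: "?j \<in> {1..N}" by (rule decouple_arg[OF decouple.prems(5) decouple.hyps(2)])
  have \<iota>: "?\<iota> \<in> hyps T \<rightarrow>\<^sub>E {1..N}" by (rule restrict_decouple[OF T(1) decouple.prems(5)])
  \<comment> \<open>The piece A may miss all tagged nodes, hence the use of the decoupling rule that
    admits this; the choice of \<open>?j\<close> then does not affect the value.\<close>
  have part: "I s' t' (subforest (decouple T) A) i (hyp_args (decouple T) A \<iota>) =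
      I s' t' (subforest T A) ?j (hyp_args T A ?\<iota>)"
    if R: "ancestor_closed T R" and A: "A = R \<or> A = nodes T - R"
      and st: "s' \<in> {0..1}" "t' \<in> {0..1}" for R A s' t'
  proof -
    have mem: "decouple (subforest T A) \<in> forests\<^sub>0 \<gamma> \<alpha> \<alpha>"
      using mem_subforest[OF decouple.hyps(3), of R A] R A by (simp add: ancestor_closed_simps subforest_decouple)
    have arg: "hyp_args (decouple T) A \<iota> \<in> hyps (decouple (subforest T A)) \<rightarrow>\<^sub>E {1..N}"
      using hyp_args_PiE[OF T(2) decouple.prems(5), of A] by (simp only: subforest_decouple)
    have "I s' t' (decouple (subforest T A)) i (hyp_args (decouple T) A \<iota>) =
        I s' t' (subforest T A) ?j (restrict (hyp_args (decouple T) A \<iota>) (hyps (subforest T A)))"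
      by (rule I_decouple[OF st i j lions_forest0_subforest(1)[OF T(1) R A] mem arg])
        (simp add: hyp_args_decouple(2)[OF T])
    then show ?thesis unfolding subforest_decouple hyp_args_decouple(1)[OF T] .
  qed
  have "mv_conv (I s t) (I t u) (decouple T) i \<iota> = mv_conv (I s t) (I t u) T ?j ?\<iota>"
    unfolding mv_conv_def ancestor_closed_simps forest_sel_simps
  proof (intro ext sum.cong refl)
    fix c R assume "R \<in> {R. ancestor_closed T R}"
    then have R: "ancestor_closed T R" by simp
    show "tprod (I s t (subforest (decouple T) (nodes T - R)) i (hyp_args (decouple T) (nodes T - R) \<iota>))
          (I t u (subforest (decouple T) R) i (hyp_args (decouple T) R \<iota>)) c =
        tprod (I s t (subforest T (nodes T - R)) ?j (hyp_args T (nodes T - R) ?\<iota>))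
          (I t u (subforest T R) ?j (hyp_args T R ?\<iota>)) c"
      unfolding part[OF R disjI1[OF refl] t u] part[OF R disjI2[OF refl] s t] ..
  qed
  also have "\<dots> = I s u T ?j ?\<iota>" by (rule decouple.IH[OF s t u j \<iota>])
  also have "\<dots> = I s u (decouple T) i \<iota>"
    by (rule I_decouple_tagged[OF s u i T(1) decouple.hyps(2,3) decouple.prems(5), symmetric])
  finally show ?case .
qed

end

section \<open>Characters over a finite probability space\<close>

context
  fixes X :: "'a set"
  assumes X: "finite X" "X \<noteq> {}"
begin

interpretation prob_space "uniform_count_measure X"
  using X by (rule prob_space_uniform_count_measure)

lemma sets_hyp_space:
  assumes "finite (hyps T)"
  shows "sets (hyp_space (uniform_count_measure X) T) = Pow (hyps T \<rightarrow>\<^sub>E X)"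
proof -
  have "sets (hyp_space (uniform_count_measure X) T) = sets (hyp_space (count_space X) T)"
    by (intro sets_PiM_cong) (simp_all add: sets_uniform_count_measure_count_space)
  also have "\<dots> = Pow (hyps T \<rightarrow>\<^sub>E X)"
    using assms X by (subst count_space_PiM_finite) (auto simp: countable_finite)
  finally show ?thesis .
qed

lemma sets_arg_space:
  assumes "finite (hyps T)"
  shows "sets (arg_space (uniform_count_measure X) T) = Pow (X \<times> (hyps T \<rightarrow>\<^sub>E X))"
proof -
  have "finite (hyps T \<rightarrow>\<^sub>E X)" using assms X(1) by (rule finite_PiE)
  then have "count_space X \<Otimes>\<^sub>M count_space (hyps T \<rightarrow>\<^sub>E X) = count_space (X \<times> (hyps T \<rightarrow>\<^sub>E X))"
    using X by (intro pair_measure_countable) (auto intro: countable_finite)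
  moreover have "sets (arg_space (uniform_count_measure X) T) =
      sets (count_space X \<Otimes>\<^sub>M count_space (hyps T \<rightarrow>\<^sub>E X))"
    by (intro sets_pair_measure_cong) (simp_all add: sets_uniform_count_measure_count_space sets_hyp_space assms)
  ultimately show ?thesis by (simp only: sets_count_space)
qed

lemma space_hyp_space: "space (hyp_space (uniform_count_measure X) T) = hyps T \<rightarrow>\<^sub>E X"
  by (simp add: space_PiM space_uniform_count_measure)

lemma space_arg_space: "space (arg_space (uniform_count_measure X) T) = X \<times> (hyps T \<rightarrow>\<^sub>E X)"
  by (simp add: space_pair_measure space_PiM space_uniform_count_measure)

text \<open>A point has the product of the masses of its coordinates, all positive. Null sets are
  therefore empty, which turns almost everywhere into everywhere.\<close>

lemma emeasure_arg_space_singleton: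
  assumes "finite (hyps T)" "a \<in> X" "\<omega> \<in> hyps T \<rightarrow>\<^sub>E X"
  shows "emeasure (arg_space (uniform_count_measure X) T) {(a, \<omega>)} \<noteq> 0"
proof -
  interpret P: product_prob_space "\<lambda>_ :: nat set. uniform_count_measure X" "hyps T" ..
  have H: "prob_space (hyp_space (uniform_count_measure X) T)"
    by (intro prob_space_PiM prob_space_axioms)
  have pos: "emeasure (uniform_count_measure X) {b} \<noteq> 0" if "b \<in> X" for b
    using X that by (subst emeasure_uniform_count_measure) (auto simp: card_gt_0_iff ennreal_eq_0_iff)
  have eq: "(\<Pi>\<^sub>E h\<in>hyps T. {\<omega> h}) = {\<omega>}"
    using PiE_singleton[of \<omega> "hyps T"] assms(3) by (auto simp: PiE_def)
  have "emeasure (hyp_space (uniform_count_measure X) T) (\<Pi>\<^sub>E h\<in>hyps T. {\<omega> h}) =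
      (\<Prod>h\<in>hyps T. emeasure (uniform_count_measure X) {\<omega> h})"
    using assms by (intro P.emeasure_PiM) (auto simp: sets_uniform_count_measure)
  then have "emeasure (hyp_space (uniform_count_measure X) T) {\<omega>} =
      (\<Prod>h\<in>hyps T. emeasure (uniform_count_measure X) {\<omega> h})"
    unfolding eq .
  moreover have "(\<Prod>h\<in>hyps T. emeasure (uniform_count_measure X) {\<omega> h}) \<noteq> 0"
  proof -
    have "finite H \<Longrightarrow> \<forall>h\<in>H. f h \<noteq> 0 \<Longrightarrow> prod f H \<noteq> 0" for H and f :: "nat set \<Rightarrow> ennreal"
      by (induction H rule: finite_induct) auto
    then show ?thesis using assms pos by (meson PiE_mem)
  qed
  moreover have "emeasure (arg_space (uniform_count_measure X) T) ({a} \<times> {\<omega>}) =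
      emeasure (uniform_count_measure X) {a} * emeasure (hyp_space (uniform_count_measure X) T) {\<omega>}"
    by (rule sigma_finite_measure.emeasure_pair_measure_Times[OF prob_space_imp_sigma_finite[OF H]])
      (use assms in \<open>auto simp: sets_uniform_count_measure sets_hyp_space\<close>)
  ultimately show ?thesis using pos[OF assms(2)] by simp
qed

lemma AE_arg_space_iff:
  assumes "finite (hyps T)"
  shows "(AE x in arg_space (uniform_count_measure X) T. P x) \<longleftrightarrow> (\<forall>x\<in>X \<times> (hyps T \<rightarrow>\<^sub>E X). P x)"
proof
  assume "AE x in arg_space (uniform_count_measure X) T. P x"
  then obtain N where N: "N \<in> sets (arg_space (uniform_count_measure X) T)"
    "emeasure (arg_space (uniform_count_measure X) T) N = 0"
    "{x \<in> space (arg_space (uniform_count_measure X) T). \<not> P x} \<subseteq> N"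
    by (rule AE_E) blast
  show "\<forall>x\<in>X \<times> (hyps T \<rightarrow>\<^sub>E X). P x"
  proof (rule ballI, rule ccontr)
    fix x assume x: "x \<in> X \<times> (hyps T \<rightarrow>\<^sub>E X)" "\<not> P x"
    then have "{x} \<subseteq> N" using N(3) unfolding space_arg_space by blast
    then have "emeasure (arg_space (uniform_count_measure X) T) {x} \<le> 0"
      unfolding N(2)[symmetric] by (rule emeasure_mono) (rule N(1))
    then show False using emeasure_arg_space_singleton[OF assms, of "fst x" "snd x"] x(1) by auto
  qed
next
  assume "\<forall>x\<in>X \<times> (hyps T \<rightarrow>\<^sub>E X). P x"
  then show "AE x in arg_space (uniform_count_measure X) T. P x"
    unfolding space_arg_space[symmetric] by (intro AE_I2) blast
qed

lemma borel_measurable_hyp_space: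
  "finite (hyps T) \<Longrightarrow> f \<in> borel_measurable (hyp_space (uniform_count_measure X) T)"
  by (rule measurableI) (auto simp: sets_hyp_space space_hyp_space)

lemma borel_measurable_arg_space:
  "finite (hyps T) \<Longrightarrow> f \<in> borel_measurable (arg_space (uniform_count_measure X) T)"
  by (rule measurableI) (auto simp: sets_arg_space space_arg_space)

text \<open>An integral over finitely many points of finite mass is a finite sum, so finiteness
  passes through each stage of the iterated norm. The list \<open>hs\<close> is arbitrary, which
  covers every order of integration.\<close>

lemma mixed_norm_finite:
  assumes "\<And>\<omega>. F \<omega> < \<infinity>"
  shows "mixed_norm (uniform_count_measure X) r hs F \<omega> < \<infinity>"
proof (induction hs arbitrary: \<omega>)
  case Nil
  then show ?case using assms by simp
next
  case (Cons h hs)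
  have epowr: "epowr x a < \<infinity>" if "x < \<infinity>" for x a using that by (simp add: epowr_def)
  have "(\<integral>\<^sup>+ a. epowr (mixed_norm (uniform_count_measure X) r hs F (fun_upd \<omega> h a)) (r h)
      \<partial>uniform_count_measure X) < \<infinity>"
    unfolding uniform_count_measure_def
    using X(1) epowr[OF Cons.IH, unfolded uniform_count_measure_def]
    by (subst nn_integral_point_measure_finite) (auto simp: ennreal_mult_less_top)
  then show ?case unfolding mixed_norm.simps by (rule epowr)
qed

lemma in_mixed_Lp_uniform_count_measure:
  "finite (hyps T) \<Longrightarrow> in_mixed_Lp (uniform_count_measure X) T r F"
  unfolding in_mixed_Lp_def by (intro conjI allI impI borel_measurable_hyp_space mixed_norm_finite) auto

end

lemma mv_ae_eq_iff:
  assumes "finite X" "X \<noteq> {}"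
  shows "mv_ae_eq (uniform_count_measure X) \<gamma> \<alpha> \<alpha> f g \<longleftrightarrow>
    (\<forall>T\<in>forests\<^sub>0 \<gamma> \<alpha> \<alpha>. \<forall>i\<in>X. \<forall>\<iota>\<in>hyps T \<rightarrow>\<^sub>E X. f T i \<iota> = g T i \<iota>)"
proof -
  have "finite (hyps T)" if "T \<in> forests\<^sub>0 \<gamma> \<alpha> \<alpha>" for T
    using that lions_forest0D(17) by (auto simp: forests\<^sub>0_def forests_iff)
  then show ?thesis
    unfolding mv_ae_eq_def by (simp add: AE_arg_space_iff[OF assms] split_beta)
qed

text \<open>With n the integer part of 1/\<alpha>, the supremum is n\<alpha>. A forest with k nodes
  has grading k\<alpha>, and k\<alpha> > 1 - \<alpha> means (k + 1)\<alpha> > 1 \<ge> n\<alpha>,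
  hence k \<ge> n; so n\<alpha> is also the infimum.\<close>

lemma mv_gamma_eq:
  assumes "0 < \<alpha>" "\<alpha> \<le> 1" "\<gamma> = Sup {real i * \<alpha> | i. real i * \<alpha> \<le> 1}"
  shows "mv_gamma \<alpha> \<alpha> = \<gamma>" "0 \<le> \<gamma>"
proof -
  define n where "n = nat \<lfloor>1 / \<alpha>\<rfloor>"
  have "1 \<le> 1 / \<alpha>" using assms by simp
  then have fl: "1 \<le> \<lfloor>1 / \<alpha>\<rfloor>" by simp
  have n1: "1 \<le> n" using nat_mono[OF fl] by (simp add: n_def)
  have nr: "real n = of_int \<lfloor>1 / \<alpha>\<rfloor>" unfolding n_def by (rule of_nat_nat) (use fl in linarith)
  have "real n \<le> 1 / \<alpha>" unfolding nr by (rule of_int_floor_le)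
  then have le: "real n * \<alpha> \<le> 1" using assms(1) by (simp only: pos_le_divide_eq)
  have "1 / \<alpha> < real n + 1" unfolding nr by (rule real_of_int_floor_add_one_gt)
  then have lt: "1 < (real n + 1) * \<alpha>" using assms(1) by (simp only: pos_divide_less_eq)
  have max: "i \<le> n" if "real i * \<alpha> \<le> 1" for i
  proof -
    have "real i * \<alpha> < (real n + 1) * \<alpha>" using that lt by simp
    then have "real i < real n + 1" using assms(1) by simp
    then show ?thesis by simp
  qed
  have \<gamma>: "\<gamma> = real n * \<alpha>"
    unfolding assms(3)
  proof (rule cSup_eq_maximum)
    show "real n * \<alpha> \<in> {real i * \<alpha> | i. real i * \<alpha> \<le> 1}" using le by blast
    show "x \<le> real n * \<alpha>" if "x \<in> {real i * \<alpha> | i. real i * \<alpha> \<le> 1}" for x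
      using that max assms(1) by auto
  qed
  then show "0 \<le> \<gamma>" using assms(1) by simp
  show "mv_gamma \<alpha> \<alpha> = \<gamma>"
    unfolding mv_gamma_def
  proof (rule cInf_eq_minimum)
    \<comment> \<open>The infimum is attained by n isolated nodes, all of them tagged;
      \<open>1 \<le> n\<close> makes this forest nonempty.\<close>
    define T where "T = LForest {..<n} {} {..<n} {}"
    have "lions_forest0 T" by (simp add: T_def lions_forest0_def forest_edges_def partition_on_def)
    moreover have "nodes T \<noteq> {}" using n1 by (auto simp: T_def lessThan_empty_iff)
    moreover have "grading \<alpha> \<alpha> T = \<gamma>" using \<open>lions_forest0 T\<close> by (simp add: grading_eq \<gamma>) (simp add: T_def)
    moreover have "\<gamma> > 1 - \<alpha>" using lt by (simp add: \<gamma> algebra_simps)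
    ultimately show "\<gamma> \<in> {grading \<alpha> \<alpha> T | T. lions_forest T \<and> grading \<alpha> \<alpha> T > 1 - \<alpha>}"
      unfolding lions_forest_iff by blast
    fix x assume "x \<in> {grading \<alpha> \<alpha> T | T. lions_forest T \<and> grading \<alpha> \<alpha> T > 1 - \<alpha>}"
    then obtain T where T: "lions_forest0 T" "x = grading \<alpha> \<alpha> T" "x > 1 - \<alpha>"
      by (auto simp: lions_forest_iff)
    then have "1 < (real (card (nodes T)) + 1) * \<alpha>" by (simp add: grading_eq algebra_simps)
    then have "real n * \<alpha> < (real (card (nodes T)) + 1) * \<alpha>" using le by linarith
    then have "real n < real (card (nodes T)) + 1" using assms(1) by simp
    then have "real n \<le> real (card (nodes T))" by simp
    then show "\<gamma> \<le> x" using T(1,2) assms(1) by (simp add: grading_eq \<gamma>)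
  qed
qed

section \<open>Classes of iterated integrals and the rough path property\<close>

context iterated_integral_family
begin

context
  fixes q :: "lforest \<Rightarrow> nat set \<Rightarrow> real" and \<nu> :: "nat measure"
  assumes N: "N \<ge> 1" and \<nu>: "\<nu> = uniform_count_measure {1..N}"
begin

abbreviation "chars \<equiv> (mv_characters \<nu> \<gamma> \<alpha> \<alpha> q :: (nat, 'd) mv_family set)"
abbreviation "cls \<equiv> (mv_class \<nu> \<gamma> \<alpha> \<alpha> q :: (nat, 'd) mv_family \<Rightarrow> _)"
abbreviation "G \<equiv> (mv_group \<nu> \<gamma> \<alpha> \<alpha> q :: (nat, 'd) mv_family set monoid)"
abbreviation "eqv \<equiv> (mv_ae_eq \<nu> \<gamma> \<alpha> \<alpha> :: (nat, 'd) mv_family \<Rightarrow> _)"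

lemma index_set: "finite {1..N}" "{1..N} \<noteq> {}"
  using N by auto

lemmas AE_iff = AE_arg_space_iff[OF index_set, folded \<nu>]

lemma eqv_iff:
  "eqv f g \<longleftrightarrow> (\<forall>T\<in>forests\<^sub>0 \<gamma> \<alpha> \<alpha>. \<forall>i\<in>{1..N}. \<forall>\<iota>\<in>hyps T \<rightarrow>\<^sub>E {1..N}. f T i \<iota> = g T i \<iota>)"
  unfolding \<nu> by (rule mv_ae_eq_iff[OF index_set])

lemma eqv_refl: "eqv f f" and eqv_sym: "eqv f g \<Longrightarrow> eqv g f" and eqv_trans: "eqv f g \<Longrightarrow> eqv g h \<Longrightarrow> eqv f h"
  unfolding eqv_iff by auto

lemma finite_hyps: "T \<in> forests\<^sub>0 \<gamma> \<alpha> \<alpha> \<Longrightarrow> finite (hyps T)"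
  using lions_forest0D(17) by (simp add: mem_iff)

text \<open>Measurability and mixed integrability are automatic on a finite index space, and the
  algebraic clauses are checked at every point.\<close>

lemma I_mem_chars:
  assumes s: "s \<in> {0..1}" and t: "t \<in> {0..1}"
  shows "I s t \<in> chars"
proof -
  have space: "space \<nu> = {1..N}" "space (hyp_space \<nu> T) = hyps T \<rightarrow>\<^sub>E {1..N}"
    "space (arg_space \<nu> T) = {1..N} \<times> (hyps T \<rightarrow>\<^sub>E {1..N})" for T
    using space_hyp_space[OF index_set] space_arg_space[OF index_set] by (simp_all add: \<nu> space_uniform_count_measure)
  have mem: "T \<in> forests\<^sub>0 \<gamma> \<alpha> \<alpha>" if "T \<in> forests \<gamma> \<alpha> \<alpha>" for T
    using that by (simp add: forests\<^sub>0_def)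
  show ?thesis
    unfolding mv_characters_def mem_Collect_eq
  proof (intro conjI ballI allI impI)
    fix T i \<iota> assume "T \<in> forests\<^sub>0 \<gamma> \<alpha> \<alpha>" "i \<in> space \<nu>" "\<iota> \<in> space (hyp_space \<nu> T)"
    then show "I s t T i \<iota> \<in> tensors (nodes T)" using I_tensors s t unfolding space by blast
  next
    fix T c assume "T \<in> forests\<^sub>0 \<gamma> \<alpha> \<alpha>"
    then show "(\<lambda>(i, \<iota>). I s t T i \<iota> c) \<in> borel_measurable (arg_space \<nu> T)"
      unfolding \<nu> by (intro borel_measurable_arg_space index_set finite_hyps)
  next
    fix T assume "T \<in> forests\<^sub>0 \<gamma> \<alpha> \<alpha>"
    then show "AE i in \<nu>. in_mixed_Lp \<nu> T (q T) (I s t T i)"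
      unfolding \<nu> by (intro AE_I2 in_mixed_Lp_uniform_count_measure index_set finite_hyps)
  next
    fix T and \<phi> :: "nat \<Rightarrow> nat" assume "T \<in> forests\<^sub>0 \<gamma> \<alpha> \<alpha>" "inj_on \<phi> (nodes T)"
    then show "AE (i, \<iota>) in arg_space \<nu> (relabel \<phi> T). \<forall>c.
        I s t (relabel \<phi> T) i \<iota> c = I s t T i (\<lambda>h\<in>hyps T. \<iota> (\<phi> ` h)) (c \<circ> \<phi>)"
      using I_relabel s t by (intro AE_I2) (auto simp: space simp del: forest_sel_simps)
  next
    show "AE (i, \<iota>) in arg_space \<nu> empty_forest. I s t empty_forest i \<iota> = (\<lambda>_. 1)"
    proof (rule AE_I2)
      fix x assume "x \<in> space (arg_space \<nu> empty_forest)"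
      then have "x \<in> {1..N} \<times> {\<lambda>_. undefined}" unfolding space by simp
      then show "case x of (i, \<iota>) \<Rightarrow> I s t empty_forest i \<iota> = (\<lambda>_. 1)" using I_empty[OF s t] by auto
    qed
  next
    fix T1 T2
    assume T: "lions_forest T1 \<and> lions_forest T2 \<and> nodes T1 \<inter> nodes T2 = {} \<and> fprod T1 T2 \<in> forests \<gamma> \<alpha> \<alpha>"
    then have "lions_forest0 T1" "lions_forest0 T2" "nodes T1 \<inter> nodes T2 = {}" "fprod T1 T2 \<in> forests\<^sub>0 \<gamma> \<alpha> \<alpha>"
      using mem by (auto simp: lions_forest_iff simp del: forest_sel_simps)
    then show "AE (i, \<iota>) in arg_space \<nu> (fprod T1 T2). I s t (fprod T1 T2) i \<iota> =
        tprod (I s t T1 i (restrict \<iota> (hyps T1))) (I s t T2 i (restrict \<iota> (hyps T2)))"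
      using I_fprod[OF s t] by (intro AE_I2) (auto simp: space simp del: forest_sel_simps)
  next
    fix T assume T: "T \<in> forests \<gamma> \<alpha> \<alpha>" "tagged T \<noteq> {} \<and> decouple T \<in> forests \<gamma> \<alpha> \<alpha>"
    then have "lions_forest0 T" "decouple T \<in> forests\<^sub>0 \<gamma> \<alpha> \<alpha>" "tagged T \<noteq> {}"
      using mem by (auto simp: forests_iff simp del: forest_sel_simps)
    then show "AE (i, \<iota>) in arg_space \<nu> (decouple T).
        I s t T (\<iota> (tagged T)) (restrict \<iota> (hyps T)) = I s t (decouple T) i \<iota>"
    proof (intro AE_I2)
      fix x assume "x \<in> space (arg_space \<nu> (decouple T))"
      then obtain i \<iota> where x: "x = (i, \<iota>)" "i \<in> {1..N}" "\<iota> \<in> hyps (decouple T) \<rightarrow>\<^sub>E {1..N}"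
        unfolding space by blast
      show "case x of (i, \<iota>) \<Rightarrow> I s t T (\<iota> (tagged T)) (restrict \<iota> (hyps T)) = I s t (decouple T) i \<iota>"
        unfolding x(1) prod.case
        by (rule I_decouple_tagged[OF s t x(2) \<open>lions_forest0 T\<close> \<open>tagged T \<noteq> {}\<close>
          \<open>decouple T \<in> forests\<^sub>0 \<gamma> \<alpha> \<alpha>\<close> x(3), symmetric])
    qed
  next
    fix T assume T: "T \<in> forests \<gamma> \<alpha> \<alpha>" "tagged T = {}"
    then show "AE (i, i', \<iota>) in \<nu> \<Otimes>\<^sub>M arg_space \<nu> T. I s t T i \<iota> = I s t T i' \<iota>"
    proof (intro AE_I2)
      fix x assume "x \<in> space (\<nu> \<Otimes>\<^sub>M arg_space \<nu> T)"
      then have "x \<in> {1..N} \<times> {1..N} \<times> (hyps T \<rightarrow>\<^sub>E {1..N})"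
        unfolding space_pair_measure[of \<nu> "arg_space \<nu> T"] space .
      then obtain i i' \<iota> where x: "x = (i, i', \<iota>)" "i \<in> {1..N}" "i' \<in> {1..N}" "\<iota> \<in> hyps T \<rightarrow>\<^sub>E {1..N}"
        by blast
      show "case x of (i, i', \<iota>) \<Rightarrow> I s t T i \<iota> = I s t T i' \<iota>"
        unfolding x(1) prod.case by (rule I_untagged[OF s t x(2,3) mem[OF T(1)] T(2) x(4)])
    qed
  qed
qed

text \<open>Cuts of a forest in the truncation stay there, so the summands only involve values that
  the equivalence controls. Products of classes can thus be computed on representatives.\<close>

lemma mv_conv_cong:
  assumes "eqv f f'" "eqv g g'"
  shows "eqv (mv_conv f g) (mv_conv f' g')"
  unfolding eqv_iff
proof (intro ballI)
  fix T i \<iota> assume T: "T \<in> forests\<^sub>0 \<gamma> \<alpha> \<alpha>" and i: "i \<in> {1..N}" and \<iota>: "\<iota> \<in> hyps T \<rightarrow>\<^sub>E {1..N}"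
  have "lions_forest0 T" using T by (simp add: mem_iff)
  then have *: "subforest T A \<in> forests\<^sub>0 \<gamma> \<alpha> \<alpha>" "hyp_args T A \<iota> \<in> hyps (subforest T A) \<rightarrow>\<^sub>E {1..N}"
    if "ancestor_closed T R" "A = R \<or> A = nodes T - R" for A R
    using mem_subforest[OF T that] hyp_args_PiE[OF _ \<iota>] by blast+
  show "mv_conv f g T i \<iota> = mv_conv f' g' T i \<iota>"
    unfolding mv_conv_def
  proof (intro ext sum.cong refl)
    fix c R assume "R \<in> {R. ancestor_closed T R}"
    then have R: "ancestor_closed T R" by simp
    have "f (subforest T (nodes T - R)) i (hyp_args T (nodes T - R) \<iota>) =
        f' (subforest T (nodes T - R)) i (hyp_args T (nodes T - R) \<iota>)"
      using assms(1) *[OF R disjI2[OF refl]] i unfolding eqv_iff by blast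
    moreover have "g (subforest T R) i (hyp_args T R \<iota>) = g' (subforest T R) i (hyp_args T R \<iota>)"
      using assms(2) *[OF R disjI1[OF refl]] i unfolding eqv_iff by blast
    ultimately show "tprod (f (subforest T (nodes T - R)) i (hyp_args T (nodes T - R) \<iota>))
        (g (subforest T R) i (hyp_args T R \<iota>)) c =
      tprod (f' (subforest T (nodes T - R)) i (hyp_args T (nodes T - R) \<iota>))
        (g' (subforest T R) i (hyp_args T R \<iota>)) c" by simp
  qed
qed

lemma cls_iff: "k \<in> cls f \<longleftrightarrow> k \<in> chars \<and> eqv f k"
  by (simp add: mv_class_def)

lemma cls_eq:
  assumes "eqv f g"
  shows "cls f = cls g"
proof (rule Set.set_eqI)
  fix k
  show "k \<in> cls f \<longleftrightarrow> k \<in> cls g"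
    unfolding cls_iff using eqv_trans[OF assms] eqv_trans[OF eqv_sym[OF assms]] by blast
qed

text \<open>The product in \<open>mv_group\<close> consists of all characters equivalent to a
  convolution of some representatives; by \<open>mv_conv_cong\<close> all these convolutions are
  equivalent to k.\<close>

lemma mult_cls:
  assumes "f \<in> chars" "g \<in> chars" "eqv (mv_conv f g) k"
  shows "cls f \<otimes>\<^bsub>G\<^esub> cls g = cls k"
proof -
  have "k' \<in> cls f \<otimes>\<^bsub>G\<^esub> cls g \<longleftrightarrow> k' \<in> chars \<and> (\<exists>f'\<in>cls f. \<exists>g'\<in>cls g. eqv (mv_conv f' g') k')" for k'
    by (simp add: mv_group_def)
  moreover have "(\<exists>f'\<in>cls f. \<exists>g'\<in>cls g. eqv (mv_conv f' g') k') \<longleftrightarrow> eqv k k'" for k'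
  proof
    assume "\<exists>f'\<in>cls f. \<exists>g'\<in>cls g. eqv (mv_conv f' g') k'"
    then obtain f' g' where "eqv f f'" "eqv g g'" "eqv (mv_conv f' g') k'" by (auto simp: cls_iff)
    then show "eqv k k'" using mv_conv_cong assms(3) eqv_sym eqv_trans by metis
  next
    assume "eqv k k'"
    then have "eqv (mv_conv f g) k'" using assms(3) eqv_trans by metis
    then show "\<exists>f'\<in>cls f. \<exists>g'\<in>cls g. eqv (mv_conv f' g') k'"
      using assms(1,2) eqv_refl cls_iff by blast
  qed
  ultimately show ?thesis by (auto simp: cls_iff)
qed

lemma chars_empty:
  assumes "f \<in> chars" "i \<in> {1..N}"
  shows "f empty_forest i (\<lambda>_. undefined) = (\<lambda>_. 1)"
proof -
  have "AE (i, \<iota>) in arg_space \<nu> empty_forest. f empty_forest i \<iota> = (\<lambda>_. 1)"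
    using assms(1) unfolding mv_characters_def by blast
  then show ?thesis using assms(2) by (subst (asm) AE_iff) auto
qed

text \<open>
  The cut \<open>R = nodes T\<close> contributes \<open>g T\<close> and all other cuts involve \<open>g\<close> on smaller forests only, so
  that convolution with a character from the left can be cancelled.
\<close>

lemma mv_conv_cancel:
  assumes "f \<in> chars" "eqv (mv_conv f g) (mv_conv f g')"
  shows "eqv g g'"
proof -
  have "\<forall>i\<in>{1..N}. \<forall>\<iota>\<in>hyps T \<rightarrow>\<^sub>E {1..N}. g T i \<iota> = g' T i \<iota>" if "T \<in> forests\<^sub>0 \<gamma> \<alpha> \<alpha>" for T
    using that
  proof (induction "card (nodes T)" arbitrary: T rule: less_induct)
    case less
    have T: "lions_forest0 T" using less.prems by (simp add: mem_iff)
    show ?case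
    proof (intro ballI ext)
      fix i \<iota> c assume i: "i \<in> {1..N}" and \<iota>: "\<iota> \<in> hyps T \<rightarrow>\<^sub>E {1..N}"
      let ?F = "\<lambda>g R. tprod (f (subforest T (nodes T - R)) i (hyp_args T (nodes T - R) \<iota>))
           (g (subforest T R) i (hyp_args T R \<iota>)) c"
      have conv: "mv_conv f g T i \<iota> c = g T i \<iota> c + (\<Sum>R\<in>{R. ancestor_closed T R} - {nodes T}. ?F g R)" for g
      proof -
        have "mv_conv f g T i \<iota> c = ?F g (nodes T) + (\<Sum>R\<in>{R. ancestor_closed T R} - {nodes T}. ?F g R)"
          unfolding mv_conv_def
          by (rule sum.remove) (use finite_ancestor_closed[OF T] ancestor_closed_simps(2)[OF T] in auto)
        moreover have "?F g (nodes T) = g T i \<iota> c"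
          by (simp add: tprod_def hyp_args_empty subforest_empty chars_empty[OF assms(1) i]
            subforest_nodes[OF T] hyp_args_nodes[OF T \<iota>])
        ultimately show ?thesis by simp
      qed
      have "?F g R = ?F g' R" if "R \<in> {R. ancestor_closed T R} - {nodes T}" for R
      proof -
        have R: "ancestor_closed T R" "R \<subset> nodes T" using that ancestor_closed_subset by auto
        have "card (nodes (subforest T R)) < card (nodes T)"
          using psubset_card_mono[OF lions_forest0D(2)[OF T] R(2)] by simp
        then have "g (subforest T R) i (hyp_args T R \<iota>) = g' (subforest T R) i (hyp_args T R \<iota>)"
          using less.hyps[OF _ mem_subforest[OF less.prems R(1) disjI1[OF refl]]] i hyp_args_PiE[OF T \<iota>] by blast
        then show ?thesis by simp
      qed
      moreover have "mv_conv f g T i \<iota> c = mv_conv f g' T i \<iota> c"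
        using assms(2) less.prems i \<iota> unfolding eqv_iff by metis
      ultimately show "g T i \<iota> c = g' T i \<iota> c" unfolding conv by simp
    qed
  qed
  then show ?thesis unfolding eqv_iff by blast
qed

lemma chen_eqv:
  "s \<in> {0..1} \<Longrightarrow> t \<in> {0..1} \<Longrightarrow> u \<in> {0..1} \<Longrightarrow> eqv (mv_conv (I s t) (I t u)) (I s u)"
  using chen unfolding eqv_iff by blast

lemma mult_I:
  "s \<in> {0..1} \<Longrightarrow> t \<in> {0..1} \<Longrightarrow> u \<in> {0..1} \<Longrightarrow> cls (I s t) \<otimes>\<^bsub>G\<^esub> cls (I t u) = cls (I s u)"
  by (intro mult_cls I_mem_chars chen_eqv)

lemma eqv_unit: "s \<in> {0..1} \<Longrightarrow> eqv (I s s) mv_unit"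
  unfolding eqv_iff using I_diagonal by blast

text \<open>Representing the unit by \<open>I s s\<close>, for whichever s is convenient, makes the
  two equations for an inverse instances of Chen's relation.\<close>

lemma one_G: "s \<in> {0..1} \<Longrightarrow> \<one>\<^bsub>G\<^esub> = cls (I s s)"
  using cls_eq[OF eqv_unit] by (simp add: mv_group_def)

text \<open>Going from 0 to s and back is covered by Chen's relation in both orders, so
  \<open>I s 0\<close> represents a two-sided inverse. For the description behind
  \<open>inv\<close>, any other candidate y is compared with it by cancelling \<open>I 0 s\<close>
  on the left.\<close>

lemma inv_I:
  assumes s: "s \<in> {0..1}"
  shows "inv\<^bsub>G\<^esub> (cls (I 0 s)) = cls (I s 0)"
  unfolding m_inv_def
proof (rule the_equality)
  have 0: "(0::real) \<in> {0..1}" by simp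
  show "cls (I s 0) \<in> carrier G \<and> cls (I 0 s) \<otimes>\<^bsub>G\<^esub> cls (I s 0) = \<one>\<^bsub>G\<^esub> \<and> cls (I s 0) \<otimes>\<^bsub>G\<^esub> cls (I 0 s) = \<one>\<^bsub>G\<^esub>"
    using mult_I[OF 0 s 0] mult_I[OF s 0 s] one_G[OF 0] one_G[OF s] I_mem_chars[OF s 0]
    by (simp add: mv_group_def)
  fix y assume y: "y \<in> carrier G \<and> cls (I 0 s) \<otimes>\<^bsub>G\<^esub> y = \<one>\<^bsub>G\<^esub> \<and> y \<otimes>\<^bsub>G\<^esub> cls (I 0 s) = \<one>\<^bsub>G\<^esub>"
  then obtain g where g: "g \<in> chars" "y = cls g" by (auto simp: mv_group_def)
  \<comment> \<open>The equation of classes only provides some representatives whose convolution is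
    equivalent to \<open>I 0 0\<close>; congruence then leads back to \<open>I 0 s\<close> and
    g.\<close>
  have "I 0 0 \<in> cls (I 0 s) \<otimes>\<^bsub>G\<^esub> cls g"
    using y g one_G[OF 0] I_mem_chars[OF 0 0] eqv_refl by (simp add: cls_iff)
  then obtain f' g' where fg: "eqv (I 0 s) f'" "eqv g g'" "eqv (mv_conv f' g') (I 0 0)"
    by (auto simp: mv_group_def cls_iff)
  have "eqv (mv_conv (I 0 s) g) (I 0 0)"
    by (rule eqv_trans[OF mv_conv_cong[OF fg(1,2)] fg(3)])
  then have "eqv (mv_conv (I 0 s) g) (mv_conv (I 0 s) (I s 0))"
    by (rule eqv_trans[OF _ eqv_sym[OF chen_eqv[OF 0 s 0]]])
  then show "y = cls (I s 0)"
    unfolding g(2) by (rule cls_eq[OF mv_conv_cancel[OF I_mem_chars[OF 0 s]]])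
qed

lemma increment_I:
  assumes "s \<in> {0..1}" "t \<in> {0..1}"
  shows "mv_increment \<nu> \<gamma> \<alpha> \<alpha> q (\<lambda>t. cls (I 0 t)) s t = cls (I s t)"
  unfolding mv_increment_def inv_I[OF assms(1)] by (rule mult_I) (use assms in simp_all)

text \<open>The square root of the number of multi-indices arises in passing from the bound on
  coordinates to the Euclidean norm. The exponent can be lowered from the number n of nodes to
  \<alpha> n since \<open>\<bar>t - s\<bar> \<le> 1\<close>.\<close>

lemma tnorm_I_le:
  assumes "0 \<le> K" "\<And>i r k. i \<in> {1..N} \<Longrightarrow> r \<in> {0..1} \<Longrightarrow> \<bar>path_deriv (w i) r $ k\<bar> \<le> K"
    and T: "T \<in> forests \<gamma> \<alpha> \<alpha>" and "\<alpha> \<le> 1"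
    and s: "s \<in> {0..1}" and t: "t \<in> {0..1}" and i: "i \<in> {1..N}" and \<iota>: "\<iota> \<in> hyps T \<rightarrow>\<^sub>E {1..N}"
  shows "tnorm (nodes T) (I s t T i \<iota>) \<le>
    sqrt (card (nodes T \<rightarrow>\<^sub>E (UNIV :: 'd set))) * K ^ card (nodes T) * \<bar>t - s\<bar> powr grading \<alpha> \<alpha> T"
proof -
  let ?n = "card (nodes T)" and ?C = "nodes T \<rightarrow>\<^sub>E (UNIV :: 'd set)" and ?x = "\<bar>t - s\<bar>"
  have T0: "T \<in> forests\<^sub>0 \<gamma> \<alpha> \<alpha>" and TS: "lions_forest0 T" "nodes T \<noteq> {}"
    using T by (simp_all add: forests\<^sub>0_def forests_iff)
  have n: "?n \<ge> 1" using TS lions_forest0D(2)[OF TS(1)] by (simp add: Suc_le_eq card_gt_0_iff)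
  have x: "0 \<le> ?x" "?x \<le> 1" using s t by auto
  have "?x ^ ?n \<le> ?x powr grading \<alpha> \<alpha> T"
  \<comment> \<open>In HOL \<open>0 powr a = 0\<close> for every a, while \<open>0 ^ 0 = 1\<close>;
    on the diagonal the inequality therefore rests on \<open>?n \<ge> 1\<close>.\<close>
  proof (cases "?x = 0")
    case True
    then show ?thesis using n by (simp add: power_0_left)
  next
    case False
    then have "?x ^ ?n = ?x powr real ?n" using x by (simp add: powr_realpow)
    also have "\<dots> \<le> ?x powr (\<alpha> * real ?n)"
      using x alpha \<open>\<alpha> \<le> 1\<close> by (intro powr_mono') (simp_all add: mult_left_le_one_le)
    finally show ?thesis by (simp add: grading_eq[OF TS(1)])
  qed
  then have B: "(K * ?x) ^ ?n \<le> K ^ ?n * ?x powr grading \<alpha> \<alpha> T"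
    using assms(1) by (simp add: power_mult_distrib mult_left_mono)
  have "(I s t T i \<iota> c)\<^sup>2 \<le> ((K * ?x) ^ ?n)\<^sup>2" for c
    using I_bound[OF assms(1,2) T0 s t i \<iota>, of c] by (simp add: abs_le_square_iff[symmetric])
  then have "(\<Sum>c\<in>?C. (I s t T i \<iota> c)\<^sup>2) \<le> real (card ?C) * ((K * ?x) ^ ?n)\<^sup>2"
    using sum_bounded_above[of ?C "\<lambda>c. (I s t T i \<iota> c)\<^sup>2" "((K * ?x) ^ ?n)\<^sup>2"] by simp
  then have "tnorm (nodes T) (I s t T i \<iota>) \<le> sqrt (real (card ?C) * ((K * ?x) ^ ?n)\<^sup>2)"
    unfolding tnorm_def by (rule real_sqrt_le_mono)
  also have "\<dots> = sqrt (card ?C) * (K * ?x) ^ ?n"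
    using assms(1) x by (simp add: real_sqrt_mult)
  also have "\<dots> \<le> sqrt (card ?C) * (K ^ ?n * ?x powr grading \<alpha> \<alpha> T)"
    by (rule mult_left_mono[OF B]) simp
  finally show ?thesis by (simp add: mult.assoc)
qed

text \<open>\<open>I\<close> itself is the choice of representatives of the increments. For a given
  T, one constant D then bounds the quotients for all s, t and all indices i.\<close>

lemma rough_path:
  assumes "\<alpha> \<le> 1" "mv_gamma \<alpha> \<alpha> = \<gamma>"
  shows "mv_rough_path \<nu> \<alpha> \<alpha> q (\<lambda>t. cls (I 0 t))"
  unfolding mv_rough_path_def Let_def assms(2)
proof (intro conjI exI[of _ I] ballI)
  fix t :: real assume t: "t \<in> {0..1}"
  show "cls (I 0 t) \<in> carrier G" using I_mem_chars[of 0 t] t by (simp add: mv_group_def)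
next
  fix s t u :: real assume "s \<in> {0..1}" "t \<in> {0..1}" "u \<in> {0..1}"
  then show "mv_increment \<nu> \<gamma> \<alpha> \<alpha> q (\<lambda>t. cls (I 0 t)) s t \<otimes>\<^bsub>G\<^esub> mv_increment \<nu> \<gamma> \<alpha> \<alpha> q (\<lambda>t. cls (I 0 t)) t u =
      mv_increment \<nu> \<gamma> \<alpha> \<alpha> q (\<lambda>t. cls (I 0 t)) s u"
    using increment_I mult_I by simp
next
  fix s t :: real assume st: "s \<in> {0..1}" "t \<in> {0..1}"
  show "I s t \<in> mv_increment \<nu> \<gamma> \<alpha> \<alpha> q (\<lambda>t. cls (I 0 t)) s t"
    unfolding increment_I[OF st] cls_iff using I_mem_chars[OF st] eqv_refl by blast
next
  fix T assume T: "T \<in> forests \<gamma> \<alpha> \<alpha>"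
  obtain K where K: "0 \<le> K" "\<And>i r k. i \<in> {1..N} \<Longrightarrow> r \<in> {0..1} \<Longrightarrow> \<bar>path_deriv (w i) r $ k\<bar> \<le> K"
    using exists_deriv_bound by blast
  define D where "D = sqrt (card (nodes T \<rightarrow>\<^sub>E (UNIV :: 'd set))) * K ^ card (nodes T)"
  have D: "0 \<le> D" using K(1) by (simp add: D_def)
  interpret prob_space "hyp_space \<nu> T"
    unfolding \<nu> by (intro prob_space_PiM prob_space_uniform_count_measure index_set)
  have le: "(\<integral>\<^sup>+ \<iota>. ennreal (tnorm (nodes T) (I s t T i \<iota>)) \<partial>hyp_space \<nu> T) /
      ennreal (\<bar>t - s\<bar> powr grading \<alpha> \<alpha> T) \<le> ennreal D"
    if st: "s \<in> {0..1}" "t \<in> {0..1}" and i: "i \<in> {1..N}" for s t i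
  proof -
    let ?y = "\<bar>t - s\<bar> powr grading \<alpha> \<alpha> T"
    have "(\<integral>\<^sup>+ \<iota>. ennreal (tnorm (nodes T) (I s t T i \<iota>)) \<partial>hyp_space \<nu> T) \<le>
        (\<integral>\<^sup>+ \<iota>. ennreal (D * ?y) \<partial>hyp_space \<nu> T)"
    proof (intro nn_integral_mono ennreal_leI)
      fix \<iota> assume "\<iota> \<in> space (hyp_space \<nu> T)"
      then have \<iota>: "\<iota> \<in> hyps T \<rightarrow>\<^sub>E {1..N}" using space_hyp_space[OF index_set] by (simp add: \<nu>)
      show "tnorm (nodes T) (I s t T i \<iota>) \<le> D * ?y"
        unfolding D_def by (rule tnorm_I_le[OF K(1) _ T assms(1) st i \<iota>]) (rule K(2))
    qed
    also have "\<dots> = ennreal (D * ?y)" by (simp add: emeasure_space_1)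
    finally have *: "(\<integral>\<^sup>+ \<iota>. ennreal (tnorm (nodes T) (I s t T i \<iota>)) \<partial>hyp_space \<nu> T) \<le> ennreal (D * ?y)" .
    show ?thesis
    \<comment> \<open>On the diagonal the numerator is at most 0, and 0 / 0 is 0 in
      \<open>ennreal\<close>.\<close>
    proof (cases "?y = 0")
      case True
      then show ?thesis using * by simp
    next
      case False
      then have y: "?y > 0" by simp
      have "(\<integral>\<^sup>+ \<iota>. ennreal (tnorm (nodes T) (I s t T i \<iota>)) \<partial>hyp_space \<nu> T) / ennreal ?y \<le>
          ennreal (D * ?y) / ennreal ?y"
        using * by (rule divide_right_mono_ennreal)
      also have "\<dots> = ennreal D" using y D by (simp add: divide_ennreal)
      finally show ?thesis .
    qed
  qed
  show "AE i in \<nu>. (SUP (s, t)\<in>{0..1} \<times> {0..1}.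
      (\<integral>\<^sup>+ \<iota>. ennreal (tnorm (nodes T) (I s t T i \<iota>)) \<partial>hyp_space \<nu> T) /
        ennreal (\<bar>t - s\<bar> powr grading \<alpha> \<alpha> T)) < \<infinity>"
  proof (rule AE_I2)
    fix i assume "i \<in> space \<nu>"
    then have i: "i \<in> {1..N}" by (simp add: \<nu> space_uniform_count_measure)
    have "(SUP (s, t)\<in>{0..1} \<times> {0..1}.
      (\<integral>\<^sup>+ \<iota>. ennreal (tnorm (nodes T) (I s t T i \<iota>)) \<partial>hyp_space \<nu> T) /
        ennreal (\<bar>t - s\<bar> powr grading \<alpha> \<alpha> T)) \<le> ennreal D"
      using le i by (intro SUP_least) auto
    also have "\<dots> < \<infinity>" by simp
    finally show "(SUP (s, t)\<in>{0..1} \<times> {0..1}.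
      (\<integral>\<^sup>+ \<iota>. ennreal (tnorm (nodes T) (I s t T i \<iota>)) \<partial>hyp_space \<nu> T) /
        ennreal (\<bar>t - s\<bar> powr grading \<alpha> \<alpha> T)) < \<infinity>" .
  qed
qed

end

end

theorem proposition3p5:
  fixes \<alpha> \<gamma> q' :: real
    and p q :: "lforest \<Rightarrow> nat set \<Rightarrow> real"
    and \<mu> :: "(real \<Rightarrow> real ^ 'd::finite) measure"
    and N :: nat
    and P :: "'w measure"
    and W :: "nat \<Rightarrow> 'w \<Rightarrow> real \<Rightarrow> real ^ 'd"
    and \<nu> :: "nat measure"
    and I :: "'w \<Rightarrow> real \<Rightarrow> real \<Rightarrow> (nat, 'd) mv_family"
  assumes alpha: "0 < \<alpha>" "\<alpha> \<le> 1"
    and gamma: "\<gamma> = Sup {real i * \<alpha> | i. real i * \<alpha> \<le> 1}"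
    and q': "q' > real_of_int \<lfloor>\<gamma> / \<alpha>\<rfloor>" "\<lfloor>\<gamma> / \<alpha>\<rfloor> \<ge> 1"
    and pq: "dual_integrability \<gamma> \<alpha> \<alpha> p q"
    and q: "\<And>T h. T \<in> forests \<gamma> \<alpha> \<alpha> \<Longrightarrow> h \<in> hyps T \<Longrightarrow> q T h = q' / real (card h)"
    and mu: "prob_space \<mu>" "sets \<mu> = sets c1_borel"
    and moment: "integrable \<mu> (\<lambda>x. c1_norm x powr q')"
    and N: "N \<ge> 1"
    and P: "prob_space P"
    and W: "\<And>i. i \<in> {1..N} \<Longrightarrow> W i \<in> measurable P c1_borel"
    and law: "\<And>i. i \<in> {1..N} \<Longrightarrow> distr P c1_borel (W i) = \<mu>"
    and nu: "\<nu> = uniform_count_measure {1..N}"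
    and I: "\<And>\<omega>. \<omega> \<in> space P \<Longrightarrow> iterated_integrals N \<gamma> \<alpha> (\<lambda>i. W i \<omega>) (I \<omega>)"
  shows "AE \<omega> in P.
    (\<forall>t\<in>{0..1}. I \<omega> 0 t \<in> mv_characters \<nu> \<gamma> \<alpha> \<alpha> q) \<and>
    (\<forall>s\<in>{0..1}. \<forall>t\<in>{0..1}. \<forall>u\<in>{0..1}.
       \<forall>T\<in>forests\<^sub>0 \<gamma> \<alpha> \<alpha>. \<forall>i\<in>{1..N}. \<forall>\<iota>\<in>hyps T \<rightarrow>\<^sub>E {1..N}.
         mv_conv (I \<omega> s t) (I \<omega> t u) T i \<iota> = I \<omega> s u T i \<iota>) \<and>
    mv_rough_path \<nu> \<alpha> \<alpha> q (\<lambda>t. mv_class \<nu> \<gamma> \<alpha> \<alpha> q (I \<omega> 0 t))"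
proof (rule AE_I2)
  fix \<omega> assume \<omega>: "\<omega> \<in> space P"
  interpret J: iterated_integral_family N \<gamma> \<alpha> "\<lambda>i. W i \<omega>" "I \<omega>"
  proof
    \<comment> \<open>A measurable map takes values in the space of its target, and that of
      \<open>c1_borel\<close> is \<open>c1_space\<close>.\<close>
    show "W i \<omega> \<in> c1_space" if "i \<in> {1..N}" for i
      using measurable_space[OF W[OF that] \<omega>] by (simp add: c1_borel_def space_measure_of_conv)
  qed (use alpha mv_gamma_eq[OF alpha gamma] I[OF \<omega>] in auto)
  show "(\<forall>t\<in>{0..1}. I \<omega> 0 t \<in> mv_characters \<nu> \<gamma> \<alpha> \<alpha> q) \<and>
    (\<forall>s\<in>{0..1}. \<forall>t\<in>{0..1}. \<forall>u\<in>{0..1}.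
       \<forall>T\<in>forests\<^sub>0 \<gamma> \<alpha> \<alpha>. \<forall>i\<in>{1..N}. \<forall>\<iota>\<in>hyps T \<rightarrow>\<^sub>E {1..N}.
         mv_conv (I \<omega> s t) (I \<omega> t u) T i \<iota> = I \<omega> s u T i \<iota>) \<and>
    mv_rough_path \<nu> \<alpha> \<alpha> q (\<lambda>t. mv_class \<nu> \<gamma> \<alpha> \<alpha> q (I \<omega> 0 t))"
    using J.I_mem_chars[OF N nu] J.chen J.rough_path[OF N nu alpha(2) mv_gamma_eq(1)[OF alpha gamma]]
    by (intro conjI ballI) auto
qed

end
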